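(* Let $G$ be one of the finite Coxeter groups $E_6,E_7,E_8,F_4,H_3,H_4$, and let $C$ be a conjugation-closed subset of $G$. Then the conjugation quandle $\mathrm{Conj}(G,C)$ satisfies the Hayashi property.
   Context: $E_6,E_7,E_8,F_4,H_3,H_4$ denote the finite irreducible Coxeter groups (finite real reflection groups) of the indicated types. For a group $G$ and a conjugation-closed subset $C\subseteq G$, the conjugation quandle $\mathrm{Conj}(G,C)$ is the set $C$ with the binary operation $x\triangleright y=yxy^{-1}$. For $y\in C$ the right translation is the permutation $R_y:C\to C$, $R_y(x)=x\triangleright y=yxy^{-1}$. A permutation of a finite set whose disjoint cycles (fixed points included as cycles of length $1$) have the distinct lengths $\lambda_1<\lambda_2<\dots<\lambda_t$ is called regular if $\lambda_i$ divides $\lambda_t$ for all $1\le i\le t$. A finite quandle satisfies the Hayashi property if all of its right translations are regular permutations. *)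

theory Defs
  imports "HOL-Algebra.Generated_Groups" "HOL-Combinatorics.Orbits"
begin

section \<open>Coxeter groups\<close>

text \<open>
  Words over \<open>I\<close> modulo the Coxeter relations \<open>(i j)\<^bsup>m i j\<^esup> = 1\<close>. Since \<open>m i i = 1\<close> gives \<open>i i = 1\<close>,
  formal inverses are not needed: the monoid presented here is the group presented by the same
  relations. An entry \<open>m i j = 0\<close> would impose no relation.
\<close>

inductive coxeter_eq :: "'i set \<Rightarrow> ('i \<Rightarrow> 'i \<Rightarrow> nat) \<Rightarrow> 'i list \<Rightarrow> 'i list \<Rightarrow> bool"
  for I :: "'i set" and m :: "'i \<Rightarrow> 'i \<Rightarrow> nat" where
  relator: "\<lbrakk>i \<in> I; j \<in> I; u \<in> lists I; v \<in> lists I\<rbrakk>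
    \<Longrightarrow> coxeter_eq I m (u @ concat (replicate (m i j) [i, j]) @ v) (u @ v)"
| refl: "u \<in> lists I \<Longrightarrow> coxeter_eq I m u u"
| sym: "coxeter_eq I m u v \<Longrightarrow> coxeter_eq I m v u"
| trans: "\<lbrakk>coxeter_eq I m u v; coxeter_eq I m v w\<rbrakk> \<Longrightarrow> coxeter_eq I m u w"

definition word_prod :: "('g, 'x) monoid_scheme \<Rightarrow> ('i \<Rightarrow> 'g) \<Rightarrow> 'i list \<Rightarrow> 'g" where
  "word_prod G s w = foldr (\<lambda>i g. s i \<otimes>\<^bsub>G\<^esub> g) w \<one>\<^bsub>G\<^esub>"

text \<open>
  \<open>G\<close> is presented by the generators \<open>s i\<close> (\<open>i \<in> I\<close>) and the relations
  \<open>(s i s j)\<^bsup>m i j\<^esup> = 1\<close>: two words have the same value in \<open>G\<close> exactly if the relations force it.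
\<close>

definition coxeter_system ::
    "('g, 'x) monoid_scheme \<Rightarrow> 'i set \<Rightarrow> ('i \<Rightarrow> 'g) \<Rightarrow> ('i \<Rightarrow> 'i \<Rightarrow> nat) \<Rightarrow> bool" where
  "coxeter_system G I s m \<longleftrightarrow>
     group G \<and> s ` I \<subseteq> carrier G \<and> generate G (s ` I) = carrier G \<and>
     (\<forall>u\<in>lists I. \<forall>v\<in>lists I. word_prod G s u = word_prod G s v \<longleftrightarrow> coxeter_eq I m u v)"

datatype coxeter_type = E6 | E7 | E8 | F4 | H3 | H4

fun coxeter_rank :: "coxeter_type \<Rightarrow> nat" where
  "coxeter_rank E6 = 6"
| "coxeter_rank E7 = 7"
| "coxeter_rank E8 = 8"
| "coxeter_rank F4 = 4"
| "coxeter_rank H3 = 3"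
| "coxeter_rank H4 = 4"

text \<open>The edges \<open>(i, j)\<close>, \<open>i < j\<close>, of the Coxeter diagrams with their labels, nodes as in Bourbaki.\<close>

fun coxeter_diagram :: "coxeter_type \<Rightarrow> ((nat \<times> nat) \<times> nat) list" where
  "coxeter_diagram E6 = [((1,3),3), ((3,4),3), ((2,4),3), ((4,5),3), ((5,6),3)]"
| "coxeter_diagram E7 = [((1,3),3), ((3,4),3), ((2,4),3), ((4,5),3), ((5,6),3), ((6,7),3)]"
| "coxeter_diagram E8 = [((1,3),3), ((3,4),3), ((2,4),3), ((4,5),3), ((5,6),3), ((6,7),3), ((7,8),3)]"
| "coxeter_diagram F4 = [((1,2),3), ((2,3),4), ((3,4),3)]"
| "coxeter_diagram H3 = [((1,2),5), ((2,3),3)]"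
| "coxeter_diagram H4 = [((1,2),5), ((2,3),3), ((3,4),3)]"

definition coxeter_matrix :: "coxeter_type \<Rightarrow> nat \<Rightarrow> nat \<Rightarrow> nat" where
  "coxeter_matrix t i j =
     (if i = j then 1
      else case map_of (coxeter_diagram t) (min i j, max i j) of Some k \<Rightarrow> k | None \<Rightarrow> 2)"

definition coxeter_group_of_type :: "coxeter_type \<Rightarrow> ('g, 'x) monoid_scheme \<Rightarrow> bool" where
  "coxeter_group_of_type t G \<longleftrightarrow>
     (\<exists>s. coxeter_system G {1..coxeter_rank t} s (coxeter_matrix t))"


section \<open>Quandles and the Hayashi property\<close>

record 'a quandle = "'a partial_object" +
  qop :: "'a \<Rightarrow> 'a \<Rightarrow> 'a"

definition right_translation :: "('a, 'x) quandle_scheme \<Rightarrow> 'a \<Rightarrow> 'a \<Rightarrow> 'a" where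
  "right_translation Q y = (\<lambda>x. qop Q x y)"

definition is_quandle :: "('a, 'x) quandle_scheme \<Rightarrow> bool" where
  "is_quandle Q \<longleftrightarrow>
     (\<forall>x\<in>carrier Q. qop Q x x = x) \<and>
     (\<forall>y\<in>carrier Q. bij_betw (right_translation Q y) (carrier Q) (carrier Q)) \<and>
     (\<forall>x\<in>carrier Q. \<forall>y\<in>carrier Q. \<forall>z\<in>carrier Q.
        qop Q (qop Q x y) z = qop Q (qop Q x z) (qop Q y z))"

text \<open>The cycle of a permutation \<open>f\<close> of \<open>A\<close> through \<open>x \<in> A\<close> is the orbit of \<open>x\<close> under \<open>f\<close>.\<close>

definition cycle_lengths :: "'a set \<Rightarrow> ('a \<Rightarrow> 'a) \<Rightarrow> nat set" where
  "cycle_lengths A f = (\<lambda>x. card (Orbits.orbit f x)) ` A"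

definition regular_permutation :: "'a set \<Rightarrow> ('a \<Rightarrow> 'a) \<Rightarrow> bool" where
  "regular_permutation A f \<longleftrightarrow>
     finite A \<and> bij_betw f A A \<and>
     (\<forall>l\<in>cycle_lengths A f. l dvd Max (cycle_lengths A f))"

definition hayashi :: "('a, 'x) quandle_scheme \<Rightarrow> bool" where
  "hayashi Q \<longleftrightarrow>
     is_quandle Q \<and> finite (carrier Q) \<and>
     (\<forall>y\<in>carrier Q. regular_permutation (carrier Q) (right_translation Q y))"

definition conjugation_closed :: "('g, 'x) monoid_scheme \<Rightarrow> 'g set \<Rightarrow> bool" where
  "conjugation_closed G C \<longleftrightarrow>
     C \<subseteq> carrier G \<and> (\<forall>g\<in>carrier G. \<forall>x\<in>C. g \<otimes>\<^bsub>G\<^esub> x \<otimes>\<^bsub>G\<^esub> inv\<^bsub>G\<^esub> g \<in> C)"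

definition conj_quandle :: "('g, 'x) monoid_scheme \<Rightarrow> 'g set \<Rightarrow> 'g quandle" where
  "conj_quandle G C =
     \<lparr>carrier = C, qop = (\<lambda>x y. y \<otimes>\<^bsub>G\<^esub> x \<otimes>\<^bsub>G\<^esub> inv\<^bsub>G\<^esub> y)\<rparr>"

end

theory Submission
  imports Defs "HOL-Analysis.Linear_Algebra" "HOL-Computational_Algebra.Primes"
begin

text \<open>
  Let \<open>y \<in> G\<close> have order \<open>n\<close> modulo the centre. All cycle lengths of \<open>R\<^sub>y\<close> divide \<open>n\<close>, so nothing
  is to be shown if \<open>n\<close> is a prime power; otherwise a conjugate of \<open>y\<close> is found whose cycle has length
  exactly \<open>n\<close>, that is, which commutes with none of the powers \<open>z\<^sub>p = y\<^bsup>n/p\<^esup>\<close>, \<open>p\<close> a prime divisor of \<open>n\<close>.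

  In the reflection representation, suppose that \<open>a\<close> is a root with \<open>z\<^sub>p a \<noteq> \<plusminus>a\<close> for all \<open>p\<close>. If \<open>z\<^sub>p\<close>
  commutes with \<open>r\<^sub>a y r\<^sub>a\<close>, then the plane spanned by \<open>a\<close> and \<open>z\<^sub>p a\<close> is invariant under \<open>y\<close>, and the
  few possible angles between roots yield \<open>y\<^sup>l a = \<plusminus>a\<close> for some \<open>l \<in> {2, 3, 5}\<close>; then \<open>z\<^sub>q a = \<plusminus>a\<close>
  for every \<open>q \<noteq> l\<close>, a contradiction. So \<open>r\<^sub>a y r\<^sub>a\<close> is the conjugate wanted.

  Such a root \<open>a\<close> exists because the root system is irreducible: for two primes this is a connectedness
  argument, for three primes a failure would produce nine linearly independent vectors, and four primes
  would require \<open>y\<close>-orbits with more than 240 roots in total.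
\<close>

section \<open>Automorphisms of irreducible root systems\<close>

text \<open>No conjugacy classes are listed; E8 alone has 696729600 elements. What is used of a type
  is an irreducible root system with Cartan numbers in \<open>cartan_values\<close>, in dimension at
  most 8 and with at most 240 roots; E8 attains both bounds. The order is taken modulo the centre
  because conjugation by \<open>y\<close> has exactly this order on the group, and roots are
  compared up to sign because central elements act on each root by a sign. The obstacle is to serve
  all prime divisors of \<open>n\<close> by one root. A reflection can merge roots moved for two
  different primes, but nothing as simple controls a third. If no root is moved for three primes,
  the angles in the orbits become rigid: orbits of lengths at least 3 and 5 through a common root,
  together with two further roots, do not fit into dimension 8. The groups are given by
  presentations only. That the reflection representation is faithful and the group finite is
  therefore part of the proof, and the root systems come from an enumeration checked by evaluation,
  with E6 and E7 inside E8 and H3 inside H4.\<close>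

definition refl_along :: "'v::real_inner \<Rightarrow> 'v \<Rightarrow> 'v" where
  "refl_along a v = v - (2 * (v \<bullet> a) / (a \<bullet> a)) *\<^sub>R a"

definition golden :: real where
  "golden = (1 + sqrt 5) / 2"

text \<open>\<open>golden\<close> is 2 cos(pi/5) and \<open>golden - 1\<close> is 2 cos(2 pi/5). The
  values 2 and -2 come from a root paired with itself or its negative and, in F4, from a long and a
  short root. One set for all types avoids separating the crystallographic types from H3 and
  H4.\<close>

definition cartan_values :: "real set" where
  "cartan_values = {0, 1, -1, 2, -2, golden, -golden, golden - 1, 1 - golden}"

lemma golden_sq: "golden * golden = golden + 1"
proof -
  have "sqrt 5 * sqrt 5 = (5::real)" by simp
  then show ?thesis unfolding golden_def by (simp add: field_simps)
qed

lemma golden_bounds: "1618 < 1000 * golden" "10000 * golden < 16181"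
proof -
  have "2236 / 1000 < sqrt (5::real)" by (rule real_less_rsqrt) (simp add: power2_eq_square)
  then show "1618 < 1000 * golden" unfolding golden_def by simp
  have "sqrt (5::real) < 22362 / 10000" by (rule real_less_lsqrt) (simp_all add: power2_eq_square)
  then show "10000 * golden < 16181" unfolding golden_def by simp
qed

text \<open>Apart from 2 and -2 the values are twice the cosines of multiples of pi/2, pi/3 or pi/5.
  The quadratic relation of \<open>d\<close> decides which power of a rotation with trace
  \<open>d\<close> is a sign.\<close>

lemma cartan_values_sq:
  assumes "d \<in> cartan_values"
  shows "d = 0 \<or> d * d = 1 \<or> d * d = d + 1 \<or> d * d = 1 - d \<or> d = 2 \<or> d = -2"
  using assms
  by (auto simp: cartan_values_def left_diff_distrib right_diff_distrib golden_sq)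

lemma linear_refl_along: "linear (refl_along a)"
  by (rule linearI) (simp_all add: refl_along_def inner_add_left algebra_simps add_divide_distrib)

text \<open>At \<open>a = 0\<close> the quotient is 0 by convention and the reflection is the
  identity; the case distinctions on \<open>a = 0\<close> come from this.\<close>

lemma refl_along_self: "refl_along a a = - a"
  by (cases "a = 0") (simp_all add: refl_along_def scaleR_2)

lemma refl_along_inner:
  "refl_along a v \<bullet> w = v \<bullet> w - 2 * (v \<bullet> a) / (a \<bullet> a) * (a \<bullet> w)"
  by (simp add: refl_along_def inner_diff_left)

lemma inner_refl_along: "refl_along a v \<bullet> refl_along a w = v \<bullet> w"
  by (cases "a = 0")
    (simp_all add: refl_along_def inner_diff_left inner_diff_right inner_commute field_simps)

lemma orthogonal_transformation_refl_along: "orthogonal_transformation (refl_along a)"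
  by (simp add: orthogonal_transformation_def linear_refl_along inner_refl_along)

lemma refl_along_involution [simp]: "refl_along a (refl_along a v) = v"
proof (cases "a = 0")
  case False
  then have "refl_along a v \<bullet> a = - (v \<bullet> a)"
    by (simp add: refl_along_inner)
  then show ?thesis
    by (simp add: refl_along_def[of a "refl_along a v"]) (simp add: refl_along_def)
qed (simp add: refl_along_def)

lemma orthogonal_transformation_refl_along_image:
  assumes "orthogonal_transformation f"
  shows "f (refl_along a v) = refl_along (f a) (f v)"
  using assms
  by (simp add: refl_along_def orthogonal_transformation_def linear_diff linear_scale)

lemma orthogonal_transformation_funpow:
  fixes f :: "'v::real_inner \<Rightarrow> 'v"
  assumes "orthogonal_transformation f"
  shows "orthogonal_transformation (f ^^ k)"
proof (induction k)
  case 0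
  show ?case by (simp add: orthogonal_transformation_def linear_id)
next
  case (Suc k)
  then show ?case using orthogonal_transformation_compose[OF assms Suc] by (simp add: o_def)
qed

text \<open>The sign is ignored because an orthogonal \<open>f\<close> commutes with the reflection
  in a nonzero \<open>a\<close> exactly if \<open>f a\<close> is \<open>a\<close> or
  \<open>- a\<close>.\<close>

definition moved :: "'v::real_inner set \<Rightarrow> ('v \<Rightarrow> 'v) \<Rightarrow> 'v set" where
  "moved R f = {a \<in> R. f a \<noteq> a \<and> f a \<noteq> - a}"

text \<open>Lengths may differ (F4) and Cartan numbers need not be integers (H3, H4). Irreducibility
  is phrased by paths with non-orthogonal neighbours, the form on which induction works.\<close>

locale root_set =
  fixes R :: "'v::euclidean_space set"
  assumes finite_roots: "finite R"
    and nonzero: "0 \<notin> R"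
    and refl_closed: "a \<in> R \<Longrightarrow> b \<in> R \<Longrightarrow> refl_along a b \<in> R"
    and cartan: "a \<in> R \<Longrightarrow> b \<in> R \<Longrightarrow> 2 * (b \<bullet> a) / (a \<bullet> a) \<in> cartan_values"
    and connected: "a \<in> R \<Longrightarrow> b \<in> R \<Longrightarrow> (a, b) \<in> {(x, y). x \<in> R \<and> y \<in> R \<and> x \<bullet> y \<noteq> 0}\<^sup>*"
begin

lemma norm_pos: "a \<in> R \<Longrightarrow> 0 < a \<bullet> a"
  using nonzero by auto

lemma uminus_root: "a \<in> R \<Longrightarrow> - a \<in> R"
  using refl_closed[of a a] by (simp add: refl_along_self)

text \<open>\<open>f\<close> commutes with the reflection in an unmoved root, so this reflection
  carries moved roots to moved roots.\<close>

lemma moved_refl_along: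
  assumes f: "orthogonal_transformation f"
    and a: "a \<in> R" "a \<notin> moved R f" and b: "b \<in> moved R f" and ab: "a \<bullet> b \<noteq> 0"
  shows "refl_along a b \<in> moved R f"
proof -
  define c where "c = 2 * (b \<bullet> a) / (a \<bullet> a)"
  have r: "refl_along a b = b - c *\<^sub>R a" by (simp add: refl_along_def c_def)
  have bR: "b \<in> R" using b by (simp add: moved_def)
  have lin: "linear f" using f by (simp add: orthogonal_transformation_def)
  have inn: "f v \<bullet> f w = v \<bullet> w" for v w using f by (simp add: orthogonal_transformation_def)
  obtain e :: real where e: "f a = e *\<^sub>R a" "e = 1 \<or> e = -1"
    using a by (force simp: moved_def)
  have fr: "f (refl_along a b) = f b - (c * e) *\<^sub>R a"
    by (simp add: r linear_diff[OF lin] linear_scale[OF lin] e)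
  have b': "f b \<noteq> b" "f b \<noteq> - b" using b by (auto simp: moved_def)
  have 1: "f (refl_along a b) \<noteq> e *\<^sub>R refl_along a b"
    using e(2) b' unfolding fr by (auto simp: r algebra_simps)
  \<comment> \<open>The opposite sign is excluded by pairing with \<open>f a\<close>: the relation
    becomes b . a = 3 (b . a).\<close>
  have 2: "f (refl_along a b) \<noteq> - (e *\<^sub>R refl_along a b)"
  proof
    assume "f (refl_along a b) = - (e *\<^sub>R refl_along a b)"
    then have "f b = (2 * c * e) *\<^sub>R a - e *\<^sub>R b"
      unfolding fr by (simp add: r algebra_simps) (simp add: scaleR_2 [symmetric] algebra_simps flip: scaleR_add_left)
    then have "f b \<bullet> f a = (2 * c * e * e) * (a \<bullet> a) - e * e * (b \<bullet> a)"
      unfolding e(1) by (simp add: inner_diff_left right_diff_distrib mult_ac)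
    moreover have "e * e = 1" using e(2) by auto
    ultimately have "b \<bullet> a = 2 * c * (a \<bullet> a) - b \<bullet> a"
      by (simp add: inn mult.assoc)
    then have "b \<bullet> a = 0"
      using norm_pos[OF a(1)] by (simp add: c_def)
    then show False using ab by (simp add: inner_commute)
  qed
  from 1 2 e(2) have "f (refl_along a b) \<noteq> refl_along a b" "f (refl_along a b) \<noteq> - refl_along a b"
    by auto
  then show ?thesis using refl_closed[OF a(1) bR] by (simp add: moved_def)
qed

text \<open>Having a moved neighbour propagates along a path. If the next root \<open>y\<close> is
  orthogonal to the moved neighbour \<open>b\<close> of \<open>x\<close>, then either
  \<open>x\<close> itself is moved, or reflecting \<open>b\<close> in \<open>x\<close> adds a
  nonzero multiple of \<open>x\<close>, which \<open>y\<close> sees.\<close>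

lemma moved_neighbour:
  assumes f: "orthogonal_transformation f" and ne: "moved R f \<noteq> {}" and a: "a \<in> R"
  shows "\<exists>b\<in>moved R f. a \<bullet> b \<noteq> 0"
proof -
  obtain b where b: "b \<in> moved R f" using ne by auto
  then have bR: "b \<in> R" by (simp add: moved_def)
  from connected[OF bR a] show ?thesis
  proof (induction rule: rtrancl_induct)
    case base
    then show ?case using b norm_pos[OF bR] by (intro bexI[of _ b]) auto
  next
    case (step x y)
    then have x: "x \<in> R" "y \<in> R" "x \<bullet> y \<noteq> 0" by auto
    obtain b where b: "b \<in> moved R f" "x \<bullet> b \<noteq> 0" using step by auto
    show ?case
    proof (cases "y \<bullet> b = 0")
      case False
      then show ?thesis using b by auto
    next
      case orth: True
      show ?thesis
      proof (cases "x \<in> moved R f")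
        case True
        then show ?thesis using x by (auto simp: inner_commute)
      next
        case False
        then have "refl_along x b \<in> moved R f"
          using moved_refl_along f x b by blast
        moreover have "y \<bullet> refl_along x b \<noteq> 0"
          using orth x b norm_pos[OF x(1)]
          by (simp add: refl_along_def inner_diff_right inner_commute)
        ultimately show ?thesis by auto
      qed
    qed
  qed
qed

text \<open>On the plane of \<open>a\<close> and \<open>f a\<close> the isometry \<open>f\<close>
  has determinant \<open>- u\<close> and trace \<open>v\<close>. Determinant -1 makes it a
  reflection; determinant 1 makes it a rotation whose trace is the Cartan number of the two roots,
  which leaves few possible orders.\<close>

lemma cartan_recurrence:
  assumes f: "orthogonal_transformation f" and a: "a \<in> R" "f a \<in> R"
    and span: "f (f a) = u *\<^sub>R a + v *\<^sub>R f a" and ind: "f a \<noteq> a" "f a \<noteq> - a"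
  shows "\<exists>l\<in>{2,3,5::nat}. (f ^^ l) a = a \<or> (f ^^ l) a = - a"
proof -
  define N where "N = a \<bullet> a"
  define h where "h = a \<bullet> f a"
  have lin: "linear f" using f by (simp add: orthogonal_transformation_def)
  have inn: "f v \<bullet> f w = v \<bullet> w" for v w using f by (simp add: orthogonal_transformation_def)
  have N: "N > 0" using norm_pos a by (simp add: N_def)
  have ffa: "f a \<bullet> f a = N" "f (f a) \<bullet> f (f a) = N" "f a \<bullet> f (f a) = h" 
    by (simp_all add: inn N_def h_def)
  have "(f a - a) \<bullet> (f a - a) > 0" "(f a + a) \<bullet> (f a + a) > 0"
    using ind by (simp_all add: add_eq_0_iff2)
  then have "2 * N - 2 * h > 0" "2 * N + 2 * h > 0"
    using ffa by (simp_all add: inner_diff_left inner_diff_right inner_add_left inner_add_right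
        inner_commute N_def h_def)
  then have hN: "-N < h" "h < N" by simp_all
  have e1: "h = u * h + v * N"
  proof -
    have "f a \<bullet> f (f a) = u * (f a \<bullet> a) + v * (f a \<bullet> f a)"
      by (simp add: span inner_add_right)
    then show ?thesis using ffa by (simp add: h_def inner_commute)
  qed
  have e2: "N = u * u * N + v * v * N + 2 * u * v * h"
  proof -
    have "f (f a) \<bullet> f (f a) = u * u * (a \<bullet> a) + v * v * (f a \<bullet> f a) + 2 * u * v * (a \<bullet> f a)"
      by (simp add: span inner_add_right inner_add_left inner_commute algebra_simps)
    then show ?thesis using ffa by (simp add: h_def N_def)
  qed
  \<comment> \<open>\<open>v\<close> is eliminated. Strict Cauchy-Schwarz makes the second factor
    nonzero, which leaves \<open>u = 1\<close> or \<open>u = -1\<close>.\<close>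
  have "(1 - u * u) * (N * N - h * h) = 0"
  proof -
    have v: "v * N = h * (1 - u)" using e1 by (simp add: algebra_simps)
    have "N * N = u * u * N * N + (v * N) * (v * N) + 2 * u * (v * N) * h"
      using arg_cong[OF e2, of "\<lambda>x. x * N"] by (simp add: algebra_simps)
    then show ?thesis unfolding v by (simp add: algebra_simps)
  qed
  moreover have "N * N - h * h \<noteq> 0"
  proof -
    have "(N - h) * (N + h) > 0" using hN by simp
    then show ?thesis by (simp add: algebra_simps)
  qed
  ultimately have "1 - u * u = 0" by (metis mult_eq_0_iff)
  then have "(1 - u) * (1 + u) = 0" by (simp add: algebra_simps)
  then consider "u = 1" | "u = -1" by fastforce
  then show ?thesis
  proof cases
    case 1
    then have "v = 0" using e1 N by simp
    then have "(f ^^ 2) a = a" using 1 span by (simp add: numeral_2_eq_2)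
    then show ?thesis by blast
  next
    case 2
    define d where "d = 2 * (f a \<bullet> a) / (a \<bullet> a)"
    have "v = d" using e1 2 N by (simp add: d_def N_def h_def inner_commute field_simps)
    then have rec: "f (f a) = d *\<^sub>R f a - a" using span 2 by simp
    have dv: "d \<in> cartan_values" unfolding d_def using cartan a by blast
    have d2: "d \<noteq> 2" "d \<noteq> -2"
      using hN N by (auto simp: d_def h_def N_def inner_commute field_simps)
    \<comment> \<open>The coefficients obey the Chebyshev recurrence with parameter
      \<open>d\<close>; the quadratic relation of \<open>d\<close> collapses the second, third or
      fifth iterate to a sign.\<close>
    have step: "f (x *\<^sub>R f a - y *\<^sub>R a) = (d * x - y) *\<^sub>R f a - x *\<^sub>R a" for x y
      by (simp only: linear_diff[OF lin] linear_scale[OF lin] rec) (simp add: algebra_simps)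
    have f3: "f (f (f a)) = (d * d - 1) *\<^sub>R f a - d *\<^sub>R a"
      using step[of d 1] rec by simp
    have f4: "f (f (f (f a))) = (d * (d * d - 1) - d) *\<^sub>R f a - (d * d - 1) *\<^sub>R a"
      unfolding f3 by (rule step)
    have f5: "f (f (f (f (f a)))) = (d * (d * (d * d - 1) - d) - (d * d - 1)) *\<^sub>R f a
        - (d * (d * d - 1) - d) *\<^sub>R a"
      unfolding f4 by (rule step)
    have "d = 0 \<or> d * d = 1 \<or> d * d = d + 1 \<or> d * d = 1 - d"
      using cartan_values_sq[OF dv] d2 by blast
    then show ?thesis
    proof (elim disjE)
      assume "d = 0"
      then have "(f ^^ 2) a = - a" using rec by (simp add: numeral_2_eq_2)
      then show ?thesis by blast
    next
      assume d: "d * d = 1"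
      then have "d = 1 \<or> d = -1" by (simp add: square_eq_1_iff)
      then have "(f ^^ 3) a = a \<or> (f ^^ 3) a = - a" using f3 d by (auto simp: numeral_3_eq_3)
      then show ?thesis by blast
    next
      assume d: "d * d = d + 1"
      have "d * (d * d - 1) - d = 1" "d * (d * (d * d - 1) - d) - (d * d - 1) = 0"
        using d by (simp_all add: algebra_simps)
      note f5[unfolded this]
      then have "(f ^^ 5) a = - a" using d by (simp add: eval_nat_numeral)
      then show ?thesis by blast
    next
      assume d: "d * d = 1 - d"
      have e: "d * d - 1 = - d" using d by simp
      have e': "d * - d - d = -1" using d by simp
      have "d * (d * d - 1) - d = -1" "d * (d * (d * d - 1) - d) - (d * d - 1) = 0"
        unfolding e e' by simp_all
      note f5[unfolded this]
      then have "(f ^^ 5) a = a" using d by (simp add: eval_nat_numeral)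
      then show ?thesis by blast
    qed
  qed
qed

end

section \<open>Periods up to sign\<close>

lemma funpow_sign_mult:
  fixes f :: "'v::real_inner \<Rightarrow> 'v"
  assumes f: "orthogonal_transformation f" and i: "(f ^^ i) a = a \<or> (f ^^ i) a = - a"
  shows "(f ^^ (i * j)) a = a \<or> (f ^^ (i * j)) a = - a"
proof (induction j)
  case (Suc j)
  have "linear (f ^^ i)"
    using orthogonal_transformation_funpow[OF f] by (simp add: orthogonal_transformation_def)
  then show ?case
    using Suc i by (auto simp: funpow_add linear_neg)
qed simp

text \<open>By Bezout: the exponents that take \<open>a\<close> to itself up to sign are closed
  under multiples and differences.\<close>

lemma funpow_sign_coprime:
  fixes f :: "'v::real_inner \<Rightarrow> 'v"
  assumes f: "orthogonal_transformation f" and cop: "coprime i j" and "i \<noteq> 0"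
    and i: "(f ^^ (m * i)) a = a \<or> (f ^^ (m * i)) a = - a"
    and j: "(f ^^ (m * j)) a = a \<or> (f ^^ (m * j)) a = - a"
  shows "(f ^^ m) a = a \<or> (f ^^ m) a = - a"
proof -
  obtain x y where xy: "i * x = j * y + 1"
    using bezout_nat[OF \<open>i \<noteq> 0\<close>, of j] cop by auto
  have lin: "linear (f ^^ m)"
    using orthogonal_transformation_funpow[OF f] by (simp add: orthogonal_transformation_def)
  have "(f ^^ m) ((f ^^ (m * j * y)) a) = (f ^^ (m * i * x)) a"
    by (simp add: mult.assoc xy funpow_add[symmetric] flip: o_apply[of "f ^^ m"])
  then show ?thesis
    using funpow_sign_mult[OF f i, of x] funpow_sign_mult[OF f j, of y] 
    by (auto simp: linear_neg[OF lin] minus_equation_iff)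
qed

section \<open>Nine independent vectors from a Gram matrix\<close>

text \<open>Stated for a family rather than a set, so that coinciding vectors count as dependent;
  their relation has the coefficients 1 and -1.\<close>

lemma linear_relation:
  fixes w :: "nat \<Rightarrow> 'v::euclidean_space"
  assumes "DIM('v) < k"
  shows "\<exists>u. (\<exists>i<k. u i \<noteq> 0) \<and> (\<Sum>i<k. u i *\<^sub>R w i) = 0"
proof (cases "inj_on w {..<k}")
  case True
  then have "card (w ` {..<k}) = k" by (simp add: card_image)
  then have "dependent (w ` {..<k})"
    using independent_bound[of "w ` {..<k}"] assms by fastforce
  then obtain u where u: "\<exists>v\<in>w ` {..<k}. u v \<noteq> 0" "(\<Sum>v\<in>w ` {..<k}. u v *\<^sub>R v) = 0"
    by (subst (asm) dependent_finite) auto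
  then have "(\<Sum>i<k. u (w i) *\<^sub>R w i) = 0" by (simp add: sum.reindex[OF True])
  then show ?thesis using u(1) by (intro exI[of _ "\<lambda>i. u (w i)"]) auto
next
  case False
  then obtain i j where ij: "i < k" "j < k" "i \<noteq> j" "w i = w j" by (auto simp: inj_on_def)
  define u :: "nat \<Rightarrow> real" where "u l = (if l = i then 1 else 0) - (if l = j then 1 else 0)" for l
  have "(\<Sum>l<k. u l *\<^sub>R w l) = 0"
    using ij by (simp add: u_def scaleR_diff_left sum_subtractf if_distrib[of "\<lambda>x. x *\<^sub>R _"] cong: if_cong)
  then show ?thesis using ij by (intro exI[of _ u]) (auto simp: u_def)
qed

text \<open>
  In a symmetric group, \<open>a = e\<^sub>3 - e\<^sub>4\<close> with the cycles \<open>(1 2 3)\<close> and \<open>(4 5 6 7 8)\<close>, \<open>b = e\<^sub>3 - e\<^sub>9\<close>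
  and \<open>h = e\<^sub>3 - e\<^bsub>10\<^esub>\<close> have such a Gram matrix.
\<close>

lemma nine_vectors:
  fixes a a1 a2 e1 e2 e3 e4 b h :: "'v::euclidean_space" and N N' g k :: real
  assumes N: "N > 0"
    and aa: "a \<bullet> a = N" "a1 \<bullet> a1 = N" "a2 \<bullet> a2 = N" "e1 \<bullet> e1 = N" "e2 \<bullet> e2 = N" "e3 \<bullet> e3 = N" "e4 \<bullet> e4 = N"
    and half: "a \<bullet> a1 = N / 2" "a \<bullet> a2 = N / 2" "a1 \<bullet> a2 = N / 2"
      "a \<bullet> e1 = N / 2" "a \<bullet> e2 = N / 2" "a \<bullet> e3 = N / 2" "a \<bullet> e4 = N / 2"
      "e1 \<bullet> e2 = N / 2" "e1 \<bullet> e3 = N / 2" "e1 \<bullet> e4 = N / 2"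
      "e2 \<bullet> e3 = N / 2" "e2 \<bullet> e4 = N / 2" "e3 \<bullet> e4 = N / 2"
    and orth: "a1 \<bullet> e1 = 0" "a1 \<bullet> e2 = 0" "a1 \<bullet> e3 = 0" "a1 \<bullet> e4 = 0"
      "a2 \<bullet> e1 = 0" "a2 \<bullet> e2 = 0" "a2 \<bullet> e3 = 0" "a2 \<bullet> e4 = 0"
    and b: "b \<bullet> b = N'" "b \<bullet> a = g" "b \<bullet> a1 = 0" "b \<bullet> a2 = 0"
      "b \<bullet> e1 = g" "b \<bullet> e2 = g" "b \<bullet> e3 = g" "b \<bullet> e4 = g"
    and h: "h \<bullet> h = N'" "h \<bullet> a = g" "h \<bullet> a1 = 0" "h \<bullet> a2 = 0"
      "h \<bullet> e1 = g" "h \<bullet> e2 = g" "h \<bullet> e3 = g" "h \<bullet> e4 = g" "b \<bullet> h = k"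
    and k: "k \<noteq> N'" "2 * N * (N' + k) \<noteq> 7 * g * g"
  shows "9 \<le> DIM('v)"
proof (rule ccontr)
  assume "\<not> 9 \<le> DIM('v)"
  then have "DIM('v) < 9" by simp
  from linear_relation[OF this, of "(!) [a, a1, a2, e1, e2, e3, e4, b, h]"]
  obtain u where u: "\<exists>i<9. u i \<noteq> 0"
    and "(\<Sum>i<9. u i *\<^sub>R [a, a1, a2, e1, e2, e3, e4, b, h] ! i) = 0" by blast
  then have rel: "u 0 *\<^sub>R a + u 1 *\<^sub>R a1 + u 2 *\<^sub>R a2 + u 3 *\<^sub>R e1 + u 4 *\<^sub>R e2 + u 5 *\<^sub>R e3 + u 6 *\<^sub>R e4
      + u 7 *\<^sub>R b + u 8 *\<^sub>R h = 0"
    by (simp add: eval_nat_numeral)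
  have inn: "u 0 * (a \<bullet> x) + u 1 * (a1 \<bullet> x) + u 2 * (a2 \<bullet> x) + u 3 * (e1 \<bullet> x) + u 4 * (e2 \<bullet> x)
      + u 5 * (e3 \<bullet> x) + u 6 * (e4 \<bullet> x) + u 7 * (b \<bullet> x) + u 8 * (h \<bullet> x) = 0" for x
    using arg_cong[OF rel, of "\<lambda>v. v \<bullet> x"] by (simp add: inner_add_left)
  define c where "c = 2 * g / N"
  have g: "g = c * N / 2" using N by (simp add: c_def)
  note G = aa half orth b h half[THEN HOL.trans[OF inner_commute]] orth[THEN HOL.trans[OF inner_commute]]
    b(2-8)[THEN HOL.trans[OF inner_commute]] h(2-9)[THEN HOL.trans[OF inner_commute]]
  \<comment> \<open>\<open>b\<close> and \<open>h\<close> pair equally with the other seven vectors,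
    so only this term survives in the difference of their equations.\<close>
  have "(u 7 - u 8) * (N' - k) = 0"
    using inn[of b] inn[of h] by (simp add: G algebra_simps)
  then have u8: "u 8 = u 7" using k by simp
  have scale: "x = 0" if "x * (N / 2) = 0" for x using that N by simp
  have "u 0 + 2 * u 1 + u 2 = 0"
    by (rule scale) (use inn[of a1] in \<open>simp add: G algebra_simps\<close>)
  moreover have "u 0 + u 1 + 2 * u 2 = 0"
    by (rule scale) (use inn[of a2] in \<open>simp add: G algebra_simps\<close>)
  moreover have "u 0 + 2 * u 3 + u 4 + u 5 + u 6 + 2 * (c * u 7) = 0"
    by (rule scale) (use inn[of e1] u8 in \<open>simp add: G g algebra_simps\<close>)
  moreover have "u 0 + u 3 + 2 * u 4 + u 5 + u 6 + 2 * (c * u 7) = 0"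
    by (rule scale) (use inn[of e2] u8 in \<open>simp add: G g algebra_simps\<close>)
  moreover have "u 0 + u 3 + u 4 + 2 * u 5 + u 6 + 2 * (c * u 7) = 0"
    by (rule scale) (use inn[of e3] u8 in \<open>simp add: G g algebra_simps\<close>)
  moreover have "u 0 + u 3 + u 4 + u 5 + 2 * u 6 + 2 * (c * u 7) = 0"
    by (rule scale) (use inn[of e4] u8 in \<open>simp add: G g algebra_simps\<close>)
  moreover have "2 * u 0 + u 1 + u 2 + u 3 + u 4 + u 5 + u 6 + 2 * (c * u 7) = 0"
    by (rule scale) (use inn[of a] u8 in \<open>simp add: G g algebra_simps\<close>)
  ultimately have eqs: "u 0 = - 3 / 4 * (c * u 7)" "u 1 = 1 / 4 * (c * u 7)" "u 2 = 1 / 4 * (c * u 7)"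
    "u 3 = - 1 / 4 * (c * u 7)" "u 4 = - 1 / 4 * (c * u 7)" "u 5 = - 1 / 4 * (c * u 7)"
    "u 6 = - 1 / 4 * (c * u 7)"
    by linarith+
  have "(u 0 + u 3 + u 4 + u 5 + u 6) * g + u 7 * (N' + k) = 0"
    using inn[of b] u8 by (simp add: G algebra_simps)
  \<comment> \<open>The five coefficients multiplied by \<open>g\<close> sum to -7/4 times
    \<open>c * u 7\<close>, whence the 7. That the bracket is nonzero is the second condition on
    \<open>k\<close>.\<close>
  then have "u 7 * (4 * (N' + k) - 7 * c * g) = 0"
    unfolding eqs by (simp add: algebra_simps)
  moreover have "4 * (N' + k) - 7 * c * g \<noteq> 0"
    using k(2) N by (simp add: c_def field_simps)
  ultimately have "u 7 = 0" by simp
  then have "u i = 0" if "i < 9" for i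
    using that eqs u8 by (auto simp: less_Suc_eq eval_nat_numeral)
  then show False using u by blast
qed

text \<open>This excludes the degenerate case of \<open>nine_vectors\<close>: with
  \<open>c * c'\<close> equal to 4 g^2 / (N N') and \<open>d\<close> equal to 2 k / N', the
  forbidden equation reads 2 N (N' + k) = 7 g^2. Finitely many values remain, and decimal bounds on
  \<open>golden\<close> separate them.\<close>

lemma cartan_values_product:
  assumes "c \<in> cartan_values" "c' \<in> cartan_values" "d \<in> cartan_values" "c * c' > 0"
  shows "4 * d + 8 \<noteq> 7 * (c * c')"
proof
  assume eq: "4 * d + 8 = 7 * (c * c')"
  let ?P = "{1, 2, 4, golden, 2 * golden, golden - 1, 2 * golden - 2, golden + 1, 2 - golden}"
  have prod: "x * y \<in> ?P"
    if "x \<in> {0, 1, 2, golden, golden - 1}" "y \<in> {0, 1, 2, golden, golden - 1}" "x * y > 0" for x y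
    using that golden_sq
    by (elim insertE emptyE; hypsubst; simp add: left_diff_distrib right_diff_distrib)
  have abs: "\<bar>x\<bar> \<in> {0, 1, 2, golden, golden - 1}" if "x \<in> cartan_values" for x
    using that golden_bounds unfolding cartan_values_def
    by (elim insertE emptyE; hypsubst; simp)
  have cc: "\<bar>c\<bar> * \<bar>c'\<bar> = c * c'" using assms(4) by (simp flip: abs_mult)
  have "\<bar>c\<bar> * \<bar>c'\<bar> \<in> ?P"
    by (rule prod[OF abs[OF assms(1)] abs[OF assms(2)]]) (simp only: cc assms(4))
  then obtain C where "C \<in> ?P" "4 * d + 8 = 7 * C" using eq cc by metis
  then show False
    using assms(3) golden_bounds unfolding cartan_values_def
    by (elim insertE emptyE; hypsubst; linarith)
qed

section \<open>Invariant planes of an automorphism\<close>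

context root_set
begin

text \<open>
  If \<open>z = f\<^sup>k\<close> commutes with the conjugate of \<open>f\<close> by the reflection in \<open>a\<close>, then \<open>f\<close> commutes with
  the rotation composed of the reflections in \<open>a\<close> and \<open>z a\<close>, so that it preserves the plane
  spanned by \<open>a\<close> and \<open>z a\<close>.
\<close>

lemma commute_conjugate_imp_small_order:
  assumes f: "orthogonal_transformation f" and fR: "\<And>a. a \<in> R \<Longrightarrow> f a \<in> R"
    and a: "a \<in> moved R (f ^^ k)"
    and comm: "\<And>v. (f ^^ k) (refl_along a (f (refl_along a v)))
                    = refl_along a (f (refl_along a ((f ^^ k) v)))"
  shows "\<exists>l\<in>{2,3,5::nat}. (f ^^ l) a = a \<or> (f ^^ l) a = - a"
proof -
  define z where "z = f ^^ k"
  define b where "b = z a"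
  define N where "N = a \<bullet> a"
  define h where "h = 2 * (a \<bullet> b) / N"
  define T where "T v = refl_along a (refl_along b v)" for v
  have aR: "a \<in> R" and ab: "b \<noteq> a" "b \<noteq> - a" using a by (auto simp: moved_def b_def z_def)
  have N: "N > 0" using norm_pos[OF aR] by (simp add: N_def)
  have lin: "linear f" using f by (simp add: orthogonal_transformation_def)
  have z: "orthogonal_transformation z"
    unfolding z_def by (rule orthogonal_transformation_funpow[OF f])
  have bN: "b \<bullet> b = N" using z by (simp add: b_def N_def orthogonal_transformation_def)
  have zf: "z (f v) = f (z v)" for v by (simp add: z_def funpow_swap1)
  \<comment> \<open>Moving \<open>z\<close> to the right turns the reflection in \<open>a\<close>
    into the one in \<open>b\<close>. Since \<open>z\<close> commutes with \<open>f\<close>, what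
    remains of \<open>comm\<close> is that \<open>f\<close> commutes with \<open>T\<close>.\<close>
  have fT: "f (T v) = T (f v)" for v
  proof -
    obtain w where w: "v = z w" using orthogonal_transformation_surj[OF z] by (metis surj_def)
    have zr: "z (refl_along a u) = refl_along b (z u)" for u
      by (simp add: b_def orthogonal_transformation_refl_along_image[OF z])
    have "z (refl_along a (f (refl_along a (refl_along a w))))
        = refl_along a (f (refl_along a (z (refl_along a w))))"
      using comm unfolding z_def by blast
    then have "refl_along b (f (z w)) = refl_along a (f (T (z w)))"
      by (simp add: zr zf T_def)
    then show ?thesis by (simp add: w T_def)
  qed
  have T: "\<exists>x y. T v - v = x *\<^sub>R a + y *\<^sub>R b" for v
  proof -
    have "T v - v = (2 * (v \<bullet> b) / N * (2 * (b \<bullet> a) / N) - 2 * (v \<bullet> a) / N) *\<^sub>R a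
        + (- (2 * (v \<bullet> b) / N)) *\<^sub>R b"
      by (simp add: T_def refl_along_def bN N_def[symmetric] inner_diff_left algebra_simps
          diff_divide_distrib)
    then show ?thesis by blast
  qed
  have linT: "T (x *\<^sub>R a + y *\<^sub>R b) = x *\<^sub>R T a + y *\<^sub>R T b" for x y
    by (simp add: T_def linear_add[OF linear_refl_along] linear_scale[OF linear_refl_along])
  have Tb: "T b = h *\<^sub>R a - b"
    by (simp add: T_def refl_along_self linear_neg[OF linear_refl_along])
      (simp add: refl_along_def N_def h_def inner_commute)
  have Ta: "T a = (h * h - 1) *\<^sub>R a - h *\<^sub>R b"
  proof -
    have rb: "refl_along b a = a - h *\<^sub>R b" by (simp add: refl_along_def bN h_def)
    have ra: "refl_along a b = b - h *\<^sub>R a" by (simp add: refl_along_def N_def h_def inner_commute)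
    have "T a = refl_along a a - h *\<^sub>R refl_along a b"
      by (simp only: T_def rb linear_diff[OF linear_refl_along] linear_scale[OF linear_refl_along])
    also have "\<dots> = (h * h - 1) *\<^sub>R a - h *\<^sub>R b"
      unfolding ra by (simp add: refl_along_self algebra_simps)
    finally show ?thesis .
  qed
  have h4: "h * h \<noteq> 4"
  proof
    assume "h * h = 4"
    then have "(h - 2) * (h + 2) = 0" by (simp add: algebra_simps)
    then have "h = 2 \<or> h = -2" by (simp add: add_eq_0_iff2)
    then have "a \<bullet> b = N \<or> a \<bullet> b = - N" using N by (auto simp: h_def field_simps)
    then have "(b - a) \<bullet> (b - a) = 0 \<or> (b + a) \<bullet> (b + a) = 0"
      using bN by (auto simp: inner_diff_left inner_diff_right inner_add_left inner_add_right
          inner_commute N_def)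
    then show False using ab by (auto simp: add_eq_0_iff2)
  qed
  \<comment> \<open>\<open>4 - h * h\<close> is the determinant of T - 1 on the plane of
    \<open>a\<close> and \<open>b\<close>. The coefficients of the two preimages below are the
    columns of the inverse matrix.\<close>
  define t where "t = 1 / (h * h - 4)"
  have t: "t * (h * h) = 1 + 4 * t" using h4 by (simp add: t_def field_simps)
  have T_minus: "T (x *\<^sub>R a + y *\<^sub>R b) - (x *\<^sub>R a + y *\<^sub>R b)
      = (x * (h * h - 1) + y * h - x) *\<^sub>R a + (- (x * h) - y - y) *\<^sub>R b" for x y
    unfolding linT Ta Tb
    by (simp only: scaleR_diff_right scaleR_add_left scaleR_diff_left scaleR_minus_left scaleR_scaleR
        right_diff_distrib mult_1_right) (simp add: ac_simps)
  have "2 * t * (h * h - 1) + (- h * t) * h - 2 * t = 1" "- (2 * t * h) - (- h * t) - (- h * t) = 0"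
    using t by (simp_all add: algebra_simps)
  then have "T ((2 * t) *\<^sub>R a + (- h * t) *\<^sub>R b) - ((2 * t) *\<^sub>R a + (- h * t) *\<^sub>R b) = a"
    unfolding T_minus by simp
  then obtain v where v: "T v - v = a" by blast
  have "h * t * (h * h - 1) + (2 - h * h) * t * h - h * t = 0"
      "- (h * t * h) - (2 - h * h) * t - (2 - h * h) * t = 1"
    using t by (simp_all add: algebra_simps)
  then have "T ((h * t) *\<^sub>R a + ((2 - h * h) * t) *\<^sub>R b) - ((h * t) *\<^sub>R a + ((2 - h * h) * t) *\<^sub>R b) = b"
    unfolding T_minus by simp
  then obtain w where w: "T w - w = b" by blast
  \<comment> \<open>All values of T - 1 lie in the plane, and \<open>f\<close> commutes with
    \<open>T\<close>; hence the images of \<open>a\<close> and \<open>b\<close> stay in the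
    plane.\<close>
  have "f a = T (f v) - f v" "f b = T (f w) - f w"
    by (simp_all add: fT[symmetric] v[symmetric] w[symmetric] linear_diff[OF lin])
  then obtain x y x' y' where fa: "f a = x *\<^sub>R a + y *\<^sub>R b" and fb: "f b = x' *\<^sub>R a + y' *\<^sub>R b"
    using T by metis
  show ?thesis
  proof (cases "f a = a \<or> f a = - a")
    case True
    then have "(f ^^ 2) a = a" by (auto simp: numeral_2_eq_2 linear_neg[OF lin])
    then show ?thesis by blast
  next
    case False
    \<comment> \<open>\<open>b\<close> is eliminated as in Cayley-Hamilton; keeping \<open>y\<close>
      as a factor covers \<open>y = 0\<close> as well.\<close>
    have yb: "y *\<^sub>R b = f a - x *\<^sub>R a" by (simp add: fa)
    have "f (f a) = x *\<^sub>R f a + y *\<^sub>R f b"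
      by (subst fa) (simp add: linear_add[OF lin] linear_scale[OF lin])
    also have "\<dots> = x *\<^sub>R f a + (y * x') *\<^sub>R a + y' *\<^sub>R (y *\<^sub>R b)"
      by (simp add: fb scaleR_add_right mult.commute)
    also have "\<dots> = (y * x' - y' * x) *\<^sub>R a + (x + y') *\<^sub>R f a"
      unfolding yb by (simp add: algebra_simps)
    finally show ?thesis
      using cartan_recurrence[OF f aR fR[OF aR]] False by blast
  qed
qed

end


section \<open>Roots moved for several primes at once\<close>

lemma inner_orthogonal_transformation:
  "orthogonal_transformation f \<Longrightarrow> f v \<bullet> f w = v \<bullet> w"
  by (simp add: orthogonal_transformation_def)

text \<open>\<open>n\<close> is the order of \<open>f\<close> modulo signs: \<open>sign\<close> says
  that \<open>f ^^ n\<close> acts on the roots as a central element does, \<open>nonscalar\<close>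
  that no \<open>f ^^ (n div p)\<close> does.\<close>

locale root_automorphism = root_set R for R :: "'v::euclidean_space set" +
  fixes f :: "'v \<Rightarrow> 'v" and n :: nat
  assumes orth: "orthogonal_transformation f"
    and image: "a \<in> R \<Longrightarrow> f a \<in> R"
    and n_pos: "n > 0"
    and sign: "a \<in> R \<Longrightarrow> (f ^^ n) a = a \<or> (f ^^ n) a = - a"
    and nonscalar: "prime p \<Longrightarrow> p dvd n \<Longrightarrow> moved R (f ^^ (n div p)) \<noteq> {}"
begin

abbreviation M :: "nat \<Rightarrow> 'v set" where
  "M p \<equiv> moved R (f ^^ (n div p))"

text \<open>The square of \<open>f ^^ (n div q)\<close>. For odd \<open>q\<close> squaring loses
  nothing but the sign, so unmoved roots become the roots in a linear subspace, the fixed space of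
  \<open>B q\<close>.\<close>

abbreviation B :: "nat \<Rightarrow> 'v \<Rightarrow> 'v" where
  "B q \<equiv> f ^^ (2 * (n div q))"

lemma orth_funpow: "orthogonal_transformation (f ^^ k)"
  by (rule orthogonal_transformation_funpow[OF orth])

lemma linear_pow: "linear (f ^^ k)"
  using orth_funpow by (simp add: orthogonal_transformation_def)

lemma inner_funpow: "(f ^^ k) v \<bullet> (f ^^ k) w = v \<bullet> w"
  by (rule inner_orthogonal_transformation[OF orth_funpow])

lemma funpow_image: "a \<in> R \<Longrightarrow> (f ^^ k) a \<in> R"
  by (induction k) (auto intro: image)

lemma funpow_commute: "(f ^^ i) ((f ^^ j) v) = (f ^^ j) ((f ^^ i) v)"
  by (simp add: add.commute flip: funpow_add[THEN fun_cong, unfolded o_apply])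

text \<open>The exponents \<open>2 * (n div q)\<close> and \<open>n\<close> are the multiples of
  \<open>n div q\<close> by the coprime numbers 2 and \<open>q\<close>.\<close>

lemma moved_odd:
  assumes "prime q" "q dvd n" "odd q" "a \<in> R"
  shows "a \<in> M q \<longleftrightarrow> B q a \<noteq> a"
proof -
  have "(f ^^ (n div q)) a = a \<or> (f ^^ (n div q)) a = - a" if "B q a = a"
  proof (rule funpow_sign_coprime[OF orth, of 2 q])
    show "(f ^^ (n div q * 2)) a = a \<or> (f ^^ (n div q * 2)) a = - a"
      using that by (simp add: mult.commute)
    show "(f ^^ (n div q * q)) a = a \<or> (f ^^ (n div q * q)) a = - a"
      using sign assms by simp
  qed (use assms in auto)
  moreover have "B q a = a" if "(f ^^ (n div q)) a = a \<or> (f ^^ (n div q)) a = - a"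
    using that by (auto simp: mult_2 funpow_add linear_neg[OF linear_pow])
  ultimately show ?thesis using assms by (auto simp: moved_def)
qed

lemma B_funpow_order:
  assumes "q dvd n" "a \<in> R"
  shows "(B q ^^ q) a = a"
proof -
  have "2 * (n div q) * q = n + n"
    by (metis assms(1) dvd_div_mult_self mult.assoc mult_2)
  then have "B q ^^ q = f ^^ (n + n)"
    by (simp add: funpow_mult)
  then show ?thesis
    using sign[OF assms(2)] by (auto simp: funpow_add linear_neg[OF linear_pow])
qed

lemma moved_funpow: "a \<in> moved R (f ^^ k) \<Longrightarrow> (f ^^ j) a \<in> moved R (f ^^ k)"
proof -
  assume a: "a \<in> moved R (f ^^ k)"
  have "inj (f ^^ j)" by (rule orthogonal_transformation_inj[OF orth_funpow])
  then have "(f ^^ j) ((f ^^ k) a) \<noteq> (f ^^ j) a" "(f ^^ j) ((f ^^ k) a) \<noteq> (f ^^ j) (- a)"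
    using a by (auto simp: moved_def dest: injD)
  then show ?thesis
    using a funpow_image by (auto simp: moved_def funpow_commute[of k j] linear_neg[OF linear_pow])
qed

text \<open>The roles of \<open>moved_refl_along\<close> are exchanged: the fixed space of
  \<open>B q\<close> contains \<open>b\<close> but not \<open>a\<close>, so it cannot contain
  \<open>b\<close> minus a nonzero multiple of \<open>a\<close>.\<close>

lemma moved_refl_along': 
  assumes q: "prime q" "q dvd n" "odd q" and a: "a \<in> M q" and b: "b \<in> R" "b \<notin> M q"
    and ab: "a \<bullet> b \<noteq> 0"
  shows "refl_along a b \<in> M q"
proof -
  have aR: "a \<in> R" using a by (simp add: moved_def)
  have "B q a \<noteq> a" "B q b = b" using moved_odd q a b aR by auto
  then have "B q (refl_along a b) \<noteq> refl_along a b"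
    using ab norm_pos[OF aR]
    by (simp add: refl_along_def linear_diff[OF linear_pow] linear_scale[OF linear_pow] inner_commute)
  then show ?thesis using moved_odd[OF q refl_closed[OF aR b(1)]] by simp
qed

text \<open>Take non-orthogonal roots, one from each set. Either one of them lies in both sets, or
  reflecting one in the other produces a common element.\<close>

lemma moved_Int_ne:
  assumes p: "prime p" "p dvd n" and q: "prime q" "q dvd n" "odd q"
  shows "M p \<inter> M q \<noteq> {}"
proof -
  obtain d where d: "d \<in> M q" using nonscalar q by auto
  then have dR: "d \<in> R" by (simp add: moved_def)
  obtain c where c: "c \<in> M p" "d \<bullet> c \<noteq> 0"
    using moved_neighbour[OF orth_funpow nonscalar[OF p] dR] by blast
  then have cR: "c \<in> R" by (simp add: moved_def)
  show ?thesis
  proof (cases "d \<in> M p \<or> c \<in> M q")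
    case True
    then show ?thesis using c d by auto
  next
    case False
    then have "refl_along d c \<in> M p" "refl_along d c \<in> M q"
      using moved_refl_along[OF orth_funpow dR _ c(1) c(2)] moved_refl_along'[OF q d cR _ c(2)] by auto
    then show ?thesis by auto
  qed
qed


text \<open>With an empty triple intersection, the reflection of \<open>b\<close> in
  \<open>a\<close> is moved for \<open>p\<close> and \<open>r\<close>, hence fixed by
  \<open>B q\<close>. This determines \<open>B q b\<close>, and the same reasoning with images of
  \<open>a\<close> in place of \<open>a\<close> pins down the angles in the
  \<open>B q\<close>-orbit.\<close>

lemma moved_triple_gram:
  assumes p: "prime p" "p dvd n" and q: "prime q" "q dvd n" "odd q" and r: "prime r" "r dvd n" "odd r"
    and disj: "M p \<inter> M q \<inter> M r = {}"
    and a: "a \<in> M q" "a \<in> M r" and b: "b \<in> M p" "b \<notin> M r" and ab: "a \<bullet> b \<noteq> 0"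
  shows "refl_along a b \<in> M p" "refl_along a b \<in> M r" "refl_along a b \<notin> M q"
    and "(B q ^^ i) b = b + (2 * (b \<bullet> a) / (a \<bullet> a)) *\<^sub>R ((B q ^^ i) a - a)"
    and "0 < i \<Longrightarrow> i < q \<Longrightarrow> b \<bullet> (B q ^^ i) a = 0"
    and "0 < i \<Longrightarrow> i < q \<Longrightarrow> a \<bullet> (B q ^^ i) a = (a \<bullet> a) / 2"
proof -
  have bR: "b \<in> R" using b by (simp add: moved_def)
  have refl: "refl_along x b \<in> M p" "refl_along x b \<in> M r" "refl_along x b \<notin> M q"
    if x: "x \<in> M q" "x \<in> M r" "x \<bullet> b \<noteq> 0" for x
  proof -
    have "x \<in> R" "x \<notin> M p" using x disj by (auto simp: moved_def)
    then show "refl_along x b \<in> M p"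
      using moved_refl_along[OF orth_funpow] b x by blast
    moreover show "refl_along x b \<in> M r"
      using moved_refl_along'[OF r] b x bR by blast
    ultimately show "refl_along x b \<notin> M q" using disj by blast
  qed
  show "refl_along a b \<in> M p" "refl_along a b \<in> M r" "refl_along a b \<notin> M q"
    using refl a ab by auto
  have key: "B q b = b + (2 * (b \<bullet> x) / (x \<bullet> x)) *\<^sub>R (B q x - x)"
    if x: "x \<in> M q" "x \<in> M r" "x \<bullet> b \<noteq> 0" for x
  proof -
    have "x \<in> R" using x by (simp add: moved_def)
    then have "B q (refl_along x b) = refl_along x b"
      using refl(3)[OF x] moved_odd[OF q] refl_closed bR by blast
    then show ?thesis
      by (simp add: refl_along_def linear_diff[OF linear_pow] linear_scale[OF linear_pow] algebra_simps)
  qed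
  define c where "c = 2 * (b \<bullet> a) / (a \<bullet> a)"
  have aR: "a \<in> R" using a by (simp add: moved_def)
  have N: "a \<bullet> a > 0" using norm_pos[OF aR] .
  have c0: "c \<noteq> 0" using ab N by (simp add: c_def inner_commute)
  have powq: "(B q ^^ i) v = (f ^^ (2 * (n div q) * i)) v" for i v
    by (simp add: funpow_mult)
  have linq: "linear (B q ^^ i)" for i
    using linear_pow[of "2 * (n div q) * i"] by (simp add: funpow_mult)
  have Bb: "B q b = b + c *\<^sub>R (B q a - a)"
    using key a ab by (simp add: c_def)
  show i_b: "(B q ^^ i) b = b + (2 * (b \<bullet> a) / (a \<bullet> a)) *\<^sub>R ((B q ^^ i) a - a)" for i
    unfolding c_def[symmetric]
  proof (induction i)
    case (Suc i)
    have "(B q ^^ Suc i) b = B q (b + c *\<^sub>R ((B q ^^ i) a - a))" by (simp add: Suc)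
    also have "\<dots> = b + c *\<^sub>R ((B q ^^ Suc i) a - a)"
      by (simp add: linear_add[OF linear_pow] linear_diff[OF linear_pow] linear_scale[OF linear_pow]
          Bb algebra_simps)
    finally show ?case .
  qed simp
  show orthb: "b \<bullet> (B q ^^ i) a = 0" if i: "0 < i" "i < q" for i
  proof (rule ccontr)
    assume ne: "b \<bullet> (B q ^^ i) a \<noteq> 0"
    \<comment> \<open>A non-orthogonal image \<open>x\<close> may replace \<open>a\<close> in
      \<open>key\<close>. Comparing the two expressions for \<open>B q b - b\<close> makes
      \<open>w\<close> an eigenvector of \<open>B q\<close>.\<close>
    define x where "x = (B q ^^ i) a"
    define w where "w = B q a - a"
    define d where "d = 2 * (b \<bullet> x) / (x \<bullet> x)"
    have x: "x \<in> M q" "x \<in> M r" unfolding x_def powq using a moved_funpow by auto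
    have "x \<bullet> b \<noteq> 0" using ne by (simp add: x_def inner_commute)
    then have "c *\<^sub>R w = d *\<^sub>R (B q x - x)"
      using key[OF x] Bb by (simp add: d_def w_def)
    also have "B q x - x = (B q ^^ i) w"
      by (simp add: x_def w_def linear_diff[OF linq] funpow_swap1)
    finally have cd: "c *\<^sub>R w = d *\<^sub>R (B q ^^ i) w" .
    then have "(c *\<^sub>R w) \<bullet> (c *\<^sub>R w) = (d *\<^sub>R (B q ^^ i) w) \<bullet> (d *\<^sub>R (B q ^^ i) w)" by simp
    then have "c * c * (w \<bullet> w) = d * d * (w \<bullet> w)"
      by (simp add: powq inner_funpow mult.assoc)
    moreover have "w \<noteq> 0" using moved_odd[OF q aR] a by (simp add: w_def)
    ultimately have "c * c = d * d" by simp
    then have "(c - d) * (c + d) = 0" by (simp add: algebra_simps)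
    then have "d = c \<or> d = - c" by (auto simp: add_eq_0_iff2)
    then have "c *\<^sub>R (B q ^^ i) w = c *\<^sub>R w \<or> c *\<^sub>R (B q ^^ i) w = c *\<^sub>R (- w)"
      using cd by auto
    then have wi: "(B q ^^ (1 * i)) w = w \<or> (B q ^^ (1 * i)) w = - w"
      unfolding mult_1 real_vector.scale_cancel_left using c0 by auto
    have wq: "(B q ^^ (1 * q)) w = w \<or> (B q ^^ (1 * q)) w = - w"
      using B_funpow_order[OF q(2) aR] B_funpow_order[OF q(2) image, of a] aR
      by (simp add: w_def linear_diff[OF linq] funpow_swap1[symmetric])
    have "coprime i q" using i q(1) by (metis coprime_commute nat_dvd_not_less prime_imp_coprime)
    then have "(B q ^^ 1) w = w \<or> (B q ^^ 1) w = - w"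
      using funpow_sign_coprime[OF orth_funpow _ _ wi wq] i by simp
    then show False
    proof
      \<comment> \<open>Then \<open>B q\<close> translates \<open>a\<close> by \<open>w\<close> at
        every step, which is incompatible with finite order.\<close>
      assume "(B q ^^ 1) w = w"
      then have Bw: "B q w = w" by simp
      have "(B q ^^ k) a = a + real k *\<^sub>R w" for k
      proof (induction k)
        case (Suc k)
        have "B q a = a + w" by (simp add: w_def)
        with Suc show ?case
          by (simp add: linear_add[OF linear_pow] linear_scale[OF linear_pow] Bw algebra_simps)
      qed simp
      from this[of q] have "real q *\<^sub>R w = 0" using B_funpow_order[OF q(2) aR] by simp
      then show False using \<open>w \<noteq> 0\<close> q(1) by (auto simp: prime_gt_0_nat)
    next
      \<comment> \<open>Then \<open>a\<close> has period 2 under \<open>B q\<close>, but also the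
        odd period \<open>q\<close>.\<close>
      assume "(B q ^^ 1) w = - w"
      then have BB: "B q (B q a) = a" by (simp add: w_def linear_diff[OF linear_pow])
      have even: "(B q ^^ (2 * k)) a = a" for k
        by (induction k) (simp_all add: BB)
      obtain k where "q = Suc (2 * k)" using q(3) by (auto elim: oddE)
      then have "B q a = a" using B_funpow_order[OF q(2) aR] even[of k] by (metis funpow.simps(2) o_apply)
      then show False using \<open>w \<noteq> 0\<close> by (simp add: w_def)
    qed
  qed
  show "a \<bullet> (B q ^^ i) a = (a \<bullet> a) / 2" if i: "0 < i" "i < q" for i
  proof -
    \<comment> \<open>Orthogonality for the exponent \<open>q - i\<close>, transported by
      \<open>B q ^^ i\<close>, says that \<open>(B q ^^ i) b\<close> is orthogonal to
      \<open>a\<close>; the formula for this vector is then inserted.\<close>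
    have "(B q ^^ i) b \<bullet> (B q ^^ i) ((B q ^^ (q - i)) a) = b \<bullet> (B q ^^ (q - i)) a"
      unfolding powq by (rule inner_funpow)
    also have "\<dots> = 0" using orthb[of "q - i"] i by simp
    also have "(B q ^^ i) ((B q ^^ (q - i)) a) = a"
      using i B_funpow_order[OF q(2) aR] by (simp flip: funpow_add[THEN fun_cong, unfolded o_apply])
    finally have "c * (a \<bullet> a) / 2 + c * ((B q ^^ i) a \<bullet> a - a \<bullet> a) = 0"
      unfolding i_b using N by (simp add: inner_add_left inner_diff_left c_def)
    then have "c * ((B q ^^ i) a \<bullet> a - (a \<bullet> a) / 2) = 0" by (simp add: algebra_simps)
    then show ?thesis using c0 by (simp add: inner_commute)
  qed
qed


text \<open>The nine vectors are \<open>a\<close>, two more from its \<open>B q\<close>-orbit, four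
  more from its \<open>B r\<close>-orbit, \<open>b\<close>, and an image \<open>h\<close> of
  \<open>b\<close>. The bounds 3 and 5 on the primes supply enough orbit vectors.\<close>

lemma moved_triple_ne:
  assumes dim: "DIM('v) \<le> 8"
    and p: "prime p" "p dvd n" and q: "prime q" "q dvd n" "q \<ge> 3" and r: "prime r" "r dvd n" "r \<ge> 5"
    and distinct: "p \<noteq> q" "p \<noteq> r" "q \<noteq> r"
  shows "M p \<inter> M q \<inter> M r \<noteq> {}"
proof
  assume disj: "M p \<inter> M q \<inter> M r = {}"
  have odd: "odd q" "odd r"
    using q r by (auto simp: prime_odd_nat)
  note q' = q(1,2) odd(1) and r' = r(1,2) odd(2)
  obtain a where a: "a \<in> M q" "a \<in> M r"
    using moved_Int_ne[OF q(1,2) r'] by auto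
  then have aR: "a \<in> R" and aM: "a \<notin> M p" using disj by (auto simp: moved_def)
  obtain b0 where b0: "b0 \<in> M p" "a \<bullet> b0 \<noteq> 0"
    using moved_neighbour[OF orth_funpow nonscalar[OF p] aR] by blast
  have b0R: "b0 \<in> R" using b0 by (simp add: moved_def)
  have ab: "a \<bullet> refl_along a v \<noteq> 0" if "a \<bullet> v \<noteq> 0" for v
    using that norm_pos[OF aR] by (simp add: refl_along_def inner_diff_right inner_commute)
  \<comment> \<open>If \<open>b0\<close> is moved for \<open>r\<close>, it is not moved for
    \<open>q\<close>; the previous lemma with \<open>q\<close> and \<open>r\<close> exchanged shows
    that its reflection in \<open>a\<close> is not moved for \<open>r\<close>.\<close>
  obtain b where b: "b \<in> M p" "b \<notin> M r" "a \<bullet> b \<noteq> 0"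
  proof (cases "b0 \<in> M r")
    case True
    then have "b0 \<notin> M q" using b0 disj by auto
    moreover have "M p \<inter> M r \<inter> M q = {}" using disj by auto
    ultimately show ?thesis
      using that[of "refl_along a b0"] moved_triple_gram(1,3)[OF p r' q' _ a(2,1) b0(1) _ b0(2)] ab[OF b0(2)]
      by blast
  qed (use b0 in blast)
  have disj': "M p \<inter> M r \<inter> M q = {}" using disj by auto
  define N where "N = a \<bullet> a"
  define g where "g = b \<bullet> a"
  define N' where "N' = b \<bullet> b"
  define c where "c = 2 * (b \<bullet> a) / (a \<bullet> a)"
  define x where "x i = (B q ^^ i) a" for i
  define e where "e i = (B r ^^ i) a" for i
  define z where "z = f ^^ (n div p)"
  have bR: "b \<in> R" using b by (simp add: moved_def)
  have N: "N > 0" using norm_pos[OF aR] by (simp add: N_def)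
  have N': "N' > 0" using norm_pos[OF bR] by (simp add: N'_def)
  have c0: "c \<noteq> 0" using N b by (simp add: c_def N_def inner_commute)
  note gq = moved_triple_gram[OF p q' r' disj a b]
  \<comment> \<open>\<open>b'\<close> is moved for \<open>p\<close> but not for \<open>q\<close>, so
    the previous lemma applies to it with \<open>q\<close> and \<open>r\<close> exchanged and yields
    the angles along the \<open>B r\<close>-orbit.\<close>
  define b' where "b' = refl_along a b"
  note gr = moved_triple_gram[OF p r' q' disj' a(2,1) gq(1)[folded b'_def] gq(3)[folded b'_def] ab[OF b(3), folded b'_def]]
  have Bpow: "B l ^^ i = f ^^ (2 * (n div l) * i)" for l i by (simp add: funpow_mult)
  have inn: "(B l ^^ i) v \<bullet> (B l ^^ i) w = v \<bullet> w" for l i v w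
    unfolding Bpow by (rule inner_funpow)
  have lin: "linear (B l ^^ i)" for l i unfolding Bpow by (rule linear_pow)
  have Bb: "B r b = b" using b moved_odd[OF r' bR] by simp
  have Brb: "(B r ^^ i) b = b" for i by (induction i) (simp_all add: Bb)
  have shift: "(B l ^^ i) a \<bullet> (B l ^^ (i + j)) a = a \<bullet> (B l ^^ j) a" for l i j
    by (simp add: funpow_add inn)
  have xx: "x i \<bullet> x j = N / 2" if "i < j" "j < q" for i j
    using gq(6)[of "j - i"] shift[where l=q and i=i and j="j - i"] that by (simp add: x_def N_def)
  have ee: "e i \<bullet> e j = N / 2" if "i < j" "j < r" for i j
    using gr(6)[of "j - i"] shift[where l=r and i=i and j="j - i"] that by (simp add: e_def N_def)
  \<comment> \<open>\<open>B r\<close> fixes \<open>b\<close> and commutes with \<open>B q\<close>,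
    hence fixes \<open>(B q ^^ i) b\<close>; expanding that vector gives this parallelogram
    rule.\<close>
  have split: "(B r ^^ j) (x i) = x i + e j - a" for i j
  proof -
    have "(B r ^^ j) ((B q ^^ i) b) = (B q ^^ i) b"
      unfolding Bpow by (subst funpow_commute) (simp add: Brb[unfolded Bpow])
    then have "c *\<^sub>R ((B r ^^ j) (x i) - e j) = c *\<^sub>R (x i - a)"
      unfolding gq(4) by (simp add: linear_add[OF lin] linear_diff[OF lin] linear_scale[OF lin] Brb
          x_def e_def c_def)
    then have "(B r ^^ j) (x i) - e j = x i - a"
      unfolding real_vector.scale_cancel_left using c0 by simp
    then show ?thesis by (simp add: algebra_simps)
  qed
  \<comment> \<open>Shifted back to \<open>a\<close> and expanded by \<open>split\<close>, the
    product is N/2 + N/2 - N.\<close>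
  have xe: "x i \<bullet> e j = 0" if i: "0 < i" "i < q" and j: "0 < j" "j < r" for i j
  proof -
    have "(B q ^^ (q - i)) (x i) = a"
      using i B_funpow_order[OF q(2) aR]
      by (simp add: x_def flip: funpow_add[THEN fun_cong, unfolded o_apply])
    then have "x i \<bullet> e j = a \<bullet> (B q ^^ (q - i)) (e j)"
      by (metis inn)
    also have "(B q ^^ (q - i)) (e j) = (B r ^^ j) (x (q - i))"
      unfolding e_def x_def Bpow by (rule funpow_commute)
    also have "a \<bullet> \<dots> = a \<bullet> x (q - i) + a \<bullet> e j - a \<bullet> a"
      unfolding split by (simp add: inner_add_right inner_diff_right)
    also have "\<dots> = 0"
      using gq(6)[of "q - i"] gr(6)[of j] i j by (simp add: x_def e_def)
    finally show ?thesis .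
  qed
  have bx: "b \<bullet> x i = 0" if "0 < i" "i < q" for i
    using gq(5) that by (simp add: x_def)
  have be: "b \<bullet> e j = g" for j
    using inn[where l=r and i=j and v=b and w=a] by (simp add: Brb e_def g_def)
  obtain s :: real where s: "z a = s *\<^sub>R a" "s * s = 1"
  proof -
    have "z a = 1 *\<^sub>R a \<or> z a = (-1) *\<^sub>R a" using aM aR by (auto simp: moved_def z_def)
    then show ?thesis using that[of 1] that[of "-1"] by auto
  qed
  have innz: "z v \<bullet> z w = v \<bullet> w" for v w unfolding z_def by (rule inner_funpow)
  have zB: "z ((B l ^^ i) a) = s *\<^sub>R (B l ^^ i) a" for l i
    using s(1) unfolding z_def Bpow by (subst funpow_commute) (simp add: linear_scale[OF linear_pow])
  \<comment> \<open>\<open>z\<close> multiplies both orbits of \<open>a\<close> by \<open>s\<close>,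
    so \<open>h\<close> has the same products with them as \<open>b\<close>; it differs from
    \<open>b\<close> because \<open>b\<close> is moved for \<open>p\<close>.\<close>
  define h where "h = s *\<^sub>R z b"
  have h_inn: "h \<bullet> (B l ^^ i) a = b \<bullet> (B l ^^ i) a" for l i
  proof -
    have "h \<bullet> (B l ^^ i) a = z b \<bullet> z ((B l ^^ i) a)" by (simp add: h_def zB)
    then show ?thesis by (simp add: innz)
  qed
  have s1: "s = 1 \<or> s = -1" using s(2) by (simp add: square_eq_1_iff)
  have zbR: "z b \<in> R" unfolding z_def by (rule funpow_image[OF bR])
  have hR: "h \<in> R" using s1 zbR uminus_root by (auto simp: h_def)
  have hh: "h \<bullet> h = N'" using s(2) by (simp add: h_def innz N'_def mult.assoc[symmetric])
  have hb: "h \<noteq> b"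
  proof
    assume "h = b"
    moreover have "s *\<^sub>R h = z b" using s(2) by (simp add: h_def)
    ultimately have "z b = s *\<^sub>R b" by simp
    then show False using s1 b(1) by (auto simp: moved_def z_def)
  qed
  define k where "k = b \<bullet> h"
  have k: "k \<noteq> N'"
  proof
    assume "k = N'"
    then have "(h - b) \<bullet> (h - b) = 0"
      using hh by (simp add: inner_diff_left inner_diff_right inner_commute k_def N'_def)
    then show False using hb by simp
  qed
  have k2: "2 * N * (N' + k) \<noteq> 7 * g * g"
  proof -
    define c' where "c' = 2 * (a \<bullet> b) / (b \<bullet> b)"
    define d where "d = 2 * (h \<bullet> b) / (b \<bullet> b)"
    have eqs: "g = c * N / 2" "g = c' * N' / 2" "k = d * N' / 2"
      using N N' by (simp_all add: c_def c'_def d_def g_def k_def N_def N'_def inner_commute)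
    have "c * N = 2 * g" "c' * N' = 2 * g" using eqs(1,2) by simp_all
    then have "(c * N) * (c' * N') = (2 * g) * (2 * g)" by simp
    then have cc: "(N * N') * (c * c') = 4 * (g * g)" by (simp add: mult_ac)
    moreover have "g * g > 0" using b by (auto simp: g_def inner_commute zero_less_mult_iff linorder_neq_iff)
    ultimately have "(N * N') * (c * c') > 0" by simp
    moreover have "N * N' > 0" using N N' by simp
    ultimately have "c * c' > 0" by (simp only: zero_less_mult_pos)
    then have ne: "4 * d + 8 \<noteq> 7 * (c * c')"
      using cartan_values_product cartan[OF aR bR] cartan[OF bR aR] cartan[OF bR hR]
      unfolding c_def c'_def d_def by blast
    show ?thesis
    proof
      assume "2 * N * (N' + k) = 7 * g * g"
      then have "(N * N') * (4 * d + 8) = (N * N') * (7 * (c * c'))"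
        using cc by (simp add: eqs(3) algebra_simps)
      then show False using ne N N' by simp
    qed
  qed
  have "9 \<le> DIM('v)"
  proof (rule nine_vectors[of N a "x 1" "x 2" "e 1" "e 2" "e 3" "e 4" b N' g h k])
    have x0: "x 0 = a" and e0: "e 0 = a" by (simp_all add: x_def e_def)
    show "a \<bullet> x 1 = N / 2" "a \<bullet> x 2 = N / 2" using xx[of 0] q x0 by auto
    show "a \<bullet> e 1 = N / 2" "a \<bullet> e 2 = N / 2" "a \<bullet> e 3 = N / 2" "a \<bullet> e 4 = N / 2"
      using ee[of 0] r e0 by auto
    show "h \<bullet> x 1 = 0" "h \<bullet> x 2 = 0" using bx[of 1] bx[of 2] q by (simp_all add: x_def h_inn del: funpow.simps)
    show "h \<bullet> e 1 = g" "h \<bullet> e 2 = g" "h \<bullet> e 3 = g" "h \<bullet> e 4 = g"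
      using be by (simp_all add: e_def h_inn del: funpow.simps)
    show "h \<bullet> a = g" using h_inn[where l=r and i=0] by (simp add: g_def)
    show "x 1 \<bullet> x 1 = N" "x 2 \<bullet> x 2 = N" by (simp_all only: x_def inn N_def)
    show "e 1 \<bullet> e 1 = N" "e 2 \<bullet> e 2 = N" "e 3 \<bullet> e 3 = N" "e 4 \<bullet> e 4 = N" by (simp_all only: e_def inn N_def)
  qed (use N xx ee xe bx be hh k k2 q r in \<open>auto simp: N_def N'_def g_def k_def\<close>)
  then show False using dim by simp
qed


section \<open>Sizes of orbits\<close>

text \<open>Otherwise \<open>l\<close> would divide \<open>n div p\<close>, and
  \<open>f ^^ (n div p)\<close> would fix \<open>a\<close> up to sign.\<close>

lemma prime_dvd_period:
  assumes p: "prime p" "p dvd n" and a: "a \<in> M p" and l: "l dvd n"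
    and per: "(f ^^ l) a = a \<or> (f ^^ l) a = - a"
  shows "p dvd l"
proof (rule ccontr)
  assume "\<not> p dvd l"
  then have "coprime l p" using p(1) by (metis coprime_commute prime_imp_coprime)
  moreover obtain k where k: "n = l * k" using l by auto
  ultimately have "p dvd k" using p(2) by (metis coprime_commute coprime_dvd_mult_right_iff)
  then have "n div p = l * (k div p)" using k by (simp add: div_mult_swap)
  then show False using funpow_sign_mult[OF orth per, of "k div p"] a by (auto simp: moved_def)
qed

definition orb :: "'v \<Rightarrow> 'v set" where
  "orb a = (\<Union>k. {(f ^^ k) a, - (f ^^ k) a})"

lemma moved_orb: "b \<in> orb a \<Longrightarrow> b \<in> R \<Longrightarrow> a \<in> R \<Longrightarrow> b \<in> M p \<longleftrightarrow> a \<in> M p"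
proof -
  assume b: "b \<in> orb a" "b \<in> R" and a: "a \<in> R"
  obtain k where k: "b = (f ^^ k) a \<or> b = - (f ^^ k) a" using b by (auto simp: orb_def)
  have "inj (f ^^ k)" by (rule orthogonal_transformation_inj[OF orth_funpow])
  then have "(f ^^ k) v = (f ^^ k) w \<longleftrightarrow> v = w" for v w by (auto dest: injD)
  from this[of _ a] this[of _ "- a"] have "(f ^^ k) a \<in> M p \<longleftrightarrow> a \<in> M p"
    using a funpow_image[OF a] by (auto simp: moved_def funpow_commute[of _ k] linear_neg[OF linear_pow])
  moreover have "- x \<in> M p \<longleftrightarrow> x \<in> M p" if "x \<in> R" for x
  proof -
    have "- w = x \<longleftrightarrow> w = - x" for w by (metis minus_minus)
    then show ?thesis using that uminus_root by (auto simp: moved_def linear_neg[OF linear_pow])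
  qed
  ultimately show ?thesis using k funpow_image[OF a] by auto
qed

lemma orb_subset: "a \<in> R \<Longrightarrow> orb a \<subseteq> R"
  using funpow_image uminus_root by (auto simp: orb_def)

text \<open>\<open>l\<close> is the least positive exponent returning \<open>a\<close> up to sign.
  Division with remainder shows that it divides \<open>n\<close>, and the vectors
  \<open>(f ^^ i) a\<close> with \<open>i < l\<close> and their negatives are all distinct.\<close>

lemma orb_period:
  assumes a: "a \<in> R"
  obtains l where "l dvd n" "(f ^^ l) a = a \<or> (f ^^ l) a = - a" "2 * l \<le> card (orb a)"
proof -
  define P where "P l \<longleftrightarrow> 0 < l \<and> ((f ^^ l) a = a \<or> (f ^^ l) a = - a)" for l
  define l where "l = (LEAST l. P l)"
  have "P n" using sign[OF a] n_pos by (simp add: P_def)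
  then have l: "P l" unfolding l_def by (rule LeastI)
  have least: "l \<le> k" if "P k" for k unfolding l_def using that by (rule Least_le)
  have "l dvd n"
  proof -
    have "(f ^^ (n div l * l)) ((f ^^ (n mod l)) a) = (f ^^ n) a"
      by (simp flip: funpow_add[THEN fun_cong, unfolded o_apply])
    moreover have "(f ^^ (n mod l)) ((f ^^ (n div l * l)) a) = (f ^^ n) a"
      by (simp flip: funpow_add[THEN fun_cong, unfolded o_apply])
    moreover have "(f ^^ (n div l * l)) a = a \<or> (f ^^ (n div l * l)) a = - a"
      using funpow_sign_mult[OF orth, of l a "n div l"] l by (simp add: P_def mult.commute)
    ultimately have "(f ^^ (n mod l)) a = a \<or> (f ^^ (n mod l)) a = - a"
      using sign[OF a] by (auto simp: linear_neg[OF linear_pow] minus_equation_iff)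
    moreover have "n mod l < l" using l by (simp add: P_def)
    ultimately show ?thesis using least[of "n mod l"] by (auto simp: P_def dvd_eq_mod_eq_0)
  qed
  have ne: "(f ^^ i) a \<noteq> (f ^^ j) a" "(f ^^ i) a \<noteq> - (f ^^ j) a" if "i < j" "j < l" for i j
  proof -
    have "(f ^^ j) a = (f ^^ i) ((f ^^ (j - i)) a)"
      using that by (simp flip: funpow_add[THEN fun_cong, unfolded o_apply])
    moreover have "(f ^^ (j - i)) a \<noteq> a" "(f ^^ (j - i)) a \<noteq> - a"
      using least[of "j - i"] that by (auto simp: P_def)
    moreover have "inj (f ^^ i)" by (rule orthogonal_transformation_inj[OF orth_funpow])
    moreover have "- (f ^^ i) v = (f ^^ i) (- v)" for v by (simp add: linear_neg[OF linear_pow])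
    ultimately show "(f ^^ i) a \<noteq> (f ^^ j) a" "(f ^^ i) a \<noteq> - (f ^^ j) a"
      by (metis injD minus_minus)+
  qed
  have nz: "(f ^^ i) a \<noteq> - (f ^^ i) a" for i
  proof
    assume "(f ^^ i) a = - (f ^^ i) a"
    then have "(f ^^ i) a \<bullet> (f ^^ i) a = - ((f ^^ i) a \<bullet> (f ^^ i) a)" by (metis inner_minus_left)
    then show False using norm_pos[OF funpow_image[OF a, of i]] by simp
  qed
  define w where "w x = (if snd x then (f ^^ fst x) a else - (f ^^ fst x) a)" for x :: "nat \<times> bool"
  have "inj_on w ({..<l} \<times> UNIV)"
  proof (rule inj_onI)
    fix x y assume x: "x \<in> {..<l} \<times> UNIV" and y: "y \<in> {..<l} \<times> UNIV" and eq: "w x = w y"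
    have eq': "(f ^^ fst x) a = (f ^^ fst y) a \<or> (f ^^ fst x) a = - (f ^^ fst y) a"
      using eq by (auto simp: w_def dest: arg_cong[of _ _ uminus] split: if_splits)
    have "fst x = fst y"
    proof (rule linorder_cases[of "fst x" "fst y"])
      assume "fst x < fst y"
      then show ?thesis using ne[of "fst x" "fst y"] eq' y by auto
    next
      assume "fst y < fst x"
      then show ?thesis using ne[of "fst y" "fst x"] eq' x by (auto simp: minus_equation_iff)
    qed
    moreover from this have "snd x = snd y"
      using eq nz[of "fst y"] nz[of "fst y", symmetric] by (auto simp: w_def split: if_splits)
    ultimately show "x = y" by (simp add: prod_eq_iff)
  qed
  then have "card (w ` ({..<l} \<times> UNIV)) = l * 2"
    by (simp add: card_image card_cartesian_product)
  moreover have "w ` ({..<l} \<times> UNIV) \<subseteq> orb a" by (auto simp: w_def orb_def)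
  moreover have "finite (orb a)" using orb_subset[OF a] finite_roots by (rule finite_subset)
  ultimately have "2 * l \<le> card (orb a)" using card_mono by (metis mult.commute)
  with \<open>l dvd n\<close> l show ?thesis using that by (auto simp: P_def)
qed

lemma prod_le_card_orb:
  assumes a: "a \<in> R" and P: "finite P" "\<And>p. p \<in> P \<Longrightarrow> prime p \<and> p dvd n \<and> a \<in> M p"
  shows "2 * \<Prod>P \<le> card (orb a)"
proof -
  obtain l where l: "l dvd n" "(f ^^ l) a = a \<or> (f ^^ l) a = - a" "2 * l \<le> card (orb a)"
    using orb_period[OF a] .
  have "\<Prod>P dvd l"
    using P
  proof (induction P rule: finite_induct)
    case (insert p P)
    then have "coprime p (\<Prod>P)" by (intro prod_coprime_right) (metis insertCI primes_coprime)
    moreover have "p dvd l" using insert prime_dvd_period[OF _ _ _ l(1,2)] by blast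
    ultimately show ?case using insert by (simp add: divides_mult)
  qed simp
  moreover have "l \<noteq> 0" using l(1) n_pos by auto
  ultimately show ?thesis using l(3) by (auto dest: dvd_imp_le)
qed

text \<open>Used in contrapositive form: roots moved for different sets of primes have disjoint
  orbits.\<close>

lemma orb_disjoint:
  assumes "a \<in> R" "b \<in> R" "orb a \<inter> orb b \<noteq> {}"
  shows "a \<in> M p \<longleftrightarrow> b \<in> M p"
proof -
  obtain c where "c \<in> orb a" "c \<in> orb b" using assms by auto
  then show ?thesis using moved_orb orb_subset assms by blast
qed

text \<open>An orbit moved for the three largest primes has at least 2 * 3 * 5 * 7 = 210 roots.
  Roots moved for the fourth prime and one of the two largest add at least 28 + 20 if their orbits
  are disjoint, and at least 140 if they coincide in the primes; each total exceeds 240.\<close>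

lemma card_prime_divisors_le_3:
  assumes dim: "DIM('v) \<le> 8" and card: "card R \<le> 240"
  shows "card {p. prime p \<and> p dvd n} \<le> 3"
proof (rule ccontr)
  define S where "S = {p. prime p \<and> p dvd n}"
  assume "\<not> card {p. prime p \<and> p dvd n} \<le> 3"
  then have S: "4 \<le> card S" by (simp add: S_def)
  have pick: "\<exists>p\<in>S. p \<notin> set T" if "length T < 4" for T
  proof (rule ccontr)
    assume "\<not> (\<exists>p\<in>S. p \<notin> set T)"
    then have "card S \<le> card (set T)" by (intro card_mono) auto
    then show False using S that card_length[of T] by simp
  qed
  have odd: "p = 2 \<or> odd p" if "p \<in> S" for p
    using that primes_dvd_imp_eq two_is_prime_nat unfolding S_def by blast
  have two: "2 \<le> p" if "p \<in> S" for p using that by (auto simp: S_def prime_ge_2_nat)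
  \<comment> \<open>The primes are chosen from the top: avoiding the small primes forces the lower
    bounds 7, 5, 3 and 2, whichever primes occur.\<close>
  obtain p3 where p3: "p3 \<in> S" "p3 \<notin> {2, 3, 5}" using pick[of "[2, 3, 5]"] by auto
  obtain p2 where p2: "p2 \<in> S" "p2 \<notin> {p3, 2, 3}" using pick[of "[p3, 2, 3]"] by auto
  obtain p1 where p1: "p1 \<in> S" "p1 \<notin> {p3, p2, 2}" using pick[of "[p3, p2, 2]"] by auto
  obtain p0 where p0: "p0 \<in> S" "p0 \<notin> {p3, p2, p1}" using pick[of "[p3, p2, p1]"] by auto
  have b3: "7 \<le> p3" and b2: "5 \<le> p2" and b1: "3 \<le> p1" and b0: "2 \<le> p0"
  proof -
    show "2 \<le> p0" using two p0 by simp
    show "3 \<le> p1" using two[OF p1(1)] p1 by auto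
    have "p2 \<noteq> 4" using odd[OF p2(1)] by auto
    then show "5 \<le> p2" using two[OF p2(1)] p2 by auto
    have "p3 \<noteq> 4" "p3 \<noteq> 6" using odd[OF p3(1)] by auto
    then show "7 \<le> p3" using two[OF p3(1)] p3 by auto
  qed
  have pr: "prime p0" "p0 dvd n" "prime p1" "p1 dvd n" "prime p2" "p2 dvd n" "prime p3" "p3 dvd n"
    using p0 p1 p2 p3 by (auto simp: S_def)
  have o: "odd p1" "odd p2" "odd p3" using odd p1 p2 p3 by auto
  have d: "p0 \<noteq> p1" "p0 \<noteq> p2" "p0 \<noteq> p3" "p1 \<noteq> p2" "p1 \<noteq> p3" "p2 \<noteq> p3"
    using p0 p1 p2 by auto
  obtain a where a: "a \<in> M p1" "a \<in> M p2" "a \<in> M p3"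
    using moved_triple_ne[OF dim pr(3,4) pr(5,6) _ pr(7,8)] b2 b3 d by auto
  obtain b where b: "b \<in> M p0" "b \<in> M p3" using moved_Int_ne[OF pr(1,2) pr(7,8) o(3)] by auto
  obtain c where c: "c \<in> M p0" "c \<in> M p2" using moved_Int_ne[OF pr(1,2) pr(5,6) o(2)] by auto
  have R: "a \<in> R" "b \<in> R" "c \<in> R" using a b c by (auto simp: moved_def)
  have fin: "finite (orb a)" "finite (orb b)" "finite (orb c)"
    using R orb_subset finite_roots finite_subset by metis+
  have no4: "a \<notin> M p0"
  proof
    assume "a \<in> M p0"
    then have "2 * \<Prod>{p0, p1, p2, p3} \<le> card (orb a)"
      by (intro prod_le_card_orb R) (use a pr in auto)
    moreover have "\<Prod>{p0, p1, p2, p3} = p0 * (p1 * (p2 * p3))" using d by auto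
    moreover have "2 * (3 * (5 * 7)) \<le> p0 * (p1 * (p2 * p3))"
      using b0 b1 b2 b3 by (intro mult_le_mono)
    moreover have "card (orb a) \<le> card R" using orb_subset[OF R(1)] finite_roots by (rule card_mono[rotated])
    ultimately show False using card by simp
  qed
  then have ab: "orb a \<inter> orb b = {}" and ac: "orb a \<inter> orb c = {}"
    using orb_disjoint R b c by blast+
  have "2 * \<Prod>{p1, p2, p3} \<le> card (orb a)"
    by (intro prod_le_card_orb R) (use a pr in auto)
  moreover have "\<Prod>{p1, p2, p3} = p1 * (p2 * p3)" using d by auto
  moreover have "3 * (5 * 7) \<le> p1 * (p2 * p3)"
    using b1 b2 b3 by (intro mult_le_mono)
  ultimately have A: "210 \<le> card (orb a)" by simp
  show False
  proof (cases "orb b \<inter> orb c = {}")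
    case True
    have "2 * \<Prod>{p0, p3} \<le> card (orb b)" "2 * \<Prod>{p0, p2} \<le> card (orb c)"
      by (intro prod_le_card_orb R; use b c pr in auto)+
    moreover have "\<Prod>{p0, p3} = p0 * p3" "\<Prod>{p0, p2} = p0 * p2" using d by auto
    moreover have "2 * 7 \<le> p0 * p3" "2 * 5 \<le> p0 * p2"
      using b0 b2 b3 by (intro mult_le_mono; simp)+
    ultimately have "28 \<le> card (orb b)" "20 \<le> card (orb c)" by simp_all
    moreover have "card (orb a \<union> (orb b \<union> orb c)) = card (orb a) + (card (orb b) + card (orb c))"
      using ab ac True fin by (subst card_Un_disjoint; auto simp: card_Un_disjoint)
    moreover have "card (orb a \<union> (orb b \<union> orb c)) \<le> card R"
      using R orb_subset finite_roots by (intro card_mono) auto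
    ultimately show False using A card by simp
  next
    case False
    then have "b \<in> M p2" using orb_disjoint R c by blast
    then have "2 * \<Prod>{p0, p2, p3} \<le> card (orb b)"
      by (intro prod_le_card_orb R) (use b pr in auto)
    moreover have "\<Prod>{p0, p2, p3} = p0 * (p2 * p3)" using d by auto
    moreover have "2 * (5 * 7) \<le> p0 * (p2 * p3)"
      using b0 b2 b3 by (intro mult_le_mono)
    ultimately have "140 \<le> card (orb b)" by simp
    moreover have "card (orb a \<union> orb b) = card (orb a) + card (orb b)"
      using ab fin by (simp add: card_Un_disjoint)
    moreover have "card (orb a \<union> orb b) \<le> card R"
      using R orb_subset finite_roots by (intro card_mono) auto
    ultimately show False using A card by simp
  qed
qed

lemma moved_all_primes:
  assumes dim: "DIM('v) \<le> 8" and card: "card R \<le> 240"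
    and two: "prime p" "p dvd n" "prime q" "q dvd n" "p \<noteq> q"
  shows "\<exists>a\<in>R. \<forall>p. prime p \<longrightarrow> p dvd n \<longrightarrow> a \<in> M p"
proof -
  define S where "S = {p. prime p \<and> p dvd n}"
  have fin: "finite S" using finite_divisors_nat[OF n_pos] by (auto simp: S_def intro: rev_finite_subset)
  have two_le: "2 \<le> x" if "x \<in> S" for x using that by (auto simp: S_def prime_ge_2_nat)
  have odd: "x = 2 \<or> odd x" if "x \<in> S" for x
    using that primes_dvd_imp_eq two_is_prime_nat unfolding S_def by blast
  have S2: "{p, q} \<subseteq> S" using two by (simp add: S_def)
  have "\<exists>a\<in>R. \<forall>p\<in>S. a \<in> M p"
  proof (cases "S = {p, q}")
    case True
    obtain a where "a \<in> M p" "a \<in> M q"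
    proof (cases "odd q")
      case True
      then show ?thesis using that moved_Int_ne[OF two(1,2) two(3,4)] by auto
    next
      case False
      then have "odd p" using odd two S2 by auto
      then show ?thesis using that moved_Int_ne[OF two(3,4) two(1,2)] by auto
    qed
    then show ?thesis using True by (auto simp: moved_def)
  next
    case False
    have "card S \<le> 3" using card_prime_divisors_le_3[OF dim card] by (simp add: S_def)
    moreover have "{p, q} \<subset> S" using S2 False by blast
    then have "2 < card S"
      using psubset_card_mono[OF fin, of "{p, q}"] two(5) by simp
    ultimately have S3: "card S = 3" by simp
    have pick: "\<exists>p\<in>S. p \<notin> set T" if "length T < 3" for T
    proof (rule ccontr)
      assume "\<not> (\<exists>p\<in>S. p \<notin> set T)"
      then have "card S \<le> card (set T)" by (intro card_mono) auto
      then show False using S3 that card_length[of T] by simp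
    qed
    obtain p2 where p2: "p2 \<in> S" "p2 \<notin> {2, 3}" using pick[of "[2, 3]"] by auto
    obtain p1 where p1: "p1 \<in> S" "p1 \<notin> {p2, 2}" using pick[of "[p2, 2]"] by auto
    obtain p0 where p0: "p0 \<in> S" "p0 \<notin> {p2, p1}" using pick[of "[p2, p1]"] by auto
    have "3 \<le> p1" using two_le[OF p1(1)] p1 by auto
    moreover have "p2 \<noteq> 4" using odd[OF p2(1)] by auto
    then have "5 \<le> p2" using two_le[OF p2(1)] p2 by auto
    ultimately obtain a where a: "a \<in> M p0" "a \<in> M p1" "a \<in> M p2"
      using moved_triple_ne[OF dim, of p0 p1 p2] p0 p1 p2 unfolding S_def by auto
    have "{p0, p1, p2} = S"
      by (rule card_subset_eq[OF fin]) (use p0 p1 p2 S3 in auto)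
    then show ?thesis using a by (auto simp: moved_def)
  qed
  then show ?thesis by (auto simp: S_def)
qed

theorem conjugate_not_commuting:
  assumes dim: "DIM('v) \<le> 8" and card: "card R \<le> 240"
    and two: "prime p" "p dvd n" "prime q" "q dvd n" "p \<noteq> q"
  shows "\<exists>a\<in>R. \<forall>p. prime p \<longrightarrow> p dvd n \<longrightarrow>
    (\<exists>v. (f ^^ (n div p)) (refl_along a (f (refl_along a v)))
         \<noteq> refl_along a (f (refl_along a ((f ^^ (n div p)) v))))"
proof -
  obtain a where aR: "a \<in> R" and a: "\<And>p. prime p \<Longrightarrow> p dvd n \<Longrightarrow> a \<in> M p"
    using moved_all_primes[OF assms] by blast
  have False if p': "prime p'" "p' dvd n"
    and comm: "\<And>v. (f ^^ (n div p')) (refl_along a (f (refl_along a v)))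
         = refl_along a (f (refl_along a ((f ^^ (n div p')) v)))" for p'
  proof -
    obtain l where l: "l \<in> {2, 3, 5}" "(f ^^ l) a = a \<or> (f ^^ l) a = - a"
      using commute_conjugate_imp_small_order[OF orth image a[OF p'] comm] by blast
    have "prime l" using l(1) by auto
    obtain s where s: "prime s" "s dvd n" "s \<noteq> l" using two by metis
    have "(f ^^ (n div s)) a = a \<or> (f ^^ (n div s)) a = - a"
    proof (rule funpow_sign_coprime[OF orth, of l s])
      show "coprime l s" using \<open>prime l\<close> s by (metis primes_coprime)
      show "(f ^^ (n div s * l)) a = a \<or> (f ^^ (n div s * l)) a = - a"
        using funpow_sign_mult[OF orth l(2), of "n div s"] by (simp add: mult.commute)
      show "(f ^^ (n div s * s)) a = a \<or> (f ^^ (n div s * s)) a = - a"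
        using sign[OF aR] s by simp
    qed (use l in auto)
    then show False using a[OF s(1,2)] by (auto simp: moved_def)
  qed
  then show ?thesis using aR by blast
qed

end

section \<open>The reflection representation\<close>

text \<open>A nonempty word ends in \<open>j\<close> and grows on the left, so that the shorter
  words are suffixes of the longer ones.\<close>

fun alternating :: "'i \<Rightarrow> 'i \<Rightarrow> nat \<Rightarrow> 'i list" where
  "alternating i j 0 = []"
| "alternating i j (Suc k) = (if even k then j else i) # alternating i j k"

lemma alternating_numeral [simp]:
  "alternating i j (numeral k)
    = (if even (pred_numeral k) then j else i) # alternating i j (pred_numeral k)"
  by (simp add: numeral_eq_Suc)

lemma length_alternating [simp]: "length (alternating i j k) = k"
  by (induction k) auto

lemma alternating_in_lists: "i \<in> I \<Longrightarrow> j \<in> I \<Longrightarrow> alternating i j k \<in> lists I"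
  by (induction k) auto

lemma alternating_split: "m \<le> k \<Longrightarrow> \<exists>u. alternating i j k = u @ alternating i j m"
proof (induction k)
  case (Suc k)
  then show ?case by (cases "m = Suc k") (auto intro: exI[of _ "[]"] exI[of _ "_ # _"])
qed simp

lemma alternating_Suc_snoc: "\<exists>u. alternating i j (Suc k) = u @ [j]"
  using alternating_split[of 1 "Suc k" i j] by simp

text \<open>Since \<open>2 * m\<close> is even, the relator \<open>(i j)\<^sup>m\<close> ends in \<open>j\<close> and its first half reversed ends in \<open>i\<close>.\<close>

lemma replicate_alternating:
  assumes "m \<in> {2, 3, 4, 5}"
  shows "concat (replicate m [i, j]) = rev (alternating j i m) @ alternating i j m"
  using assms by (elim insertE emptyE) (simp_all, simp_all add: numeral_eq_Suc)

definition act :: "('i \<Rightarrow> 'v::real_inner) \<Rightarrow> 'i list \<Rightarrow> 'v \<Rightarrow> 'v" where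
  "act \<alpha> w = foldr (\<lambda>i. refl_along (\<alpha> i)) w"

lemma act_Nil [simp]: "act \<alpha> [] v = v" by (simp add: act_def)
lemma act_Cons [simp]: "act \<alpha> (i # w) v = refl_along (\<alpha> i) (act \<alpha> w v)" by (simp add: act_def)
lemma act_append: "act \<alpha> (u @ w) v = act \<alpha> u (act \<alpha> w v)" by (simp add: act_def)

lemma orthogonal_transformation_act: "orthogonal_transformation (act \<alpha> w)"
proof (induction w)
  case Nil
  then show ?case by (simp add: orthogonal_transformation_def act_def linear_id)
next
  case (Cons i w)
  have "act \<alpha> (i # w) = refl_along (\<alpha> i) \<circ> act \<alpha> w" by (simp add: act_def)
  then show ?case
    using orthogonal_transformation_compose[OF orthogonal_transformation_refl_along Cons]
    by (simp add: o_def)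
qed

text \<open>Pulling one factor \<open>k\<close> or \<open>l\<close> out of the mixed coefficients
  leaves a recursion for \<open>A\<close>, \<open>B\<close>, \<open>C\<close>, \<open>D\<close> that
  depends on \<open>k * l\<close> alone. Thus the order of the product of two reflections is
  independent of the root lengths.\<close>

lemma refl_along_pair_step:
  fixes a b v :: "'v::real_inner"
  assumes "a \<noteq> 0" "b \<noteq> 0"
  defines "p \<equiv> 2 * (v \<bullet> a) / (a \<bullet> a)" and "q \<equiv> 2 * (v \<bullet> b) / (b \<bullet> b)"
    and "k \<equiv> 2 * (b \<bullet> a) / (a \<bullet> a)" and "l \<equiv> 2 * (a \<bullet> b) / (b \<bullet> b)"
  shows "refl_along a (refl_along b (v + (A * p + B * k * q) *\<^sub>R a + (C * l * p + D * q) *\<^sub>R b))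
    = v + (((k * l - 1) * A + k * l * C - 1) * p + ((k * l - 1) * B + D + 1) * k * q) *\<^sub>R a
        + ((- A - C) * l * p + (- (k * l * B) - D - 1) * q) *\<^sub>R b"
proof -
  have b: "refl_along b (v + x *\<^sub>R a + y *\<^sub>R b) = v + x *\<^sub>R a + (- q - l * x - y) *\<^sub>R b" for x y
  proof -
    have "2 * ((v + x *\<^sub>R a + y *\<^sub>R b) \<bullet> b) / (b \<bullet> b) = q + l * x + 2 * y"
      using assms(2) by (simp add: q_def l_def inner_add_left field_simps)
    then show ?thesis by (simp add: refl_along_def algebra_simps) (simp flip: scaleR_add_left)
  qed
  have a: "refl_along a (v + x *\<^sub>R a + y *\<^sub>R b) = v + (- p - x - k * y) *\<^sub>R a + y *\<^sub>R b" for x y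
  proof -
    have "2 * ((v + x *\<^sub>R a + y *\<^sub>R b) \<bullet> a) / (a \<bullet> a) = p + k * y + 2 * x"
      using assms(1) by (simp add: p_def k_def inner_add_left field_simps)
    then show ?thesis by (simp add: refl_along_def algebra_simps) (simp flip: scaleR_add_left)
  qed
  show ?thesis unfolding a b by (simp add: algebra_simps)
qed

text \<open>The possible products of two opposite Cartan integers are \<open>4 cos\<^sup>2 (\<pi> / m)\<close>.\<close>

definition cartan_order :: "'v::real_inner \<Rightarrow> 'v \<Rightarrow> nat \<Rightarrow> bool" where
  "cartan_order a b m \<longleftrightarrow>
    (m, 2 * (b \<bullet> a) / (a \<bullet> a) * (2 * (a \<bullet> b) / (b \<bullet> b))) \<in> {(2, 0), (3, 1), (4, 2), (5, golden + 1)}"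

lemma refl_along_pair_order:
  assumes "a \<noteq> 0" "b \<noteq> 0" and m: "cartan_order a b m"
  shows "((\<lambda>v. refl_along a (refl_along b v)) ^^ m) v = v"
proof -
  note step = refl_along_pair_step[OF assms(1,2), of v]
  define p where "p = 2 * (v \<bullet> a) / (a \<bullet> a)"
  define q where "q = 2 * (v \<bullet> b) / (b \<bullet> b)"
  define k where "k = 2 * (b \<bullet> a) / (a \<bullet> a)"
  define l where "l = 2 * (a \<bullet> b) / (b \<bullet> b)"
  define t where "t = k * l"
  note step = step[folded p_def q_def k_def l_def, folded t_def]
  define V where "V A B C D = v + (A * p + B * k * q) *\<^sub>R a + (C * l * p + D * q) *\<^sub>R b" for A B C D
  have st: "refl_along a (refl_along b (V A B C D))
      = V ((t - 1) * A + t * C - 1) ((t - 1) * B + D + 1) (- A - C) (- (t * B) - D - 1)" for A B C D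
    unfolding V_def by (rule step)
  have 0: "v = V 0 0 0 0" by (simp add: V_def)
  have t: "(m, t) \<in> {(2, 0), (3, 1), (4, 2), (5, golden + 1)}"
    using m by (simp add: cartan_order_def t_def k_def l_def)
  have gg: "golden * (golden * x) = golden * x + x" for x
    using golden_sq by (simp add: mult.assoc[symmetric] distrib_right)
  \<comment> \<open>For \<open>t = 0\<close> the second iterate still has nonzero \<open>B\<close>
    and \<open>C\<close>; their terms vanish because the two roots are orthogonal.\<close>
  have 2: "V A B C D = V A 0 0 D" if "t = 0" for A B C D
  proof -
    have "b \<bullet> a = 0" using that assms(1,2) by (auto simp: t_def k_def l_def inner_commute)
    then show ?thesis by (simp add: V_def k_def l_def inner_commute)
  qed
  have "((\<lambda>v. refl_along a (refl_along b v)) ^^ m) (V 0 0 0 0) = V 0 0 0 0"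
    using t
  proof (elim insertE emptyE)
    assume "(m, t) = (2, 0)"
    then show ?thesis using 2[of 0 "- 1" 1 0] by (simp add: eval_nat_numeral st)
  qed (simp_all add: eval_nat_numeral st, simp_all add: algebra_simps golden_sq gg)
  then show ?thesis by (simp add: 0[symmetric])
qed

text \<open>The rank two case of positivity. As \<open>m\<close> is at most 5, the images for
  \<open>k\<close> up to 4 are written out as polynomials in \<open>t\<close>, and their signs are
  read off at the values that \<open>t\<close> can take.\<close>

lemma alternating_act_nonneg:
  assumes "\<alpha> i \<noteq> 0" "\<alpha> j \<noteq> 0" and m: "cartan_order (\<alpha> i) (\<alpha> j) m"
    and neg: "\<alpha> i \<bullet> \<alpha> j \<le> 0" and k: "k < m"
  shows "\<exists>x y. act \<alpha> (alternating i j k) (\<alpha> i) = x *\<^sub>R \<alpha> i + y *\<^sub>R \<alpha> j \<and> 0 \<le> x \<and> 0 \<le> y \<and> (0 < x \<or> 0 < y)"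
proof -
  define K where "K = - (2 * (\<alpha> j \<bullet> \<alpha> i) / (\<alpha> i \<bullet> \<alpha> i))"
  define L where "L = - (2 * (\<alpha> i \<bullet> \<alpha> j) / (\<alpha> j \<bullet> \<alpha> j))"
  have KL: "K \<ge> 0" "L \<ge> 0"
    using neg assms(1,2) by (simp_all add: K_def L_def inner_commute divide_nonpos_pos)
  define t where "t = K * L"
  have t: "(m, t) \<in> {(2, 0), (3, 1), (4, 2), (5, golden + 1)}"
    using m by (simp add: cartan_order_def t_def K_def L_def)
  have Lpos: "L > 0" if "m \<noteq> 2"
  proof -
    have "t \<noteq> 0" using t that golden_bounds by auto
    then show ?thesis using KL by (auto simp: t_def)
  qed
  define V where "V x y = x *\<^sub>R \<alpha> i + y *\<^sub>R \<alpha> j" for x y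
  have ri: "refl_along (\<alpha> i) (V x y) = V (K * y - x) y" for x y
  proof -
    have "2 * (V x y \<bullet> \<alpha> i) / (\<alpha> i \<bullet> \<alpha> i) = 2 * x - K * y"
      using assms(1) by (simp add: V_def K_def inner_add_left field_simps)
    then show ?thesis by (simp add: refl_along_def) (simp add: V_def algebra_simps flip: scaleR_2)
  qed
  have rj: "refl_along (\<alpha> j) (V x y) = V x (L * x - y)" for x y
  proof -
    have "2 * (V x y \<bullet> \<alpha> j) / (\<alpha> j \<bullet> \<alpha> j) = 2 * y - L * x"
      using assms(2) by (simp add: V_def L_def inner_add_left field_simps)
    then show ?thesis by (simp add: refl_along_def) (simp add: V_def algebra_simps flip: scaleR_2)
  qed
  have i: "act \<alpha> w (\<alpha> i) = act \<alpha> w (V 1 0)" for w by (simp add: V_def)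
  have alt: "act \<alpha> (alternating i j 0) (\<alpha> i) = V 1 0"
    "act \<alpha> (alternating i j 1) (\<alpha> i) = V 1 L"
    "act \<alpha> (alternating i j 2) (\<alpha> i) = V (t - 1) L"
    "act \<alpha> (alternating i j 3) (\<alpha> i) = V (t - 1) (L * (t - 2))"
    "act \<alpha> (alternating i j 4) (\<alpha> i) = V (t * (t - 2) - (t - 1)) (L * (t - 2))"
    unfolding i by (simp_all add: ri rj t_def algebra_simps)
  have "\<exists>x y. act \<alpha> (alternating i j k) (\<alpha> i) = V x y \<and> 0 \<le> x \<and> 0 \<le> y \<and> (0 < x \<or> 0 < y)"
  proof -
    consider "k = 0" | "k = 1" | "k = 2" "m \<in> {3, 4, 5}" | "k = 3" "m \<in> {4, 5}" | "k = 4" "m = 5"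
      using k t by fastforce
    then show ?thesis
    proof cases
      case 1
      show ?thesis unfolding 1 alt by (rule exI[of _ 1], rule exI[of _ 0]) simp
    next
      case 2
      show ?thesis unfolding 2 alt using KL by (intro exI[of _ 1] exI[of _ L]) simp
    next
      case 3
      show ?thesis unfolding 3(1) alt
        using Lpos 3 t golden_bounds by (intro exI[of _ "t - 1"] exI[of _ L]) auto
    next
      case 4
      show ?thesis unfolding 4(1) alt
        using KL 4 t golden_bounds by (intro exI[of _ "t - 1"] exI[of _ "L * (t - 2)"]) auto
    next
      case 5
      then have "t = golden + 1" using t by auto
      \<comment> \<open>\<open>golden + 1\<close> is a root of t^2 - 3 t + 1; this last image is a
        multiple of \<open>\<alpha> j\<close>.\<close>
      then have "t * (t - 2) - (t - 1) = 0" using golden_sq by (simp add: algebra_simps)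
      moreover have "L * (t - 2) > 0" using Lpos 5 \<open>t = golden + 1\<close> golden_bounds by simp
      ultimately show ?thesis unfolding 5(1) alt
        by (intro exI[of _ 0] exI[of _ "L * (t - 2)"]) simp
    qed
  qed
  then show ?thesis by (simp add: V_def)
qed


section \<open>Faithfulness of the reflection representation\<close>

text \<open>The \<open>\<alpha> i\<close> may lie in a space larger than their span, so part of the
  simple roots of a larger system can serve. \<open>\<rho>\<close> decides signs without reference
  to coordinates.\<close>

locale coxeter_reflection_group =
  fixes G :: "('g, 'x) monoid_scheme" and I :: "'i set" and s :: "'i \<Rightarrow> 'g" and m :: "'i \<Rightarrow> 'i \<Rightarrow> nat"
    and \<alpha> :: "'i \<Rightarrow> 'v::euclidean_space" and \<rho> :: 'v
  assumes sys: "coxeter_system G I s m"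
    and diagonal: "i \<in> I \<Longrightarrow> m i i = 1"
    and order: "i \<in> I \<Longrightarrow> j \<in> I \<Longrightarrow> i \<noteq> j \<Longrightarrow> cartan_order (\<alpha> i) (\<alpha> j) (m i j)"
    and obtuse: "i \<in> I \<Longrightarrow> j \<in> I \<Longrightarrow> i \<noteq> j \<Longrightarrow> \<alpha> i \<bullet> \<alpha> j \<le> 0"
    and positive: "i \<in> I \<Longrightarrow> 0 < \<rho> \<bullet> \<alpha> i"
begin

sublocale group G using sys by (simp add: coxeter_system_def)

abbreviation W :: "'i list \<Rightarrow> 'g" where "W \<equiv> word_prod G s"

lemma gen_closed: "i \<in> I \<Longrightarrow> s i \<in> carrier G"
  using sys by (auto simp: coxeter_system_def)

lemma W_closed [simp]: "w \<in> lists I \<Longrightarrow> W w \<in> carrier G"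
  by (induction w) (auto simp: word_prod_def gen_closed)

lemma W_Nil: "W [] = \<one>\<^bsub>G\<^esub>"
  by (simp add: word_prod_def)

lemma W_Cons: "W (i # w) = s i \<otimes>\<^bsub>G\<^esub> W w"
  by (simp add: word_prod_def)

lemma W_append: "u \<in> lists I \<Longrightarrow> w \<in> lists I \<Longrightarrow> W (u @ w) = W u \<otimes>\<^bsub>G\<^esub> W w"
  by (induction u) (auto simp: W_Nil W_Cons m_assoc gen_closed)

lemma W_eq_iff: "u \<in> lists I \<Longrightarrow> w \<in> lists I \<Longrightarrow> W u = W w \<longleftrightarrow> coxeter_eq I m u w"
  using sys by (simp add: coxeter_system_def)

lemma W_relator: "i \<in> I \<Longrightarrow> j \<in> I \<Longrightarrow> W (concat (replicate (m i j) [i, j])) = \<one>\<^bsub>G\<^esub>"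
proof -
  assume ij: "i \<in> I" "j \<in> I"
  then have "concat (replicate k [i, j]) \<in> lists I" for k by (induction k) auto
  then show ?thesis
    using ij coxeter_eq.relator[of i I j "[]" "[]" m] W_eq_iff[of _ "[]"] by (simp add: W_Nil)
qed

lemma gen_sq: "i \<in> I \<Longrightarrow> s i \<otimes>\<^bsub>G\<^esub> s i = \<one>\<^bsub>G\<^esub>"
  using W_relator[of i i] by (simp add: diagonal W_Cons W_Nil gen_closed)

lemma gen_inv: "i \<in> I \<Longrightarrow> inv\<^bsub>G\<^esub> (s i) = s i"
  using gen_sq gen_closed by (simp add: inv_equality)

lemma W_rev: "w \<in> lists I \<Longrightarrow> W (rev w) = inv\<^bsub>G\<^esub> (W w)"
proof (induction w)
  case (Cons i w)
  then have i: "i \<in> I" and w: "w \<in> lists I" "rev w \<in> lists I" by auto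
  then have "W (rev (i # w)) = inv\<^bsub>G\<^esub> (W w) \<otimes>\<^bsub>G\<^esub> s i"
    using Cons by (simp add: W_append[OF w(2)] W_Cons W_Nil gen_closed)
  then show ?case using i w by (simp add: W_Cons inv_mult_group gen_inv gen_closed)
qed (simp add: W_Nil)

lemma W_surj: "g \<in> carrier G \<Longrightarrow> \<exists>w\<in>lists I. W w = g"
proof -
  assume "g \<in> carrier G"
  then have "g \<in> generate G (s ` I)" using sys by (simp add: coxeter_system_def)
  then show ?thesis
  proof (induction rule: generate.induct)
    case one
    then show ?case by (intro bexI[of _ "[]"]) (auto simp: W_Nil)
  next
    case (incl h)
    then obtain i where "i \<in> I" "h = s i" by auto
    then show ?case by (intro bexI[of _ "[i]"]) (auto simp: W_Nil W_Cons gen_closed)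
  next
    case (inv h)
    then obtain i where "i \<in> I" "h = s i" by auto
    then show ?case by (intro bexI[of _ "[i]"]) (auto simp: W_Nil W_Cons gen_closed gen_inv)
  next
    case (eng h1 h2)
    then obtain u w where "u \<in> lists I" "w \<in> lists I" "W u = h1" "W w = h2" by blast
    then show ?case by (intro bexI[of _ "u @ w"]) (auto simp: W_append)
  qed
qed

lemma simple_nonzero: "i \<in> I \<Longrightarrow> \<alpha> i \<noteq> 0"
  using positive by force

lemma act_relator:
  assumes "i \<in> I" "j \<in> I"
  shows "act \<alpha> (concat (replicate (m i j) [i, j])) v = v"
proof -
  have "act \<alpha> (concat (replicate k [i, j])) v
      = ((\<lambda>v. refl_along (\<alpha> i) (refl_along (\<alpha> j) v)) ^^ k) v" for k
    by (induction k) auto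
  then show ?thesis
    using refl_along_pair_order[OF simple_nonzero simple_nonzero order] assms
    by (cases "i = j") (auto simp: diagonal)
qed

lemma act_cong: "coxeter_eq I m u w \<Longrightarrow> act \<alpha> u = act \<alpha> w"
proof (induction rule: coxeter_eq.induct)
  case (relator i j u v)
  then show ?case by (intro ext) (simp only: act_append act_relator)
qed auto

text \<open>Any word for \<open>g\<close> gives the same map: words of equal value are related by
  \<open>coxeter_eq\<close>, on whose classes \<open>act\<close> is constant.\<close>

definition geom :: "'g \<Rightarrow> 'v \<Rightarrow> 'v" where
  "geom g = act \<alpha> (SOME w. w \<in> lists I \<and> W w = g)"

lemma geom_W: "w \<in> lists I \<Longrightarrow> geom (W w) = act \<alpha> w"
proof -
  assume w: "w \<in> lists I"
  define u where "u = (SOME u. u \<in> lists I \<and> W u = W w)"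
  have "u \<in> lists I \<and> W u = W w" unfolding u_def by (rule someI[of _ w]) (use w in auto)
  then show ?thesis using act_cong w W_eq_iff unfolding geom_def u_def by blast
qed

lemma geom_mult:
  assumes "g \<in> carrier G" "h \<in> carrier G"
  shows "geom (g \<otimes>\<^bsub>G\<^esub> h) v = geom g (geom h v)"
proof -
  obtain u w where "u \<in> lists I" "w \<in> lists I" "W u = g" "W w = h" using assms W_surj by blast
  moreover from this have "geom (W (u @ w)) v = act \<alpha> u (act \<alpha> w v)"
    by (subst geom_W) (simp_all add: act_append)
  ultimately show ?thesis by (metis W_append geom_W)
qed

lemma geom_one: "geom \<one>\<^bsub>G\<^esub> v = v"
  using geom_W[of "[]"] by (simp add: W_Nil)

lemma geom_gen: "i \<in> I \<Longrightarrow> geom (s i) = refl_along (\<alpha> i)"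
  using geom_W[of "[i]"] by (auto simp: W_Nil W_Cons gen_closed)

lemma geom_orth: "orthogonal_transformation (geom g)"
  by (simp add: geom_def orthogonal_transformation_act)

definition len :: "'g \<Rightarrow> nat" where
  "len g = (LEAST k. \<exists>w\<in>lists I. length w = k \<and> W w = g)"

lemma len_W: "w \<in> lists I \<Longrightarrow> len (W w) \<le> length w"
  unfolding len_def by (rule Least_le) auto

lemma reduced_word:
  assumes "g \<in> carrier G"
  obtains w where "w \<in> lists I" "W w = g" "length w = len g"
proof -
  have "\<exists>k. \<exists>w\<in>lists I. length w = k \<and> W w = g" using W_surj[OF assms] by blast
  then have "\<exists>w\<in>lists I. length w = len g \<and> W w = g" unfolding len_def by (rule LeastI_ex)
  then show ?thesis using that by blast
qed

lemma len_mult_W: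
  assumes "g \<in> carrier G" "w \<in> lists I"
  shows "len (g \<otimes>\<^bsub>G\<^esub> W w) \<le> len g + length w"
proof -
  obtain u where u: "u \<in> lists I" "W u = g" "length u = len g" using reduced_word assms(1) .
  then show ?thesis using len_W[of "u @ w"] assms by (auto simp: W_append)
qed

lemma W_braid:
  assumes "i \<in> I" "j \<in> I" "i \<noteq> j"
  shows "W (alternating i j (m i j)) = W (alternating j i (m i j))"
proof -
  have l: "alternating i j k \<in> lists I" "alternating j i k \<in> lists I" for k
    using alternating_in_lists assms by metis+
  have "m i j \<in> {2, 3, 4, 5}" using order[OF assms] by (auto simp: cartan_order_def)
  then have "inv\<^bsub>G\<^esub> (W (alternating j i (m i j))) \<otimes>\<^bsub>G\<^esub> W (alternating i j (m i j)) = \<one>\<^bsub>G\<^esub>"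
    using W_relator[OF assms(1,2)]
      W_append[of "rev (alternating j i (m i j))", OF _ l(1)[of "m i j"]] W_rev[OF l(2)[of "m i j"]] l(2)[of "m i j"]
    by (simp add: replicate_alternating in_lists_conv_set)
  then show ?thesis using l by (metis W_closed inv_closed inv_equality inv_inv)
qed

text \<open>
  Tits' argument, with the linear functional \<open>\<rho>\<close> in place of the positive cone: split off from \<open>g\<close>
  the longest reduced alternating suffix in \<open>i\<close> and the last letter \<open>j\<close>.
\<close>

lemma geom_positive:
  assumes "g \<in> carrier G" "i \<in> I" "len g \<le> len (g \<otimes>\<^bsub>G\<^esub> s i)"
  shows "0 < \<rho> \<bullet> geom g (\<alpha> i)"
  using assms
proof (induction "len g" arbitrary: g i rule: less_induct)
  case less
  note g = less.prems(1) and i = less.prems(2)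
  obtain w where w: "w \<in> lists I" "W w = g" "length w = len g" using reduced_word[OF g] .
  show ?case
  proof (cases w rule: rev_cases)
    case Nil
    then show ?thesis using w positive[OF i] by (auto simp: W_Nil geom_one)
  next
    case (snoc w' j)
    then have j: "j \<in> I" and w': "w' \<in> lists I" using w by auto
    have gw: "g = W w' \<otimes>\<^bsub>G\<^esub> s j"
      using w snoc w' j by (auto simp: W_append W_Cons W_Nil gen_closed)
    have cancel: "x \<otimes>\<^bsub>G\<^esub> s l \<otimes>\<^bsub>G\<^esub> s l = x" if "x \<in> carrier G" "l \<in> I" for x l
      using that gen_closed gen_sq by (simp add: m_assoc)
    have ij: "i \<noteq> j"
    proof
      assume "i = j"
      then have "g \<otimes>\<^bsub>G\<^esub> s i = W w'" using gw cancel w' j by simp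
      then show False using less.prems(3) len_W[OF w'] w(3) snoc by simp
    qed
    define alt where "alt = alternating i j"
    have alt: "alt k \<in> lists I" for k unfolding alt_def using alternating_in_lists i j by metis
    \<comment> \<open>The alternating suffix of length \<open>k\<close> splits off with additive
      lengths, so both factors stay reduced.\<close>
    define P where "P k \<longleftrightarrow> (\<exists>v\<in>carrier G. g = v \<otimes>\<^bsub>G\<^esub> W (alt k) \<and> len v + k = len g)" for k
    have "P 1"
      unfolding P_def
    proof (intro bexI conjI)
      show "g = W w' \<otimes>\<^bsub>G\<^esub> W (alt 1)" using gw j by (simp add: alt_def W_Cons W_Nil gen_closed)
      then have "len g \<le> len (W w') + 1" using len_mult_W[of "W w'" "alt 1"] w' j by (simp add: alt_def)
      then show "len (W w') + 1 = len g" using len_W[OF w'] w(3) snoc by simp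
    qed (use w' in simp)
    moreover have "k \<le> len g" if "P k" for k using that by (auto simp: P_def)
    ultimately obtain k where "P k" and k_max: "\<And>l. P l \<Longrightarrow> l \<le> k"
      using Nat.ex_has_greatest_nat[of P 1 "len g"] by blast
    then obtain v where v: "v \<in> carrier G" "g = v \<otimes>\<^bsub>G\<^esub> W (alt k)" "len v + k = len g"
      by (auto simp: P_def)
    obtain k' where k': "k = Suc k'" using k_max[OF \<open>P 1\<close>] by (cases k) auto
    \<comment> \<open>If \<open>v\<close> became shorter by \<open>s l\<close>, that letter would
      either extend the alternating suffix, against maximality of \<open>k\<close>, or cancel its
      first letter and shorten \<open>g\<close>.\<close>
    have pos: "0 < \<rho> \<bullet> geom v (\<alpha> l)" if l: "l \<in> {i, j}" for l
    proof (rule less.hyps)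
      show "len v < len g" using v(3) k' by simp
      show lI: "l \<in> I" using l i j by auto
      show "len v \<le> len (v \<otimes>\<^bsub>G\<^esub> s l)"
      proof (rule ccontr)
        assume less: "\<not> len v \<le> len (v \<otimes>\<^bsub>G\<^esub> s l)"
        have vl: "v \<otimes>\<^bsub>G\<^esub> s l \<in> carrier G" using v(1) lI gen_closed by simp
        have vv: "v = v \<otimes>\<^bsub>G\<^esub> s l \<otimes>\<^bsub>G\<^esub> s l" using cancel v(1) lI by simp
        show False
        proof (cases "l = (if even k then j else i)")
          case True
          have eq: "g = (v \<otimes>\<^bsub>G\<^esub> s l) \<otimes>\<^bsub>G\<^esub> W (alt (Suc k))"
            using True v alt vl lI gen_closed cancel[of v l]
            by (simp add: alt_def W_Cons m_assoc[symmetric])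
          then have "len g \<le> len (v \<otimes>\<^bsub>G\<^esub> s l) + Suc k"
            using len_mult_W[OF vl alt, of "Suc k"] by (simp add: alt_def)
          then have "len (v \<otimes>\<^bsub>G\<^esub> s l) + Suc k = len g" using less v(3) by simp
          then have "P (Suc k)" using eq vl by (auto simp: P_def)
          then show False using k_max by force
        next
          case False
          then have "alt k = l # alt k'" using l by (auto simp: k' alt_def)
          then have "g = (v \<otimes>\<^bsub>G\<^esub> s l) \<otimes>\<^bsub>G\<^esub> W (alt k')"
            using v alt lI gen_closed by (simp add: W_Cons m_assoc)
          then have "len g \<le> len (v \<otimes>\<^bsub>G\<^esub> s l) + k'"
            using len_mult_W[OF vl alt, of k'] by (simp add: alt_def)
          then show False using less v(3) k' by simp
        qed
      qed
    qed (use v in simp)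
    \<comment> \<open>Otherwise the braid relation rewrites the suffix to end in \<open>i\<close>,
      and multiplying \<open>g\<close> by \<open>s i\<close> would shorten it.\<close>
    have "k < m i j"
    proof (rule ccontr)
      assume "\<not> k < m i j"
      then obtain u where u: "alt k = u @ alternating i j (m i j)"
        using alternating_split[of "m i j" k i j] by (auto simp: alt_def)
      then have uI: "u \<in> lists I" using alt[of k] by auto
      obtain n where n: "m i j = Suc n"
        using order[OF i j ij] by (auto simp: cartan_order_def)
      obtain u' where u': "alternating j i (m i j) = u' @ [i]"
        using alternating_Suc_snoc n by metis
      have u'I: "u' \<in> lists I" using u' alternating_in_lists[OF j i, of "m i j"] by simp
      have "W (alt k) = W (u @ u') \<otimes>\<^bsub>G\<^esub> s i"
        using W_braid[OF i j ij] u u' uI u'I i alternating_in_lists[OF i j, of "m i j"]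
        by (simp add: W_append W_Cons W_Nil gen_closed m_assoc)
      then have "g \<otimes>\<^bsub>G\<^esub> s i = v \<otimes>\<^bsub>G\<^esub> W (u @ u')"
        using v(1,2) uI u'I i gen_closed cancel[of "v \<otimes>\<^bsub>G\<^esub> W (u @ u')" i]
        by (simp add: m_assoc[symmetric])
      moreover have "length (u @ u') + 1 = k"
        using arg_cong[OF u, of length] arg_cong[OF u', of length] by (simp add: alt_def)
      ultimately have "len (g \<otimes>\<^bsub>G\<^esub> s i) + 1 \<le> len g"
        using len_mult_W[OF v(1), of "u @ u'"] uI u'I v(3) by simp
      then show False using less.prems(3) by simp
    qed
    then obtain x y where xy: "act \<alpha> (alt k) (\<alpha> i) = x *\<^sub>R \<alpha> i + y *\<^sub>R \<alpha> j" "0 \<le> x" "0 \<le> y" "0 < x \<or> 0 < y"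
      using alternating_act_nonneg[where \<alpha> = \<alpha>, OF simple_nonzero[OF i] simple_nonzero[OF j] order[OF i j ij] obtuse[OF i j ij]]
      unfolding alt_def by blast
    have "geom g (\<alpha> i) = geom v (x *\<^sub>R \<alpha> i + y *\<^sub>R \<alpha> j)"
      using v alt xy(1) by (simp add: geom_mult geom_W)
    also have "\<dots> = x *\<^sub>R geom v (\<alpha> i) + y *\<^sub>R geom v (\<alpha> j)"
      using geom_orth[of v] by (simp add: orthogonal_transformation_def linear_add linear_scale)
    finally have "\<rho> \<bullet> geom g (\<alpha> i) = x * (\<rho> \<bullet> geom v (\<alpha> i)) + y * (\<rho> \<bullet> geom v (\<alpha> j))"
      by (simp add: inner_add_right)
    moreover have "0 < \<rho> \<bullet> geom v (\<alpha> i)" "0 < \<rho> \<bullet> geom v (\<alpha> j)" using pos by auto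
    ultimately show ?thesis using xy(2-4) by (auto intro: add_pos_nonneg add_nonneg_pos)
  qed
qed

text \<open>If a reduced word for \<open>g\<close> ends in \<open>i\<close>, positivity for the word
  without this letter makes \<open>\<rho>\<close> negative on the image of
  \<open>\<alpha> i\<close>, while \<open>\<rho>\<close> is positive on \<open>\<alpha> i\<close>
  itself.\<close>

lemma geom_faithful:
  assumes g: "g \<in> carrier G" and fixed: "\<And>i. i \<in> I \<Longrightarrow> geom g (\<alpha> i) = \<alpha> i"
  shows "g = \<one>\<^bsub>G\<^esub>"
proof -
  obtain w where w: "w \<in> lists I" "W w = g" "length w = len g" using reduced_word[OF g] .
  show ?thesis
  proof (cases w rule: rev_cases)
    case Nil
    then show ?thesis using w by (simp add: W_Nil)
  next
    case (snoc u i)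
    then have i: "i \<in> I" and u: "u \<in> lists I" using w by auto
    have gu: "g = W u \<otimes>\<^bsub>G\<^esub> s i"
      using w snoc u i by (auto simp: W_append W_Cons W_Nil gen_closed)
    have "len (W u) \<le> len (W u \<otimes>\<^bsub>G\<^esub> s i)" using len_W[OF u] w(3) snoc gu by simp
    then have "0 < \<rho> \<bullet> geom (W u) (\<alpha> i)" using geom_positive u i by simp
    moreover have "geom g (\<alpha> i) = - geom (W u) (\<alpha> i)"
      using gu u i gen_closed geom_orth[of "W u"]
      by (simp add: geom_mult geom_gen refl_along_self orthogonal_transformation_def linear_neg)
    ultimately show ?thesis using fixed[OF i] positive[OF i]
      by (metis inner_minus_right less_asym neg_0_less_iff_less neg_less_0_iff_less)
  qed
qed

end

section \<open>Regular permutations and conjugation quandles\<close>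

text \<open>\<open>orbit f x\<close> starts from \<open>f x\<close>; periodicity of \<open>x\<close>
  makes it the full cycle, of length the least period.\<close>

lemma funpow_fixes_iff_card_orbit_dvd:
  assumes n: "(f ^^ n) x = x" "0 < n"
  shows "(f ^^ k) x = x \<longleftrightarrow> card (orbit f x) dvd k"
proof -
  define P where "P l \<longleftrightarrow> 0 < l \<and> (f ^^ l) x = x" for l
  define l where "l = (LEAST l. P l)"
  have l: "0 < l" "(f ^^ l) x = x"
    using LeastI[of P n] n by (simp_all add: P_def l_def)
  have least: "l \<le> j" if "0 < j" "(f ^^ j) x = x" for j
    unfolding l_def by (rule Least_le) (simp add: P_def that)
  have ne: "(f ^^ i) x \<noteq> (f ^^ j) x" if ij: "i < j" "j < l" for i j
  proof
    assume "(f ^^ i) x = (f ^^ j) x"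
    then have "(f ^^ (l - j + i)) x = (f ^^ (l - j + j)) x" by (simp only: funpow_add o_apply)
    then have "(f ^^ (l - j + i)) x = x" using ij l by simp
    then have "l \<le> l - j + i" using ij by (intro least) auto
    then show False using ij by simp
  qed
  have "inj_on (\<lambda>m. (f ^^ m) x) {..<l}"
  proof (rule inj_onI)
    fix i j
    assume "i \<in> {..<l}" "j \<in> {..<l}" "(f ^^ i) x = (f ^^ j) x"
    then show "i = j" using ne[of i j] ne[of j i] by (cases i j rule: linorder_cases) auto
  qed
  moreover have "orbit f x = (\<lambda>m. (f ^^ m) x) ` {..<l}"
    unfolding orbit_altdef_bounded[OF l(2,1)] by auto
  ultimately have card: "card (orbit f x) = l" by (simp add: card_image)
  have "(f ^^ (k mod l)) x = (f ^^ k) x" by (rule funpow_mod_eq[OF l(2)])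
  then show ?thesis
    unfolding card dvd_eq_mod_eq_0 using least[of "k mod l"] mod_less_divisor[OF l(1), of k] by force
qed

lemma single_prime_power:
  assumes "\<And>q. prime q \<Longrightarrow> q dvd n \<Longrightarrow> q = p" and "0 < (n::nat)"
  shows "\<exists>k. n = p ^ k"
  using assms
proof (induction n rule: less_induct)
  case (less n)
  show ?case
  proof (cases "n = 1")
    case True
    then show ?thesis by (intro exI[of _ 0]) simp
  next
    case False
    then obtain q where q: "prime q" "q dvd n" using prime_factor_nat by blast
    then obtain r where r: "n = p * r" using less.prems(1)[OF q] by auto
    have "1 < p" using q less.prems(1)[OF q] prime_gt_1_nat by blast
    then have "r < n" "0 < r" using r less.prems(2) by auto
    then obtain k where "r = p ^ k" using less.IH[of r] less.prems(1) r by auto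
    then show ?thesis using r by (intro exI[of _ "Suc k"]) simp
  qed
qed

lemma regular_permutationI:
  assumes A: "finite A" "bij_betw f A A" "A \<noteq> {}"
    and n: "0 < n" "\<And>x. x \<in> A \<Longrightarrow> (f ^^ n) x = x"
    and x: "\<And>p q. prime p \<Longrightarrow> p dvd n \<Longrightarrow> prime q \<Longrightarrow> q dvd n \<Longrightarrow> p \<noteq> q \<Longrightarrow>
      \<exists>x\<in>A. \<forall>p. prime p \<longrightarrow> p dvd n \<longrightarrow> (f ^^ (n div p)) x \<noteq> x"
  shows "regular_permutation A f"
proof -
  let ?L = "cycle_lengths A f"
  have fin: "finite ?L" and ne: "?L \<noteq> {}" using A by (auto simp: cycle_lengths_def)
  have iff: "(f ^^ k) x = x \<longleftrightarrow> card (orbit f x) dvd k" if "x \<in> A" for k x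
    by (rule funpow_fixes_iff_card_orbit_dvd[OF n(2)[OF that] n(1)])
  have dvd_n: "l dvd n" if "l \<in> ?L" for l
    using that iff n(2) by (auto simp: cycle_lengths_def)
  have "l dvd Max ?L" if l: "l \<in> ?L" for l
  proof (cases "\<exists>p. \<forall>q. prime q \<longrightarrow> q dvd n \<longrightarrow> q = p")
    case True
    then obtain p where p: "\<And>q. prime q \<Longrightarrow> q dvd n \<Longrightarrow> q = p" by blast
    then obtain k where k: "n = p ^ k" using single_prime_power n(1) by blast
    show ?thesis
    proof (cases "n = 1")
      case True
      then show ?thesis using dvd_n[OF l] by simp
    next
      case False
      then have "prime p" using p prime_factor_nat by blast
      then obtain i j where ij: "l = p ^ i" "Max ?L = p ^ j"
        using dvd_n[OF l] dvd_n[OF Max_in[OF fin ne]]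
        unfolding k divides_primepow_nat[OF \<open>prime p\<close>] by auto
      moreover have "l \<le> Max ?L" using fin l by (rule Max_ge)
      ultimately have "i \<le> j"
        using power_le_imp_le_exp[OF prime_gt_1_nat[OF \<open>prime p\<close>], of i j] by simp
      then show ?thesis using ij by (simp add: le_imp_power_dvd)
    qed
  next
    case False
    then obtain p q where "prime p" "p dvd n" "prime q" "q dvd n" "p \<noteq> q" by blast
    then obtain x where xA: "x \<in> A" and x: "\<And>p. prime p \<Longrightarrow> p dvd n \<Longrightarrow> (f ^^ (n div p)) x \<noteq> x"
      using x by blast
    have "card (orbit f x) = n"
    proof (rule ccontr)
      assume neq: "card (orbit f x) \<noteq> n"
      \<comment> \<open>A cofactor other than 1 has a prime divisor \<open>p\<close>, and then the
        cycle length already divides \<open>n div p\<close>.\<close>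
      obtain k where k: "n = card (orbit f x) * k" using iff[OF xA, of n] n(2)[OF xA] by auto
      then have "k \<noteq> 1" using neq by auto
      then obtain p where p: "prime p" "p dvd k" using prime_factor_nat by blast
      then have "n div p = card (orbit f x) * (k div p)" using k by (simp add: div_mult_swap)
      then have "(f ^^ (n div p)) x = x" using iff[OF xA] by simp
      moreover have "p dvd n" using p k by simp
      ultimately show False using x p(1) by blast
    qed
    then have "n \<in> ?L" using xA by (auto simp: cycle_lengths_def)
    moreover have "l \<le> n" if "l \<in> ?L" for l using dvd_n[OF that] n(1) by (rule dvd_imp_le)
    ultimately have "Max ?L = n" using fin by (intro Max_eqI) auto
    then show ?thesis using dvd_n[OF l] by simp
  qed
  then show ?thesis using A by (simp add: regular_permutation_def)
qed

context group
begin

definition conj_by :: "'a \<Rightarrow> 'a \<Rightarrow> 'a" where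
  "conj_by y = (\<lambda>x. y \<otimes> x \<otimes> inv y)"

lemma conj_by_closed [simp]: "y \<in> carrier G \<Longrightarrow> x \<in> carrier G \<Longrightarrow> conj_by y x \<in> carrier G"
  by (simp add: conj_by_def)

lemma conj_by_mult:
  "y \<in> carrier G \<Longrightarrow> z \<in> carrier G \<Longrightarrow> x \<in> carrier G \<Longrightarrow> conj_by (y \<otimes> z) x = conj_by y (conj_by z x)"
  by (simp add: conj_by_def inv_mult_group m_assoc)

lemma conj_by_funpow:
  "y \<in> carrier G \<Longrightarrow> x \<in> carrier G \<Longrightarrow> (conj_by y ^^ k) x = conj_by (y [^] k) x"
proof (induction k)
  case (Suc k)
  then have "(conj_by y ^^ Suc k) x = conj_by (y \<otimes> y [^] k) x" by (simp add: conj_by_mult)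
  then show ?case using nat_pow_Suc2[OF Suc.prems(1)] by metis
qed (simp add: conj_by_def)

lemma conj_by_fixes_iff:
  assumes "y \<in> carrier G" "x \<in> carrier G"
  shows "conj_by y x = x \<longleftrightarrow> y \<otimes> x = x \<otimes> y"
proof -
  have "x = conj_by y x \<longleftrightarrow> y \<otimes> x = x \<otimes> y"
    unfolding conj_by_def by (rule inv_solve_right) (use assms in simp_all)
  then show ?thesis by auto
qed

lemma bij_betw_conj_by:
  assumes "y \<in> carrier G" "conjugation_closed G C"
  shows "bij_betw (conj_by y) C C"
proof (rule bij_betw_byWitness[where f' = "conj_by (inv y)"])
  have C: "C \<subseteq> carrier G" using assms(2) by (simp add: conjugation_closed_def)
  have "conj_by \<one> x = x" if "x \<in> carrier G" for x using that by (simp add: conj_by_def)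
  then show "\<forall>x\<in>C. conj_by (inv y) (conj_by y x) = x" "\<forall>x\<in>C. conj_by y (conj_by (inv y) x) = x"
    using assms(1) C by (auto simp: subset_iff simp flip: conj_by_mult)
  have "conj_by z ` C \<subseteq> C" if "z \<in> carrier G" for z
    using assms(2) that by (auto simp: conj_by_def conjugation_closed_def)
  then show "conj_by y ` C \<subseteq> C" "conj_by (inv y) ` C \<subseteq> C" using assms(1) by simp_all
qed

lemma right_translation_conj_quandle: "right_translation (conj_quandle G C) y = conj_by y"
  by (simp add: right_translation_def conj_quandle_def conj_by_def)

lemma carrier_conj_quandle: "carrier (conj_quandle G C) = C"
  by (simp add: conj_quandle_def)

lemma is_quandle_conj_quandle:
  assumes "conjugation_closed G C"
  shows "is_quandle (conj_quandle G C)"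
proof -
  have C: "x \<in> carrier G" if "x \<in> C" for x using that assms by (auto simp: conjugation_closed_def)
  have qop: "qop (conj_quandle G C) x y = conj_by y x" for x y
    by (simp add: conj_quandle_def conj_by_def)
  have idem: "conj_by x x = x" if "x \<in> carrier G" for x
    using that by (simp add: conj_by_def m_assoc)
  have dist: "conj_by z (conj_by y x) = conj_by (conj_by z y) (conj_by z x)"
    if "x \<in> carrier G" "y \<in> carrier G" "z \<in> carrier G" for x y z
  proof -
    have "conj_by z y \<otimes> z = z \<otimes> y" using that by (simp add: conj_by_def m_assoc)
    then show ?thesis using that by (simp flip: conj_by_mult)
  qed
  show ?thesis
    unfolding is_quandle_def carrier_conj_quandle right_translation_conj_quandle qop
    by (intro conjI ballI idem dist bij_betw_conj_by assms C)
qed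

lemma finite_carrier_pow_one:
  assumes "finite (carrier G)" and y: "y \<in> carrier G"
  obtains i :: nat where "0 < i" "y [^] i = \<one>"
proof -
  have "\<not> inj_on (\<lambda>k::nat. y [^] k) UNIV"
  proof
    assume "inj_on (\<lambda>k::nat. y [^] k) UNIV"
    moreover have "range (\<lambda>k::nat. y [^] k) \<subseteq> carrier G" using y by auto
    ultimately show False using assms(1) by (metis finite_imageD finite_subset infinite_UNIV_nat)
  qed
  then obtain i j :: nat where ij: "i < j" "y [^] i = y [^] j"
    unfolding inj_on_def by (metis linorder_neqE_nat)
  have "y [^] i \<otimes> y [^] (j - i) = y [^] (i + (j - i))" by (rule nat_pow_mult[OF y])
  also have "\<dots> = y [^] i \<otimes> \<one>" using ij y by simp
  finally have "y [^] (j - i) = \<one>" using l_cancel_one[of "y [^] i" "y [^] (j - i)"] y by simp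
  then show ?thesis using that[of "j - i"] ij by simp
qed

text \<open>The premise is free of \<open>C\<close>: the required element is a conjugate of
  \<open>y\<close>, which lies in \<open>C\<close> automatically, and \<open>n\<close> is minimal
  with \<open>y [^] n\<close> commuting with all of \<open>G\<close>, not just with
  \<open>C\<close>.\<close>

lemma hayashi_conj_quandleI:
  assumes fin: "finite (carrier G)" and C: "conjugation_closed G C"
    and prime: "\<And>y (n :: nat) p q. y \<in> carrier G \<Longrightarrow> 0 < n \<Longrightarrow>
        (\<And>x. x \<in> carrier G \<Longrightarrow> y [^] n \<otimes> x = x \<otimes> y [^] n) \<Longrightarrow>
        (\<And>k. 0 < k \<Longrightarrow> k < n \<Longrightarrow> \<exists>x\<in>carrier G. y [^] k \<otimes> x \<noteq> x \<otimes> y [^] k) \<Longrightarrow>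
        prime p \<Longrightarrow> p dvd n \<Longrightarrow> prime q \<Longrightarrow> q dvd n \<Longrightarrow> p \<noteq> q \<Longrightarrow>
        \<exists>r\<in>carrier G. \<forall>p. prime p \<longrightarrow> p dvd n \<longrightarrow>
          y [^] (n div p) \<otimes> conj_by r y \<noteq> conj_by r y \<otimes> y [^] (n div p)"
  shows "hayashi (conj_quandle G C)"
proof -
  have CG: "C \<subseteq> carrier G" using C by (simp add: conjugation_closed_def)
  have finC: "finite C" using CG fin by (rule finite_subset)
  have "regular_permutation C (conj_by y)" if y: "y \<in> C" for y
  proof -
    have yG: "y \<in> carrier G" using y CG by auto
    define P where "P n \<longleftrightarrow> 0 < n \<and> (\<forall>x\<in>carrier G. y [^] n \<otimes> x = x \<otimes> y [^] n)" for n :: nat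
    define n where "n = (LEAST n. P n)"
    obtain i :: nat where "0 < i" "y [^] i = \<one>" using finite_carrier_pow_one[OF fin yG] .
    then have "P i" by (simp add: P_def)
    then have "P n" unfolding n_def by (rule LeastI)
    have min: "\<not> P k" if "k < n" for k using that not_less_Least unfolding n_def by blast
    show ?thesis
    proof (rule regular_permutationI)
      show "finite C" "C \<noteq> {}" using finC y by auto
      show "bij_betw (conj_by y) C C" by (rule bij_betw_conj_by[OF yG C])
      show "0 < n" using \<open>P n\<close> by (simp add: P_def)
      show "(conj_by y ^^ n) x = x" if "x \<in> C" for x
        using that CG yG \<open>P n\<close> by (auto simp: conj_by_funpow conj_by_fixes_iff P_def)
    next
      fix p q
      assume "prime p" "p dvd n" "prime q" "q dvd n" "p \<noteq> q"
      then obtain r where r: "r \<in> carrier G" and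
        ne: "\<And>p. prime p \<Longrightarrow> p dvd n \<Longrightarrow>
          y [^] (n div p) \<otimes> conj_by r y \<noteq> conj_by r y \<otimes> y [^] (n div p)"
        using prime[OF yG, of n p q] \<open>P n\<close> min unfolding P_def by blast
      have "conj_by r y \<in> C" using C r y by (simp add: conjugation_closed_def conj_by_def)
      moreover have "(conj_by y ^^ (n div p)) (conj_by r y) \<noteq> conj_by r y" if "prime p" "p dvd n" for p
        using ne[OF that] r yG by (simp add: conj_by_funpow conj_by_fixes_iff)
      ultimately show "\<exists>x\<in>C. \<forall>p. prime p \<longrightarrow> p dvd n \<longrightarrow> (conj_by y ^^ (n div p)) x \<noteq> x" by blast
    qed
  qed
  then show ?thesis
    using is_quandle_conj_quandle[OF C] finC
    by (simp add: hayashi_def carrier_conj_quandle right_translation_conj_quandle)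
qed

end


section \<open>Coxeter groups with a finite root system\<close>

text \<open>\<open>R\<close> is a finite container stable under the simple reflections and may
  exceed the root system of \<open>G\<close>, as the E8 roots do for E6. The root system proper is
  \<open>roots\<close> below.\<close>

locale finite_coxeter_reflection_group = coxeter_reflection_group G I s m \<alpha> \<rho>
  for G :: "('g, 'x) monoid_scheme" and I :: "'i set" and s m
    and \<alpha> :: "'i \<Rightarrow> 'v::euclidean_space" and \<rho> +
  fixes R :: "'v set"
  assumes finite_I: "finite I"
    and diagram_connected: "i \<in> I \<Longrightarrow> j \<in> I \<Longrightarrow>
      (i, j) \<in> {(x, y). x \<in> I \<and> y \<in> I \<and> \<alpha> x \<bullet> \<alpha> y \<noteq> 0}\<^sup>*"
    and dim_le_8: "DIM('v) \<le> 8"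
    and finite_R: "finite R" and card_R: "card R \<le> 240"
    and simple_R: "i \<in> I \<Longrightarrow> \<alpha> i \<in> R"
    and refl_R: "i \<in> I \<Longrightarrow> v \<in> R \<Longrightarrow> refl_along (\<alpha> i) v \<in> R"
    and cartan_R: "i \<in> I \<Longrightarrow> v \<in> R \<Longrightarrow> 2 * (v \<bullet> \<alpha> i) / (\<alpha> i \<bullet> \<alpha> i) \<in> cartan_values"
begin

definition roots :: "'v set" where
  "roots = {geom g (\<alpha> i) | g i. g \<in> carrier G \<and> i \<in> I}"

lemma geom_inner: "geom g v \<bullet> geom g w = v \<bullet> w"
  by (rule inner_orthogonal_transformation[OF geom_orth])

lemma geom_R: "g \<in> carrier G \<Longrightarrow> v \<in> R \<Longrightarrow> geom g v \<in> R"
proof -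
  assume g: "g \<in> carrier G" and v: "v \<in> R"
  obtain w where "w \<in> lists I" "W w = g" using W_surj[OF g] by blast
  moreover from this(1) have "act \<alpha> w v \<in> R"
    by (induction w) (auto simp: v refl_R)
  ultimately show ?thesis using geom_W by metis
qed

lemma roots_subset_R: "roots \<subseteq> R"
  using geom_R simple_R by (auto simp: roots_def)

lemma geom_inv: "g \<in> carrier G \<Longrightarrow> geom (inv\<^bsub>G\<^esub> g) (geom g v) = v"
  by (metis geom_mult geom_one inv_closed l_inv)

lemma geom_root: "g \<in> carrier G \<Longrightarrow> a \<in> roots \<Longrightarrow> geom g a \<in> roots"
  unfolding roots_def using geom_mult m_closed by (smt (verit, best) mem_Collect_eq)

lemma reflection_element:
  assumes "a \<in> roots"
  obtains r where "r \<in> carrier G" "geom r = refl_along a" "inv\<^bsub>G\<^esub> r = r"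
proof -
  obtain g i where a: "a = geom g (\<alpha> i)" and g: "g \<in> carrier G" and i: "i \<in> I"
    using assms by (auto simp: roots_def)
  define r where "r = g \<otimes>\<^bsub>G\<^esub> s i \<otimes>\<^bsub>G\<^esub> inv\<^bsub>G\<^esub> g"
  have "geom r v = refl_along a v" for v
  proof -
    have "geom r v = geom g (refl_along (\<alpha> i) (geom (inv\<^bsub>G\<^esub> g) v))"
      using g i gen_closed by (simp add: r_def geom_mult geom_gen)
    also have "\<dots> = refl_along a (geom g (geom (inv\<^bsub>G\<^esub> g) v))"
      by (simp add: a orthogonal_transformation_refl_along_image[OF geom_orth])
    also have "geom g (geom (inv\<^bsub>G\<^esub> g) v) = v"
      using geom_inv[of "inv\<^bsub>G\<^esub> g" v] g by simp
    finally show ?thesis .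
  qed
  moreover have "inv\<^bsub>G\<^esub> r = r"
    using g i gen_closed by (simp add: r_def inv_mult_group gen_inv m_assoc)
  ultimately show ?thesis using that[of r] g i gen_closed by (auto simp: r_def)
qed

lemma geom_inj:
  assumes "g \<in> carrier G" "h \<in> carrier G" and eq: "\<And>i. i \<in> I \<Longrightarrow> geom g (\<alpha> i) = geom h (\<alpha> i)"
  shows "g = h"
proof -
  have "inv\<^bsub>G\<^esub> h \<otimes>\<^bsub>G\<^esub> g = \<one>\<^bsub>G\<^esub>"
    by (rule geom_faithful) (use assms in \<open>simp_all add: geom_mult geom_inv\<close>)
  then have "inv\<^bsub>G\<^esub> g = inv\<^bsub>G\<^esub> h" using assms(1,2) by (intro inv_equality) simp_all
  then have "inv\<^bsub>G\<^esub> (inv\<^bsub>G\<^esub> g) = inv\<^bsub>G\<^esub> (inv\<^bsub>G\<^esub> h)" by simp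
  then show ?thesis using assms(1,2) by simp
qed

text \<open>By faithfulness an element is determined by the images of the simple roots, which lie in
  the finite set \<open>R\<close>.\<close>

lemma finite_G: "finite (carrier G)"
proof -
  have "inj_on (\<lambda>g. \<lambda>i\<in>I. geom g (\<alpha> i)) (carrier G)"
  proof (rule inj_onI, rule geom_inj)
    fix g h i
    assume "(\<lambda>i\<in>I. geom g (\<alpha> i)) = (\<lambda>i\<in>I. geom h (\<alpha> i))" "i \<in> I"
    then show "geom g (\<alpha> i) = geom h (\<alpha> i)" by (metis restrict_apply')
  qed
  moreover have "(\<lambda>g. \<lambda>i\<in>I. geom g (\<alpha> i)) ` carrier G \<subseteq> I \<rightarrow>\<^sub>E R"
    using geom_R simple_R by auto
  moreover have "finite (I \<rightarrow>\<^sub>E R)" using finite_I finite_R by (simp add: finite_PiE)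
  ultimately show ?thesis using inj_on_finite by blast
qed

lemma roots_nonzero: "0 \<notin> roots"
proof
  assume "0 \<in> roots"
  then obtain g i where "i \<in> I" "geom g (\<alpha> i) = 0" by (auto simp: roots_def)
  then have "\<alpha> i \<bullet> \<alpha> i = 0" using geom_inner[of g "\<alpha> i" "\<alpha> i"] by simp
  then show False using simple_nonzero \<open>i \<in> I\<close> by simp
qed

text \<open>Applying a simple reflection to \<open>c\<close> either fixes it or gives a root joined
  to \<open>c\<close> through the simple root \<open>\<alpha> j\<close>; so each root is joined to a
  simple one, and the diagram joins these.\<close>

lemma roots_connected:
  assumes "a \<in> roots" "b \<in> roots"
  shows "(a, b) \<in> {(x, y). x \<in> roots \<and> y \<in> roots \<and> x \<bullet> y \<noteq> 0}\<^sup>*"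
proof -
  let ?E = "{(x, y). x \<in> roots \<and> y \<in> roots \<and> x \<bullet> y \<noteq> 0}"
  have sym: "(y, x) \<in> ?E\<^sup>*" if "(x, y) \<in> ?E\<^sup>*" for x y
    using that by (rule sym_rtrancl[THEN symD, rotated]) (auto simp: sym_def inner_commute)
  have simple: "\<alpha> i \<in> roots" if "i \<in> I" for i
    using that geom_one[of "\<alpha> i"] unfolding roots_def by (auto intro!: exI[of _ "\<one>\<^bsub>G\<^esub>"] exI[of _ i])
  have to_simple: "(\<alpha> i, act \<alpha> w (\<alpha> i)) \<in> ?E\<^sup>*" if "i \<in> I" "w \<in> lists I" for i w
    using that(2)
  proof (induction w)
    case (Cons j w)
    define c where "c = act \<alpha> w (\<alpha> i)"
    have wI: "w \<in> lists I" "j \<in> I" using Cons by auto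
    then have c: "c \<in> roots"
      unfolding c_def roots_def using that(1) geom_W[OF wI(1), symmetric] W_closed[OF wI(1)]
      by (intro CollectI exI[of _ "W w"] exI[of _ i]) simp
    have d: "refl_along (\<alpha> j) c \<in> roots"
      using geom_root[OF gen_closed[OF wI(2)] c] geom_gen[OF wI(2)] by simp
    have IH: "(\<alpha> i, c) \<in> ?E\<^sup>*" using Cons by (simp add: c_def)
    show ?case
    proof (cases "c \<bullet> \<alpha> j = 0")
      case True
      then show ?thesis using IH by (simp add: c_def[symmetric]) (simp add: refl_along_def)
    next
      case False
      then have 1: "(c, \<alpha> j) \<in> ?E" using c simple wI by simp
      have "\<alpha> j \<bullet> refl_along (\<alpha> j) c = - (c \<bullet> \<alpha> j)"
        using simple_nonzero[OF wI(2)] by (simp add: refl_along_def inner_diff_right inner_commute)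
      then have "(\<alpha> j, refl_along (\<alpha> j) c) \<in> ?E" using False d simple wI by simp
      with 1 IH have "(\<alpha> i, refl_along (\<alpha> j) c) \<in> ?E\<^sup>*" by (meson rtrancl.rtrancl_into_rtrancl)
      then show ?thesis by (simp add: c_def)
    qed
  qed simp
  have simple_simple: "(\<alpha> i, \<alpha> j) \<in> ?E\<^sup>*" if "i \<in> I" "j \<in> I" for i j
    using diagram_connected[OF that]
  proof (induction rule: rtrancl_induct)
    case (step x y)
    then have "(\<alpha> x, \<alpha> y) \<in> ?E" using simple by auto
    with step show ?case by (meson rtrancl.rtrancl_into_rtrancl)
  qed simp
  have root_simple: "\<exists>i\<in>I. (\<alpha> i, c) \<in> ?E\<^sup>*" if "c \<in> roots" for c
  proof -
    obtain g i where g: "c = geom g (\<alpha> i)" "g \<in> carrier G" "i \<in> I" using \<open>c \<in> roots\<close> by (auto simp: roots_def)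
    obtain w where w: "w \<in> lists I" "W w = g" using W_surj g(2) by blast
    show ?thesis using to_simple[OF g(3) w(1)] g(3) unfolding g(1) w(2)[symmetric] geom_W[OF w(1)] by blast
  qed
  then show ?thesis using sym simple_simple assms by (meson rtrancl_trans)
qed

sublocale root_set roots
proof
  show "finite roots" using roots_subset_R finite_R by (rule finite_subset)
  show "0 \<notin> roots" by (rule roots_nonzero)
  show "(a, b) \<in> {(x, y). x \<in> roots \<and> y \<in> roots \<and> x \<bullet> y \<noteq> 0}\<^sup>*" if "a \<in> roots" "b \<in> roots" for a b
    using that by (rule roots_connected)
next
  fix a b
  assume a: "a \<in> roots" and b: "b \<in> roots"
  obtain r where "r \<in> carrier G" "geom r = refl_along a" using reflection_element[OF a] .
  then show "refl_along a b \<in> roots" using geom_root[OF _ b] by metis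
  obtain g i where g: "a = geom g (\<alpha> i)" "g \<in> carrier G" "i \<in> I" using a by (auto simp: roots_def)
  \<comment> \<open>Transport by the inverse of \<open>g\<close> reduces the Cartan number to one
    with a simple root.\<close>
  have "geom (inv\<^bsub>G\<^esub> g) b \<in> R" using geom_root[OF inv_closed[OF g(2)] b] roots_subset_R by auto
  moreover have "geom (inv\<^bsub>G\<^esub> g) b \<bullet> \<alpha> i = b \<bullet> a"
    using geom_inner[of "inv\<^bsub>G\<^esub> g" b a] g geom_inv by simp
  moreover have "\<alpha> i \<bullet> \<alpha> i = a \<bullet> a" by (simp add: g geom_inner)
  ultimately show "2 * (b \<bullet> a) / (a \<bullet> a) \<in> cartan_values" using cartan_R[OF g(3)] by metis
qed

text \<open>An orthogonal map that preserves each root up to sign commutes with the reflections in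
  them, hence with the generators; faithfulness brings this back to the group.\<close>

lemma central_if_not_moved:
  assumes z: "z \<in> carrier G" and fixed: "moved roots (geom z) = {}" and x: "x \<in> carrier G"
  shows "z \<otimes>\<^bsub>G\<^esub> x = x \<otimes>\<^bsub>G\<^esub> z"
proof (rule geom_inj)
  fix i assume i: "i \<in> I"
  have comm: "geom z (refl_along a v) = refl_along a (geom z v)" if "a \<in> roots" for a v
  proof -
    have "geom z a = a \<or> geom z a = - a" using fixed that by (auto simp: moved_def)
    then have "refl_along (geom z a) = refl_along a" by (auto simp: refl_along_def)
    then show ?thesis by (metis orthogonal_transformation_refl_along_image[OF geom_orth])
  qed
  have simple: "\<alpha> i \<in> roots" if "i \<in> I" for i
    using that geom_one[of "\<alpha> i"] unfolding roots_def by (auto intro!: exI[of _ "\<one>\<^bsub>G\<^esub>"] exI[of _ i])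
  obtain w where w: "w \<in> lists I" "W w = x" using W_surj[OF x] by blast
  from w(1) have "geom z (act \<alpha> w v) = act \<alpha> w (geom z v)" for v
    by (induction w) (auto simp: comm simple)
  then show "geom (z \<otimes>\<^bsub>G\<^esub> x) (\<alpha> i) = geom (x \<otimes>\<^bsub>G\<^esub> z) (\<alpha> i)"
    using geom_mult[OF z x] geom_mult[OF x z] geom_W[OF w(1)] w(2) by simp
qed (use z x in auto)

text \<open>Conjugating the reflection in \<open>a\<close> by \<open>z\<close> gives the reflection
  in \<open>geom z a\<close>. Centrality makes the two equal, so the vectors are proportional, and
  they have the same length.\<close>

lemma geom_central_sign:
  assumes z: "z \<in> carrier G" and central: "\<And>x. x \<in> carrier G \<Longrightarrow> z \<otimes>\<^bsub>G\<^esub> x = x \<otimes>\<^bsub>G\<^esub> z"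
    and a: "a \<in> roots"
  shows "geom z a = a \<or> geom z a = - a"
proof -
  define b where "b = geom z a"
  define c where "c = 2 * (a \<bullet> b) / (b \<bullet> b)"
  obtain r where r: "r \<in> carrier G" "geom r = refl_along a" using reflection_element[OF a] .
  have *: "refl_along b (geom z v) = refl_along a (geom z v)" for v
  proof -
    have "refl_along b (geom z v) = geom z (geom r v)"
      unfolding b_def r(2) by (rule orthogonal_transformation_refl_along_image[OF geom_orth, symmetric])
    also have "\<dots> = geom r (geom z v)"
      using central[OF r(1)] geom_mult[OF z r(1), of v] geom_mult[OF r(1) z, of v] by simp
    finally show ?thesis by (simp add: r(2))
  qed
  have "refl_along b v = refl_along a v" for v
  proof -
    obtain w where "v = geom z w" using orthogonal_transformation_surj[OF geom_orth, of z] by (metis surj_def)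
    then show ?thesis using * by simp
  qed
  then have "a - c *\<^sub>R b = - a" by (metis c_def refl_along_def refl_along_self)
  then have ab: "2 *\<^sub>R a = c *\<^sub>R b" by (simp add: scaleR_2 algebra_simps)
  have bb: "b \<bullet> b = a \<bullet> a" by (simp add: b_def geom_inner)
  have aa: "a \<bullet> a > 0" using norm_pos[OF a] .
  have "(2 *\<^sub>R a) \<bullet> (2 *\<^sub>R a) = (c *\<^sub>R b) \<bullet> (c *\<^sub>R b)" using ab by simp
  then have "c * c = 4" using bb aa by simp
  then have "(c - 2) * (c + 2) = 0" by (simp add: algebra_simps)
  then have "c = 2 \<or> c = -2" by (simp add: add_eq_0_iff2)
  then have "2 *\<^sub>R b = 2 *\<^sub>R a \<or> 2 *\<^sub>R b = 2 *\<^sub>R (- a)"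
    using ab by auto
  then show ?thesis unfolding real_vector.scale_cancel_left by (simp add: b_def)
qed

lemma geom_pow: "y \<in> carrier G \<Longrightarrow> geom (y [^]\<^bsub>G\<^esub> k) v = (geom y ^^ k) v" for k :: nat
  by (induction k arbitrary: v) (simp_all add: geom_one geom_mult funpow_swap1)

theorem hayashi_conj_quandle:
  assumes "conjugation_closed G C"
  shows "hayashi (conj_quandle G C)"
proof (rule hayashi_conj_quandleI[OF finite_G assms])
  fix y and n p q :: nat
  assume y: "y \<in> carrier G" and n: "0 < n"
    and central: "\<And>x. x \<in> carrier G \<Longrightarrow> y [^]\<^bsub>G\<^esub> n \<otimes>\<^bsub>G\<^esub> x = x \<otimes>\<^bsub>G\<^esub> y [^]\<^bsub>G\<^esub> n"
    and least: "\<And>k. 0 < k \<Longrightarrow> k < n \<Longrightarrow>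
      \<exists>x\<in>carrier G. y [^]\<^bsub>G\<^esub> k \<otimes>\<^bsub>G\<^esub> x \<noteq> x \<otimes>\<^bsub>G\<^esub> y [^]\<^bsub>G\<^esub> k"
    and pq: "prime p" "p dvd n" "prime q" "q dvd n" "p \<noteq> q"
  have pow: "geom (y [^]\<^bsub>G\<^esub> k) = geom y ^^ k" for k :: nat
    by (rule ext) (rule geom_pow[OF y])
  interpret root_automorphism roots "geom y" n
  proof
    show "orthogonal_transformation (geom y)" by (rule geom_orth)
    show "geom y a \<in> roots" if "a \<in> roots" for a using geom_root[OF y that] .
    show "0 < n" by (rule n)
    show "(geom y ^^ n) a = a \<or> (geom y ^^ n) a = - a" if "a \<in> roots" for a
      using geom_central_sign[OF _ central that] y by (simp add: pow)
    show "moved roots (geom y ^^ (n div p)) \<noteq> {}" if p: "prime p" "p dvd n" for p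
    proof
      assume "moved roots (geom y ^^ (n div p)) = {}"
      then have "moved roots (geom (y [^]\<^bsub>G\<^esub> (n div p))) = {}" by (simp add: pow)
      moreover have "0 < n div p" "n div p < n"
        using p n prime_gt_1_nat[OF p(1)] by (auto simp: dvd_imp_le div_greater_zero_iff)
      ultimately show False using least central_if_not_moved y by blast
    qed
  qed
  have "card roots \<le> 240"
    using card_mono[OF finite_R roots_subset_R] card_R by simp
  then obtain a where a: "a \<in> roots" and ne: "\<And>p. prime p \<Longrightarrow> p dvd n \<Longrightarrow>
    \<exists>v. (geom y ^^ (n div p)) (refl_along a (geom y (refl_along a v)))
         \<noteq> refl_along a (geom y (refl_along a ((geom y ^^ (n div p)) v)))"
    using conjugate_not_commuting[OF dim_le_8 _ pq] by blast
  obtain r where r: "r \<in> carrier G" "geom r = refl_along a" "inv\<^bsub>G\<^esub> r = r"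
    using reflection_element[OF a] .
  have "y [^]\<^bsub>G\<^esub> (n div p) \<otimes>\<^bsub>G\<^esub> conj_by r y \<noteq> conj_by r y \<otimes>\<^bsub>G\<^esub> y [^]\<^bsub>G\<^esub> (n div p)"
    if p: "prime p" "p dvd n" for p
  proof
    assume eq: "y [^]\<^bsub>G\<^esub> (n div p) \<otimes>\<^bsub>G\<^esub> conj_by r y = conj_by r y \<otimes>\<^bsub>G\<^esub> y [^]\<^bsub>G\<^esub> (n div p)"
    have g: "geom (conj_by r y) v = refl_along a (geom y (refl_along a v))" for v
      using r y by (simp add: conj_by_def geom_mult)
    have "geom (y [^]\<^bsub>G\<^esub> (n div p)) (geom (conj_by r y) v) = geom (conj_by r y) (geom (y [^]\<^bsub>G\<^esub> (n div p)) v)" for v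
      using eq r y by (simp flip: geom_mult)
    then show False using ne[OF p] by (simp add: g pow)
  qed
  then show "\<exists>r\<in>carrier G. \<forall>p. prime p \<longrightarrow> p dvd n \<longrightarrow>
      y [^]\<^bsub>G\<^esub> (n div p) \<otimes>\<^bsub>G\<^esub> conj_by r y \<noteq> conj_by r y \<otimes>\<^bsub>G\<^esub> y [^]\<^bsub>G\<^esub> (n div p)"
    using r(1) by blast
qed

end

section \<open>The root systems of types E, F and H\<close>

text \<open>
  The pair \<open>(a, b)\<close> stands for \<open>a + b \<phi>\<close> with the golden ratio \<open>\<phi>\<close>. A root is the list of its
  coefficients over the simple roots; the entry at index \<open>i\<close> belongs to the simple root \<open>Suc i\<close>.
\<close>

type_synonym zgolden = "int \<times> int"

text \<open>Multiplication in the ring generated by the golden ratio, whose square is itself plus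
  1.\<close>

fun zmul :: "zgolden \<Rightarrow> zgolden \<Rightarrow> zgolden" where
  "zmul (a, b) (c, d) = (a * c + b * d, a * d + b * c + b * d)"

text \<open>Row \<open>i\<close> is normalised by the length of the root \<open>i\<close>. For the
  label 4, occurring only in F4, the smaller node is the long root, whence -1 and -2; the label 5
  gives minus the golden ratio, -2 cos(pi/5).\<close>

definition cartan_entry :: "coxeter_type \<Rightarrow> nat \<Rightarrow> nat \<Rightarrow> zgolden" where
  "cartan_entry t i j = (if i = j then (2, 0) else
     let k = coxeter_matrix t i j in
     if k = 3 then (- 1, 0) else if k = 5 then (0, - 1)
     else if k = 4 then (if i < j then (- 1, 0) else (- 2, 0)) else (0, 0))"

definition zdot :: "zgolden list \<Rightarrow> zgolden list \<Rightarrow> zgolden" where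
  "zdot r v = foldr (\<lambda>(a, x) s. zmul a x + s) (zip r v) (0, 0)"

definition zrefl :: "nat \<Rightarrow> zgolden \<Rightarrow> zgolden list \<Rightarrow> zgolden list" where
  "zrefl i c v = v[i := v ! i - c]"

text \<open>The sign of a pair is not visible from its integer entries, so the nine Cartan values
  are listed by sign and membership replaces comparison.\<close>

definition zneg :: "zgolden list" where
  "zneg = [(-1, 0), (-2, 0), (0, -1), (1, -1)]"
definition znonneg :: "zgolden list" where
  "znonneg = [(0, 0), (1, 0), (2, 0), (0, 1), (-1, 1)]"

definition unit_vec :: "nat \<Rightarrow> nat \<Rightarrow> zgolden list" where
  "unit_vec n i = (replicate n (0, 0))[i := (1, 0)]"

text \<open>
  The levels enumerate the positive roots by depth. A simple reflection changes the depth of a root by at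
  most one and lowers it iff the Cartan integer is positive, so closure is tested one level back only.
\<close>

definition next_level :: "(nat \<times> zgolden list) list \<Rightarrow> zgolden list list \<Rightarrow> zgolden list list" where
  "next_level A vs = remdups (concat (map (\<lambda>v. concat (map (\<lambda>(i, r).
      let c = zdot r v in if c \<in> set zneg then [zrefl i c v] else []) A)) vs))"

fun levels :: "(nat \<times> zgolden list) list \<Rightarrow> nat \<Rightarrow> zgolden list list \<Rightarrow> zgolden list list" where
  "levels A 0 vs = []"
| "levels A (Suc k) vs = vs @ levels A k (next_level A vs)"

text \<open>\<open>us\<close> is the preceding level. A simple root goes to its negative under its
  own reflection, hence the exception for \<open>unit_vec\<close>. The clause \<open>vs = []\<close>
  certifies that the enumeration ended within the bound.\<close>

fun levels_closed :: "(nat \<times> zgolden list) list \<Rightarrow> nat \<Rightarrow> nat \<Rightarrow> zgolden list list \<Rightarrow> zgolden list list \<Rightarrow> bool" where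
  "levels_closed A n 0 us vs \<longleftrightarrow> vs = []"
| "levels_closed A n (Suc k) us vs \<longleftrightarrow>
    list_all (\<lambda>v. list_all (\<lambda>(i, r). let c = zdot r v in
      c \<in> set zneg \<or> c \<in> set znonneg \<and> (c = (0, 0) \<or> v = unit_vec n i \<or> zrefl i c v \<in> set us)) A) vs
    \<and> levels_closed A n k vs (next_level A vs)"

definition cartan_rows :: "coxeter_type \<Rightarrow> (nat \<times> zgolden list) list" where
  "cartan_rows t = map (\<lambda>i. (i, map (\<lambda>j. cartan_entry t (Suc i) (Suc j)) [0..<coxeter_rank t]))
      [0..<coxeter_rank t]"


section \<open>From coefficient lists to vectors\<close>

definition zval :: "zgolden \<Rightarrow> real" where
  "zval x = of_int (fst x) + of_int (snd x) * golden"

lemma zval_add: "zval (x + y) = zval x + zval y"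
  and zval_diff: "zval (x - y) = zval x - zval y"
  by (simp_all add: zval_def algebra_simps)

lemma zval_zmul: "zval (zmul x y) = zval x * zval y"
proof -
  have gg: "golden * (golden * z) = golden * z + z" for z
    using golden_sq by (simp add: mult.assoc[symmetric] distrib_right)
  show ?thesis by (cases x; cases y) (simp add: zval_def algebra_simps golden_sq gg)
qed

lemma zval_zdot:
  "length r = length v \<Longrightarrow> zval (zdot r v) = (\<Sum>j<length v. zval (r ! j) * zval (v ! j))"
proof (induction r v rule: list_induct2)
  case Nil
  then show ?case by (simp add: zdot_def zval_def)
next
  case (Cons x xs y ys)
  have "zdot (x # xs) (y # ys) = zmul x y + zdot xs ys" by (simp add: zdot_def)
  then show ?case
    using Cons by (simp add: zval_add zval_zmul sum.lessThan_Suc_shift del: sum.lessThan_Suc)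
qed

definition lincomb :: "(nat \<Rightarrow> 'v::real_inner) \<Rightarrow> zgolden list \<Rightarrow> 'v" where
  "lincomb \<alpha> v = (\<Sum>j<length v. zval (v ! j) *\<^sub>R \<alpha> (Suc j))"

lemma lincomb_zrefl:
  assumes "i < length v"
  shows "lincomb \<alpha> (zrefl i c v) = lincomb \<alpha> v - zval c *\<^sub>R \<alpha> (Suc i)"
proof -
  have "zval (v[i := v ! i - c] ! j) *\<^sub>R \<alpha> (Suc j)
      = zval (v ! j) *\<^sub>R \<alpha> (Suc j) - (if j = i then zval c *\<^sub>R \<alpha> (Suc i) else 0)" if "j < length v" for j
    using that by (auto simp: nth_list_update zval_diff scaleR_diff_left)
  then show ?thesis
    using assms by (simp add: lincomb_def zrefl_def sum_subtractf)
qed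

lemma lincomb_unit_vec: "i < n \<Longrightarrow> lincomb \<alpha> (unit_vec n i) = \<alpha> (Suc i)"
proof -
  assume i: "i < n"
  have "zval (unit_vec n i ! j) *\<^sub>R \<alpha> (Suc j) = (if j = i then \<alpha> (Suc i) else 0)" if "j < n" for j
    using that by (auto simp: unit_vec_def nth_list_update zval_def)
  then show ?thesis using i by (simp add: lincomb_def unit_vec_def)
qed

lemma zval_cartan_values:
  "c \<in> set zneg \<union> set znonneg \<Longrightarrow> zval c \<in> cartan_values"
  by (auto simp: zneg_def znonneg_def zval_def cartan_values_def)

lemma uminus_cartan_values: "- c \<in> cartan_values \<longleftrightarrow> c \<in> cartan_values"
proof -
  have "- c \<in> cartan_values" if "c \<in> cartan_values" for c
    using that by (auto simp: cartan_values_def)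
  from this[of c] this[of "- c"] show ?thesis by auto
qed

lemma levels_closed_imp_subset: "levels_closed A n k us vs \<Longrightarrow> set vs \<subseteq> set (levels A k vs)"
  by (cases k) auto

text \<open>A negative Cartan number leads to the next level by construction, a positive one to the
  preceding level by the check; together they make the union of the levels closed.\<close>

lemma levels_closedD:
  assumes "levels_closed A n k us vs" "v \<in> set (levels A k vs)" "(i, r) \<in> set A"
  shows "zdot r v \<in> set zneg \<union> set znonneg"
    and "zdot r v = (0, 0) \<or> v = unit_vec n i \<or> zrefl i (zdot r v) v \<in> set us \<union> set (levels A k vs)"
proof -
  have "zdot r v \<in> set zneg \<union> set znonneg \<and> (zdot r v = (0, 0) \<or> v = unit_vec n i
      \<or> zrefl i (zdot r v) v \<in> set us \<union> set (levels A k vs))"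
    using assms(1,2)
  proof (induction k arbitrary: us vs)
    case (Suc k)
    then have next_closed: "levels_closed A n k vs (next_level A vs)" by simp
    show ?case
    proof (cases "v \<in> set vs")
      case True
      then have v: "zdot r v \<in> set zneg \<or> zdot r v \<in> set znonneg
          \<and> (zdot r v = (0, 0) \<or> v = unit_vec n i \<or> zrefl i (zdot r v) v \<in> set us)"
        using Suc.prems(1) assms(3) by (auto simp: list_all_iff Let_def)
      show ?thesis
      proof (cases "zdot r v \<in> set zneg")
        case neg: True
        have "zrefl i (zdot r v) v \<in> set (next_level A vs)"
          unfolding next_level_def set_remdups set_concat set_map image_image
          by (rule UN_I[OF True], rule UN_I[OF assms(3)]) (simp add: neg Let_def)
        then show ?thesis using neg levels_closed_imp_subset[OF next_closed] by auto
      qed (use v in auto)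
    next
      case False
      then show ?thesis using Suc.IH[OF next_closed] Suc.prems(2) by auto
    qed
  qed simp
  then show "zdot r v \<in> set zneg \<union> set znonneg"
    "zdot r v = (0, 0) \<or> v = unit_vec n i \<or> zrefl i (zdot r v) v \<in> set us \<union> set (levels A k vs)" by auto
qed

lemma length_levels:
  assumes "\<And>v. v \<in> set vs \<Longrightarrow> length v = n" "v \<in> set (levels A k vs)"
  shows "length v = n"
  using assms
proof (induction k arbitrary: vs)
  case (Suc k)
  have "length w = n" if "w \<in> set (next_level A vs)" for w
    using that Suc.prems(1) by (auto simp: next_level_def zrefl_def Let_def split: if_splits)
  then show ?case using Suc by auto
qed simp

section \<open>Coordinates of the simple roots\<close>

text \<open>The numbering makes E6, E7 and H3 initial segments of the diagrams of E8 and H4, so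
  three systems suffice.\<close>

fun ambient :: "coxeter_type \<Rightarrow> coxeter_type" where
  "ambient E6 = E8" | "ambient E7 = E8" | "ambient E8 = E8"
| "ambient F4 = F4" | "ambient H3 = H4" | "ambient H4 = H4"

lemma range_ambient: "t \<in> range ambient \<Longrightarrow> t \<in> {E8, F4, H4}"
proof -
  assume "t \<in> range ambient"
  then obtain u where "t = ambient u" by blast
  then show ?thesis by (cases u) simp_all
qed

type_synonym vec8 = "real \<times> real \<times> real \<times> real \<times> real \<times> real \<times> real \<times> real"

text \<open>E8 and F4 are in Bourbaki coordinates. The H4 vectors are unit icosians doubled, which
  have coordinates integral over \<open>golden\<close> and squared length 4. Padding with zeros
  allows one type of dimension 8.\<close>

definition simple_roots :: "coxeter_type \<Rightarrow> vec8 list" where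
  "simple_roots t = (case t of
     F4 \<Rightarrow> [(0, 1, -1, 0, 0, 0, 0, 0), (0, 0, 1, -1, 0, 0, 0, 0), (0, 0, 0, 1, 0, 0, 0, 0),
            (1/2, -1/2, -1/2, -1/2, 0, 0, 0, 0)]
   | H4 \<Rightarrow> [(golden, -1, golden - 1, 0, 0, 0, 0, 0), (-golden, 1, golden - 1, 0, 0, 0, 0, 0),
            (1, golden - 1, -golden, 0, 0, 0, 0, 0), (-1, -golden, 0, golden - 1, 0, 0, 0, 0)]
   | _ \<Rightarrow> [(1/2, -1/2, -1/2, -1/2, -1/2, -1/2, -1/2, 1/2), (1, 1, 0, 0, 0, 0, 0, 0),
           (-1, 1, 0, 0, 0, 0, 0, 0), (0, -1, 1, 0, 0, 0, 0, 0), (0, 0, -1, 1, 0, 0, 0, 0),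
           (0, 0, 0, -1, 1, 0, 0, 0), (0, 0, 0, 0, -1, 1, 0, 0), (0, 0, 0, 0, 0, -1, 1, 0)])"

definition simple_root :: "coxeter_type \<Rightarrow> nat \<Rightarrow> vec8" where
  "simple_root t i = simple_roots t ! (i - 1)"

text \<open>For E8 this is the half sum of the positive roots, for F4 twice that; for H4 it is just
  a convenient vector inside the fundamental chamber.\<close>

definition positive_functional :: "coxeter_type \<Rightarrow> vec8" where
  "positive_functional t = (case t of
     F4 \<Rightarrow> (11, 5, 3, 1, 0, 0, 0, 0)
   | H4 \<Rightarrow> (5, 8, 5, 40, 0, 0, 0, 0)
   | _ \<Rightarrow> (0, 1, 2, 3, 4, 5, 6, 23))"

definition half_norm :: "coxeter_type \<Rightarrow> nat \<Rightarrow> real" where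
  "half_norm t i = (case t of F4 \<Rightarrow> (if i \<le> 2 then 1 else 1/2) | H4 \<Rightarrow> 2 | _ \<Rightarrow> 1)"

lemma less_8_cases: "(i::nat) < 8 \<Longrightarrow> i \<in> {0, 1, 2, 3, 4, 5, 6, 7}"
  and less_4_cases: "(i::nat) < 4 \<Longrightarrow> i \<in> {0, 1, 2, 3}"
  by auto

lemma simple_root_inner_0:
  assumes "t \<in> range ambient" "i < coxeter_rank t" "j < coxeter_rank t"
  shows "simple_root t (Suc j) \<bullet> simple_root t (Suc i)
    = zval (cartan_entry t (Suc i) (Suc j)) * half_norm t (Suc i)"
proof -
  have "t \<in> {E8, F4, H4}" by (rule range_ambient[OF assms(1)])
  then show ?thesis
  proof (elim insertE emptyE)
    assume t: "t = E8"
    then have "i \<in> {0, 1, 2, 3, 4, 5, 6, 7}" "j \<in> {0, 1, 2, 3, 4, 5, 6, 7}"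
      using assms less_8_cases by simp_all
    then show ?thesis unfolding t
      by (elim insertE emptyE; hypsubst;
          simp add: simple_root_def simple_roots_def cartan_entry_def coxeter_matrix_def zval_def half_norm_def)
  next
    assume t: "t = F4"
    then have "i \<in> {0, 1, 2, 3}" "j \<in> {0, 1, 2, 3}" using assms less_4_cases by simp_all
    then show ?thesis unfolding t
      by (elim insertE emptyE; hypsubst;
          simp add: simple_root_def simple_roots_def cartan_entry_def coxeter_matrix_def zval_def half_norm_def)
  next
    assume t: "t = H4"
    then have "i \<in> {0, 1, 2, 3}" "j \<in> {0, 1, 2, 3}" using assms less_4_cases by simp_all
    then show ?thesis unfolding t
      by (elim insertE emptyE; hypsubst;
          simp add: simple_root_def simple_roots_def cartan_entry_def coxeter_matrix_def zval_def half_norm_def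
            algebra_simps golden_sq)
  qed
qed

lemma half_norm_pos: "0 < half_norm t i"
  by (cases t) (simp_all add: half_norm_def)

lemma simple_root_inner:
  assumes "t \<in> range ambient" "i \<in> {1..coxeter_rank t}" "j \<in> {1..coxeter_rank t}"
  shows "simple_root t j \<bullet> simple_root t i = zval (cartan_entry t i j) * half_norm t i"
proof -
  obtain k l where "i = Suc k" "k < coxeter_rank t" "j = Suc l" "l < coxeter_rank t"
    using assms(2,3) by (cases i; cases j) auto
  then show ?thesis using simple_root_inner_0[OF assms(1), of k l] by simp
qed

lemma simple_root_cartan:
  assumes "t \<in> range ambient" "i \<in> {1..coxeter_rank t}" "j \<in> {1..coxeter_rank t}"
  shows "2 * (simple_root t j \<bullet> simple_root t i) / (simple_root t i \<bullet> simple_root t i)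
    = zval (cartan_entry t i j)"
proof -
  have "simple_root t i \<bullet> simple_root t i = 2 * half_norm t i"
    using simple_root_inner[OF assms(1,2,2)] by (simp add: cartan_entry_def zval_def)
  then show ?thesis using simple_root_inner[OF assms] half_norm_pos[of t i] by simp
qed

lemma coxeter_matrix_commute: "coxeter_matrix t i j = coxeter_matrix t j i"
  by (simp add: coxeter_matrix_def min.commute max.commute)

lemma coxeter_matrix_values: "i \<noteq> j \<Longrightarrow> coxeter_matrix t i j \<in> {2, 3, 4, 5}"
  by (cases t) (auto simp: coxeter_matrix_def)

lemma coxeter_matrix_ambient:
  assumes "i \<in> {1..coxeter_rank t}" "j \<in> {1..coxeter_rank t}"
  shows "coxeter_matrix (ambient t) i j = coxeter_matrix t i j"
proof -
  have "max i j \<le> coxeter_rank t" using assms by simp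
  then have "map_of (coxeter_diagram (ambient t)) (min i j, max i j)
      = map_of (coxeter_diagram t) (min i j, max i j)"
    by (cases t) auto
  then show ?thesis by (simp add: coxeter_matrix_def)
qed

lemma coxeter_rank_ambient: "coxeter_rank t \<le> coxeter_rank (ambient t)"
  by (cases t) auto

lemma simple_root_order:
  assumes "t \<in> range ambient" "i \<in> {1..coxeter_rank t}" "j \<in> {1..coxeter_rank t}" "i \<noteq> j"
  shows "cartan_order (simple_root t i) (simple_root t j) (coxeter_matrix t i j)"
  unfolding cartan_order_def simple_root_cartan[OF assms(1-3)] simple_root_cartan[OF assms(1,3,2)]
  using coxeter_matrix_values[OF assms(4), of t] assms(4)
  by (auto simp: cartan_entry_def zval_def coxeter_matrix_commute[of t j i] golden_sq)

lemma simple_root_obtuse: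
  assumes "t \<in> range ambient" "i \<in> {1..coxeter_rank t}" "j \<in> {1..coxeter_rank t}" "i \<noteq> j"
  shows "simple_root t i \<bullet> simple_root t j \<le> 0"
proof -
  have "zval (cartan_entry t j i) \<le> 0"
    using assms(4) golden_bounds by (auto simp: cartan_entry_def zval_def Let_def)
  then show ?thesis
    using simple_root_inner[OF assms(1,3,2)] half_norm_pos[of t j] by (simp add: mult_nonpos_nonneg)
qed

lemma simple_root_positive:
  assumes "t \<in> range ambient" "i \<in> {1..coxeter_rank t}"
  shows "0 < positive_functional t \<bullet> simple_root t i"
proof -
  define k where "k = i - 1"
  have i: "i = Suc k" "k < coxeter_rank t" using assms(2) by (auto simp: k_def)
  have "t \<in> {E8, F4, H4}" by (rule range_ambient[OF assms(1)])
  then show ?thesis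
  proof (elim insertE emptyE)
    assume t: "t = E8"
    then have "k \<in> {0, 1, 2, 3, 4, 5, 6, 7}" using i less_8_cases by simp
    then show ?thesis unfolding t i
      by (elim insertE emptyE; hypsubst; simp add: simple_root_def simple_roots_def positive_functional_def)
  next
    assume t: "t = F4"
    then have "k \<in> {0, 1, 2, 3}" using i less_4_cases by simp
    then show ?thesis unfolding t i
      by (elim insertE emptyE; hypsubst; simp add: simple_root_def simple_roots_def positive_functional_def)
  next
    assume t: "t = H4"
    then have "k \<in> {0, 1, 2, 3}" using i less_4_cases by simp
    then show ?thesis unfolding t i using golden_bounds
      by (elim insertE emptyE; hypsubst; simp add: simple_root_def simple_roots_def positive_functional_def)
  qed
qed

section \<open>The enumerated root systems\<close>

text \<open>The bound 30 is the Coxeter number of E8 and H4; the highest root of E8 has height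
  29.\<close>

definition positive_roots :: "coxeter_type \<Rightarrow> zgolden list list" where
  "positive_roots t = levels (cartan_rows t) 30 (map (unit_vec (coxeter_rank t)) [0..<coxeter_rank t])"

definition root_system :: "coxeter_type \<Rightarrow> vec8 set" where
  "root_system t = (let P = lincomb (simple_root t) ` set (positive_roots t) in P \<union> uminus ` P)"

lemma positive_roots_closed:
  assumes "t \<in> range ambient"
  shows "levels_closed (cartan_rows t) (coxeter_rank t) 30 []
    (map (unit_vec (coxeter_rank t)) [0..<coxeter_rank t])"
proof -
  have "levels_closed (cartan_rows E8) (coxeter_rank E8) 30 [] (map (unit_vec (coxeter_rank E8)) [0..<coxeter_rank E8])"
    by code_simp
  moreover have "levels_closed (cartan_rows F4) (coxeter_rank F4) 30 [] (map (unit_vec (coxeter_rank F4)) [0..<coxeter_rank F4])"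
    by code_simp
  moreover have "levels_closed (cartan_rows H4) (coxeter_rank H4) 30 [] (map (unit_vec (coxeter_rank H4)) [0..<coxeter_rank H4])"
    by code_simp
  moreover have "t \<in> {E8, F4, H4}" by (rule range_ambient[OF assms])
  ultimately show ?thesis by auto
qed

lemma length_positive_roots:
  assumes "t \<in> range ambient"
  shows "length (positive_roots t) \<le> 120"
proof -
  have "length (positive_roots E8) = 120" by code_simp
  moreover have "length (positive_roots F4) = 24" by code_simp
  moreover have "length (positive_roots H4) = 60" by code_simp
  moreover have "t \<in> {E8, F4, H4}" by (rule range_ambient[OF assms])
  ultimately show ?thesis by auto
qed

lemma finite_root_system: "finite (root_system t)"
  by (simp add: root_system_def Let_def)

lemma card_root_system:
  assumes "t \<in> range ambient"
  shows "card (root_system t) \<le> 240"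
proof -
  let ?P = "lincomb (simple_root t) ` set (positive_roots t)"
  have "card ?P \<le> 120"
    using card_image_le[of "set (positive_roots t)" "lincomb (simple_root t)"]
      card_length[of "positive_roots t"] length_positive_roots[OF assms] by simp
  moreover have "card (uminus ` ?P) \<le> card ?P" by (rule card_image_le) simp
  moreover have "card (root_system t) \<le> card ?P + card (uminus ` ?P)"
    unfolding root_system_def Let_def by (rule card_Un_le)
  ultimately show ?thesis by simp
qed

text \<open>The evaluated number \<open>zdot r v\<close> is the Cartan number of the vector
  \<open>lincomb\<close> of \<open>v\<close>, and \<open>zrefl\<close> is the reflection in
  coordinates, so the evaluated check transfers to real vectors.\<close>

lemma root_system_step:
  assumes t: "t \<in> range ambient" and i: "i < coxeter_rank t" and v: "v \<in> set (positive_roots t)"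
  shows "2 * (lincomb (simple_root t) v \<bullet> simple_root t (Suc i))
      / (simple_root t (Suc i) \<bullet> simple_root t (Suc i)) \<in> cartan_values" (is "?c \<in> _")
    and "refl_along (simple_root t (Suc i)) (lincomb (simple_root t) v) \<in> root_system t"
proof -
  let ?n = "coxeter_rank t" and ?\<alpha> = "simple_root t"
  define r where "r = map (\<lambda>j. cartan_entry t (Suc i) (Suc j)) [0..<?n]"
  have r: "(i, r) \<in> set (cartan_rows t)" using i by (auto simp: r_def cartan_rows_def)
  have len: "length v = ?n"
    using v unfolding positive_roots_def by (rule length_levels[rotated]) (auto simp: unit_vec_def)
  note D = levels_closedD[OF positive_roots_closed[OF t] v[unfolded positive_roots_def] r, folded positive_roots_def]
  have "?c = (\<Sum>j<?n. zval (v ! j) * (2 * (?\<alpha> (Suc j) \<bullet> ?\<alpha> (Suc i)) / (?\<alpha> (Suc i) \<bullet> ?\<alpha> (Suc i))))"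
    by (simp add: lincomb_def len inner_sum_left sum_distrib_left sum_divide_distrib mult_ac)
  also have "\<dots> = (\<Sum>j<?n. zval (v ! j) * zval (cartan_entry t (Suc i) (Suc j)))"
    by (intro sum.cong HOL.refl arg_cong2[where f = "(*)"] simple_root_cartan[OF t]) (use i in auto)
  also have "\<dots> = zval (zdot r v)"
    by (subst zval_zdot) (simp_all add: len r_def mult.commute)
  finally have c: "?c = zval (zdot r v)" .
  show "?c \<in> cartan_values" unfolding c by (rule zval_cartan_values[OF D(1)])
  have refl: "refl_along (?\<alpha> (Suc i)) (lincomb ?\<alpha> v) = lincomb ?\<alpha> (zrefl i (zdot r v) v)"
    unfolding refl_along_def c using i by (simp add: lincomb_zrefl len)
  from D(2) show "refl_along (?\<alpha> (Suc i)) (lincomb ?\<alpha> v) \<in> root_system t"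
  proof (elim disjE)
    assume "zdot r v = (0, 0)"
    then have "refl_along (?\<alpha> (Suc i)) (lincomb ?\<alpha> v) = lincomb ?\<alpha> v"
      unfolding refl_along_def c by (simp add: zval_def)
    then show ?thesis using v by (auto simp: root_system_def Let_def)
  next
    assume "v = unit_vec ?n i"
    then have "refl_along (?\<alpha> (Suc i)) (lincomb ?\<alpha> v) = - lincomb ?\<alpha> v"
      using i by (simp add: lincomb_unit_vec refl_along_self)
    then show ?thesis using v by (auto simp: root_system_def Let_def)
  next
    assume "zrefl i (zdot r v) v \<in> set [] \<union> set (positive_roots t)"
    then show ?thesis unfolding refl by (auto simp: root_system_def Let_def)
  qed
qed

lemma root_system_refl:
  assumes t: "t \<in> range ambient" and i: "i \<in> {1..coxeter_rank t}" and a: "a \<in> root_system t"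
  shows "2 * (a \<bullet> simple_root t i) / (simple_root t i \<bullet> simple_root t i) \<in> cartan_values"
    and "refl_along (simple_root t i) a \<in> root_system t"
proof -
  obtain k where k: "i = Suc k" "k < coxeter_rank t" using i by (cases i) auto
  obtain v where v: "v \<in> set (positive_roots t)"
    "a = lincomb (simple_root t) v \<or> a = - lincomb (simple_root t) v"
    using a by (auto simp: root_system_def Let_def)
  note step = root_system_step[OF t k(2) v(1), folded k(1)]
  show "2 * (a \<bullet> simple_root t i) / (simple_root t i \<bullet> simple_root t i) \<in> cartan_values"
    using v(2)
  proof
    assume "a = lincomb (simple_root t) v"
    then show ?thesis using step(1) by (simp only:)
  next
    assume "a = - lincomb (simple_root t) v"
    then show ?thesis
      using step(1) by (simp only: inner_minus_left mult_minus_right minus_divide_left[symmetric] uminus_cartan_values)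
  qed
  have minus: "- b \<in> root_system t" if "b \<in> root_system t" for b
    using that by (auto simp: root_system_def Let_def)
  show "refl_along (simple_root t i) a \<in> root_system t"
    using v(2)
  proof
    assume "a = lincomb (simple_root t) v"
    then show ?thesis using step(2) by (simp only:)
  next
    assume "a = - lincomb (simple_root t) v"
    then show ?thesis using minus[OF step(2)] by (simp only: linear_neg[OF linear_refl_along])
  qed
qed

lemma simple_root_in_root_system:
  assumes "t \<in> range ambient" "i \<in> {1..coxeter_rank t}"
  shows "simple_root t i \<in> root_system t"
proof -
  obtain k where k: "i = Suc k" "k < coxeter_rank t" using assms(2) by (cases i) auto
  have "unit_vec (coxeter_rank t) k \<in> set (positive_roots t)"
    using levels_closed_imp_subset[OF positive_roots_closed[OF assms(1)]] k
    unfolding positive_roots_def by auto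
  then show ?thesis
    using lincomb_unit_vec[OF k(2), of "simple_root t"] k(1)
    by (force simp: root_system_def Let_def)
qed

text \<open>All nodes are joined to one hub: the branch node 4 for type E, the end node 1 for the
  diagrams that are paths.\<close>

lemma simple_root_connected:
  assumes "i \<in> {1..coxeter_rank t}" "j \<in> {1..coxeter_rank t}"
  shows "(i, j) \<in> {(x, y). x \<in> {1..coxeter_rank t} \<and> y \<in> {1..coxeter_rank t}
    \<and> simple_root (ambient t) x \<bullet> simple_root (ambient t) y \<noteq> 0}\<^sup>*" (is "_ \<in> ?E\<^sup>*")
proof -
  have edge: "(x, y) \<in> ?E"
    if "x \<in> {1..coxeter_rank t}" "y \<in> {1..coxeter_rank t}" "3 \<le> coxeter_matrix t x y" for x y
  proof -
    have xy: "x \<in> {1..coxeter_rank (ambient t)}" "y \<in> {1..coxeter_rank (ambient t)}"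
      using that coxeter_rank_ambient[of t] by auto
    have "x \<noteq> y" using that(3) by (auto simp: coxeter_matrix_def)
    moreover have "3 \<le> coxeter_matrix (ambient t) y x"
      using that coxeter_matrix_ambient[OF that(1,2)] by (simp add: coxeter_matrix_commute)
    ultimately have "zval (cartan_entry (ambient t) y x) \<noteq> 0"
      using coxeter_matrix_values[of y x "ambient t"] golden_bounds
      by (auto simp: cartan_entry_def zval_def)
    then show ?thesis
      using that(1,2) simple_root_inner[OF _ xy(2,1)] half_norm_pos[of "ambient t" y] by auto
  qed
  have hub: "\<exists>h. \<forall>i\<in>{1..coxeter_rank t}. (i, h) \<in> ?E\<^sup>*"
  proof -
    have chain: "(x, h) \<in> ?E\<^sup>*"
      if "h \<le> x" "x \<le> coxeter_rank t" "1 \<le> h"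
        and "\<And>k. h \<le> k \<Longrightarrow> k < coxeter_rank t \<Longrightarrow> 3 \<le> coxeter_matrix t (Suc k) k" for x h
      using that(1,2)
    proof (induction x rule: dec_induct)
      case (step k)
      then have "(Suc k, k) \<in> ?E" using that by (intro edge) auto
      then show ?case using step by (meson Suc_leD converse_rtrancl_into_rtrancl)
    qed simp
    show ?thesis
    proof (cases "ambient t = E8")
      case True
      then have t: "t \<in> {E6, E7, E8}" by (cases t) auto
      have "3 \<le> coxeter_matrix t (Suc k) k" if "4 \<le> k" "k < coxeter_rank t" for k
      proof -
        have "k \<in> {4, 5, 6, 7}" using that t by auto
        then show ?thesis using that t by (auto simp: coxeter_matrix_def)
      qed
      then have ge4: "(x, 4) \<in> ?E\<^sup>*" if "4 \<le> x" "x \<le> coxeter_rank t" for x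
        using that chain[of 4 x] by simp
      have e: "(3, 4) \<in> ?E" "(2, 4) \<in> ?E" "(1, 3) \<in> ?E"
        by (rule edge; use t in \<open>auto simp: coxeter_matrix_def\<close>)+
      have "(x, 4) \<in> ?E\<^sup>*" if x: "x \<in> {1..coxeter_rank t}" for x
      proof -
        consider "x = 1" | "x = 2" | "x = 3" | "4 \<le> x"
          using x by (atomize_elim) auto
        then show ?thesis
        proof cases
          case 1
          have "(1, 4) \<in> ?E\<^sup>*" using e(3,1) by (rule rtrancl.rtrancl_into_rtrancl[OF r_into_rtrancl])
          then show ?thesis using 1 by simp
        next
          case 2
          then show ?thesis using e(2) by (simp only: r_into_rtrancl)
        next
          case 3
          then show ?thesis using e(1) by (simp only: r_into_rtrancl)
        next
          case 4
          then show ?thesis using ge4 x by simp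
        qed
      qed
      then show ?thesis by blast
    next
      case False
      then have t: "t \<in> {F4, H3, H4}" by (cases t) auto
      have "3 \<le> coxeter_matrix t (Suc k) k" if "1 \<le> k" "k < coxeter_rank t" for k
      proof -
        have "k \<in> {1, 2, 3}" using that t by auto
        then show ?thesis using that t by (auto simp: coxeter_matrix_def)
      qed
      then have "(x, 1) \<in> ?E\<^sup>*" if "x \<in> {1..coxeter_rank t}" for x
        using that chain[of 1 x] by simp
      then show ?thesis by blast
    qed
  qed
  then obtain h where h: "(i, h) \<in> ?E\<^sup>*" "(j, h) \<in> ?E\<^sup>*" using assms by blast
  have "sym (?E\<^sup>*)" by (rule sym_rtrancl) (auto simp: sym_def inner_commute)
  then show ?thesis using h by (meson rtrancl_trans symD)
qed

theorem theorem4p2: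
  fixes G :: "('g, 'x) monoid_scheme" and t :: coxeter_type and C :: "'g set"
  assumes "coxeter_group_of_type t G"
    and "conjugation_closed G C"
  shows "hayashi (conj_quandle G C)"
proof -
  let ?I = "{1..coxeter_rank t}" and ?a = "ambient t"
  obtain s where s: "coxeter_system G ?I s (coxeter_matrix t)"
    using assms(1) by (auto simp: coxeter_group_of_type_def)
  have a: "?a \<in> range ambient" by simp
  have I: "i \<in> {1..coxeter_rank ?a}" if "i \<in> ?I" for i
    using that coxeter_rank_ambient[of t] by auto
  \<comment> \<open>The relations are those of \<open>t\<close>, while vectors, functional and
    container of roots are taken from the ambient type.\<close>
  interpret finite_coxeter_reflection_group G ?I s "coxeter_matrix t"
    "simple_root ?a" "positive_functional ?a" "root_system ?a"
  proof
    show "coxeter_system G ?I s (coxeter_matrix t)" by (rule s)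
    show "coxeter_matrix t i i = 1" for i by (simp add: coxeter_matrix_def)
    show "cartan_order (simple_root ?a i) (simple_root ?a j) (coxeter_matrix t i j)"
      if "i \<in> ?I" "j \<in> ?I" "i \<noteq> j" for i j
      using simple_root_order[OF a I I] that coxeter_matrix_ambient[of i t j] by metis
    show "simple_root ?a i \<bullet> simple_root ?a j \<le> 0" if "i \<in> ?I" "j \<in> ?I" "i \<noteq> j" for i j
      using simple_root_obtuse[OF a I I] that by blast
    show "0 < positive_functional ?a \<bullet> simple_root ?a i" if "i \<in> ?I" for i
      using simple_root_positive[OF a I[OF that]] .
    show "(i, j) \<in> {(x, y). x \<in> ?I \<and> y \<in> ?I \<and> simple_root ?a x \<bullet> simple_root ?a y \<noteq> 0}\<^sup>*"
      if "i \<in> ?I" "j \<in> ?I" for i j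
      using simple_root_connected[OF that] .
    show "card (root_system ?a) \<le> 240" by (rule card_root_system[OF a])
    show "simple_root ?a i \<in> root_system ?a" if "i \<in> ?I" for i
      using simple_root_in_root_system[OF a I[OF that]] .
    show "refl_along (simple_root ?a i) v \<in> root_system ?a" if "i \<in> ?I" "v \<in> root_system ?a" for i v
      using root_system_refl(2)[OF a I[OF that(1)] that(2)] .
    show "2 * (v \<bullet> simple_root ?a i) / (simple_root ?a i \<bullet> simple_root ?a i) \<in> cartan_values"
      if "i \<in> ?I" "v \<in> root_system ?a" for i v
      using root_system_refl(1)[OF a I[OF that(1)] that(2)] .
  qed (simp_all add: finite_root_system)
  show ?thesis by (rule hayashi_conj_quandle[OF assms(2)])
qed

end
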